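(* Let $h$ be a non-constant regular Hausdorff function, and let $\gamma\in(0,\pi/2)$ be fixed. The following statements are equivalent. (i) $1-h(\lambda)\in\overline{\Sigma}_\gamma$ for all $\lambda\in\mathbb{D}$. (ii) For every complex Banach space $X$ and every power bounded operator $T$ on $X$, the operator $h(T)$ is Ritt of angle $\gamma$.
   Context: $\mathbb{D}=\{\lambda\in\mathbb{C}:|\lambda|<1\}$; $\Sigma_\beta=\{\lambda\in\mathbb{C}:|\arg\lambda|<\beta\}$ for $\beta\in(0,\pi]$; bars denote closures in $\mathbb{C}$. Regular Hausdorff function: $h(\lambda)=c_0+\sum_{n=1}^\infty c_n\lambda^n$, $\lambda\in\mathbb{D}$, where $c_0\ge0$ and there is a bounded positive Borel measure $\nu$ on $[0,1)$ such that $c_n=\int_{[0,1)}t^{n-1}\,\nu(dt)$ for $n\ge1$ (with the convention $0^0=1$) and $c_0+\int_{[0,1)}\frac{\nu(dt)}{1-t}=1$. In particular $c_n\ge0$ and $\sum_{n\ge0}c_n=1$. A bounded linear operator $T$ is power bounded if $\sup_{n\ge0}\|T^n\|<\infty$. For such $T$, $h(T):=\sum_{n=0}^\infty c_nT^n$ (norm convergent). A bounded operator $S$ on $X$ is a Ritt operator of angle $\omega\in[0,\pi/2)$ if its spectrum satisfies $\sigma(S)\subset\mathbb{D}\cup\{1\}$ and for every $\omega'\in(\omega,\pi)$ there is $C_{\omega'}\ge1$ with $\|(z-S)^{-1}\|\le C_{\omega'}/|z-1|$ for all $z\in\mathbb{C}\setminus(1-\overline{\Sigma}_{\omega'})$.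 *)

theory Defs
  imports "HOL-Analysis.Analysis" "HOL-Algebra.Module"
begin

section \<open>Regular Hausdorff functions\<close>

text \<open>
  \<open>c\<close> is the coefficient sequence of \<open>h\<close>; it is determined by \<open>h\<close>. The measure \<open>\<nu>\<close> lives on the
  Borel sets of \<open>[0,1)\<close>. The normalisation is stated with the nonnegative integral, so that it
  includes the integrability of \<open>1 / (1 - t)\<close>; and \<open>0 ^ 0 = 1\<close> holds for the library power.
\<close>

definition regular_hausdorff :: "(complex \<Rightarrow> complex) \<Rightarrow> (nat \<Rightarrow> real) \<Rightarrow> bool" where
  "regular_hausdorff h c \<longleftrightarrow>
     (\<forall>z\<in>ball 0 1. (\<lambda>n. complex_of_real (c n) * z ^ n) sums h z) \<and>
     0 \<le> c 0 \<and>
     (\<exists>\<nu> :: real measure.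
        finite_measure \<nu> \<and> sets \<nu> = sets (restrict_space borel {0..<1}) \<and>
        (\<forall>n\<ge>1. c n = (\<integral>t. t ^ (n - 1) \<partial>\<nu>)) \<and>
        ennreal (c 0) + (\<integral>\<^sup>+ t. ennreal (1 / (1 - t)) \<partial>\<nu>) = 1)"

section \<open>Sectors\<close>

text \<open>The vertex is excluded explicitly because the library sets \<open>Arg 0 = 0\<close>.\<close>

definition sector :: "real \<Rightarrow> complex set" where
  "sector \<beta> = {z. z \<noteq> 0 \<and> \<bar>Arg z\<bar> < \<beta>}"

section \<open>Complex Banach spaces\<close>

text \<open>
  Banach spaces are structures with an explicit carrier, so that one can quantify over all of them
  inside a formula. The fields \<open>mult\<close> and \<open>one\<close>, which \<^typ>\<open>('a, 'b) module\<close> inherits from rings,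
  are not constrained by the locale \<^locale>\<open>module\<close> and play no role.

  The formula can only range over carriers in one type. Taking this type to be
  \<^typ>\<open>'u + complex\<close> with \<open>'u\<close> an arbitrary type, every complex Banach space has an isometric
  copy in it (let \<open>'u\<close> be its own type), and the summand \<^typ>\<open>complex\<close> ensures that the
  type contains nonzero spaces whatever \<open>'u\<close> is.
\<close>

record 'b normed_module = "(complex, 'b) module" +
  vnorm :: "'b \<Rightarrow> real"

definition complex_ring :: "complex ring" where
  "complex_ring = \<lparr>carrier = UNIV, mult = (*), one = 1, zero = 0, add = (+)\<rparr>"

text \<open>The value outside the carrier is fixed because \<^locale>\<open>Metric_space\<close> requires a function that
  is nonnegative and symmetric on the whole type.\<close>

definition vdist :: "('b, 'm) normed_module_scheme \<Rightarrow> 'b \<Rightarrow> 'b \<Rightarrow> real" where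
  "vdist X x y = (if x \<in> carrier X \<and> y \<in> carrier X then vnorm X (x \<ominus>\<^bsub>X\<^esub> y) else 0)"

locale complex_normed_space = module complex_ring X for X (structure) +
  assumes vnorm_eq_0_iff: "x \<in> carrier X \<Longrightarrow> vnorm X x = 0 \<longleftrightarrow> x = \<zero>"
    and vnorm_triangle:
      "\<lbrakk>x \<in> carrier X; y \<in> carrier X\<rbrakk> \<Longrightarrow> vnorm X (x \<oplus> y) \<le> vnorm X x + vnorm X y"
    and vnorm_smult: "x \<in> carrier X \<Longrightarrow> vnorm X (a \<odot>\<^bsub>X\<^esub> x) = cmod a * vnorm X x"
begin

lemma smult_minus_one:
  assumes "x \<in> carrier X" shows "(-1) \<odot>\<^bsub>X\<^esub> x = \<ominus> x"
proof -
  have "x \<oplus> (-1) \<odot>\<^bsub>X\<^esub> x = (1 + (-1)) \<odot>\<^bsub>X\<^esub> x"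
    using smult_l_distr[of 1 "-1" x] smult_one[of x] assms by (simp add: complex_ring_def)
  also have "\<dots> = \<zero>"
  proof -
    have c: "0 \<odot>\<^bsub>X\<^esub> x \<in> carrier X"
      using smult_closed[of 0 x] assms by (simp add: complex_ring_def)
    have "vnorm X (0 \<odot>\<^bsub>X\<^esub> x) = 0"
      using vnorm_smult[of x 0] assms by simp
    then show ?thesis using vnorm_eq_0_iff[OF c] by simp
  qed
  finally have e: "x \<oplus> (-1) \<odot>\<^bsub>X\<^esub> x = \<zero>" .
  have "(-1) \<odot>\<^bsub>X\<^esub> x \<in> carrier X"
    using smult_closed[of "-1" x] assms by (simp add: complex_ring_def)
  then show ?thesis
    using e assms by (metis M.add.m_comm M.minus_equality)
qed

lemma vnorm_uminus: "x \<in> carrier X \<Longrightarrow> vnorm X (\<ominus> x) = vnorm X x"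
  using vnorm_smult[of x "-1"] smult_minus_one[of x] by simp

lemma vnorm_nonneg:
  assumes "x \<in> carrier X" shows "0 \<le> vnorm X x"
proof -
  have "vnorm X (x \<oplus> \<ominus> x) \<le> vnorm X x + vnorm X (\<ominus> x)"
    using assms by (intro vnorm_triangle) auto
  moreover have "vnorm X (x \<oplus> \<ominus> x) = 0"
    using assms vnorm_eq_0_iff[of \<zero>] by (simp add: M.r_neg)
  ultimately show ?thesis using vnorm_uminus[OF assms] by simp
qed

sublocale metric: Metric_space "carrier X" "vdist X"
proof
  fix x y
  show "0 \<le> vdist X x y" by (simp add: vdist_def vnorm_nonneg)
  show "vdist X x y = vdist X y x"
  proof (cases "x \<in> carrier X \<and> y \<in> carrier X")
    case True
    then have "\<ominus> (x \<ominus> y) = y \<ominus> x"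
      by (simp add: M.minus_eq M.minus_add M.add.m_comm)
    then show ?thesis
      using True vnorm_uminus[of "x \<ominus> y"] by (simp add: vdist_def)
  qed (auto simp: vdist_def)
next
  fix x y assume "x \<in> carrier X" "y \<in> carrier X"
  then show "vdist X x y = 0 \<longleftrightarrow> x = y"
    using vnorm_eq_0_iff[of "x \<ominus> y"] vnorm_eq_0_iff[of \<zero>]
    by (simp add: vdist_def) (metis M.minus_eq M.minus_minus M.minus_equality M.a_inv_closed M.r_neg)
next
  fix x y z assume c: "x \<in> carrier X" "y \<in> carrier X" "z \<in> carrier X"
  have "x \<ominus> z = (x \<ominus> y) \<oplus> (y \<ominus> z)"
    using c by (simp add: M.minus_eq M.a_assoc M.r_neg1 M.l_neg M.r_neg2)
  then show "vdist X x z \<le> vdist X x y + vdist X y z"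
    using c vnorm_triangle[of "x \<ominus> y" "y \<ominus> z"] by (simp add: vdist_def)
qed

end

locale complex_banach_space = complex_normed_space +
  assumes complete: "metric.mcomplete"

section \<open>Bounded operators\<close>

text \<open>
  An operator on \<open>X\<close> is a function of which only the values on the carrier matter; \<open>T ^^ n\<close> is its
  \<open>n\<close>-th power.
\<close>

definition bounded_op :: "('b, 'm) normed_module_scheme \<Rightarrow> ('b \<Rightarrow> 'b) \<Rightarrow> bool" where
  "bounded_op X T \<longleftrightarrow>
     T \<in> carrier X \<rightarrow> carrier X \<and>
     (\<forall>x\<in>carrier X. \<forall>y\<in>carrier X. T (x \<oplus>\<^bsub>X\<^esub> y) = T x \<oplus>\<^bsub>X\<^esub> T y) \<and>
     (\<forall>a. \<forall>x\<in>carrier X. T (a \<odot>\<^bsub>X\<^esub> x) = a \<odot>\<^bsub>X\<^esub> T x) \<and>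
     (\<exists>K. \<forall>x\<in>carrier X. vnorm X (T x) \<le> K * vnorm X x)"

definition op_norm :: "('b, 'm) normed_module_scheme \<Rightarrow> ('b \<Rightarrow> 'b) \<Rightarrow> real" where
  "op_norm X T = (SUP x\<in>{x \<in> carrier X. vnorm X x \<le> 1}. vnorm X (T x))"

definition power_bounded :: "('b, 'm) normed_module_scheme \<Rightarrow> ('b \<Rightarrow> 'b) \<Rightarrow> bool" where
  "power_bounded X T \<longleftrightarrow> bounded_op X T \<and> bdd_above (range (\<lambda>n. op_norm X (T ^^ n)))"

text \<open>
  The sum of \<open>\<Sum>n. c n T\<^sup>n\<close> in operator norm. Extensionality makes it unique as a function on the
  type; it exists if \<open>T\<close> is power bounded, \<open>X\<close> complete and \<open>c\<close> absolutely summable.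
\<close>

definition op_series ::
  "('b, 'm) normed_module_scheme \<Rightarrow> (nat \<Rightarrow> real) \<Rightarrow> ('b \<Rightarrow> 'b) \<Rightarrow> 'b \<Rightarrow> 'b" where
  "op_series X c T = (THE S. bounded_op X S \<and> S \<in> extensional (carrier X) \<and>
     (\<lambda>n. op_norm X (\<lambda>x. (\<Oplus>\<^bsub>X\<^esub>k\<in>{..<n}. complex_of_real (c k) \<odot>\<^bsub>X\<^esub> (T ^^ k) x) \<ominus>\<^bsub>X\<^esub> S x))
       \<longlonglongrightarrow> 0)"

definition resolvent ::
  "('b, 'm) normed_module_scheme \<Rightarrow> ('b \<Rightarrow> 'b) \<Rightarrow> complex \<Rightarrow> 'b \<Rightarrow> 'b" where
  "resolvent X S z = inv_into (carrier X) (\<lambda>x. z \<odot>\<^bsub>X\<^esub> x \<ominus>\<^bsub>X\<^esub> S x)"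

definition spectrum :: "('b, 'm) normed_module_scheme \<Rightarrow> ('b \<Rightarrow> 'b) \<Rightarrow> complex set" where
  "spectrum X S =
     {z. \<not> (bij_betw (\<lambda>x. z \<odot>\<^bsub>X\<^esub> x \<ominus>\<^bsub>X\<^esub> S x) (carrier X) (carrier X) \<and>
            bounded_op X (resolvent X S z))}"

text \<open>The resolvent bound presupposes that \<open>z\<close> belongs to the resolvent set.\<close>

definition ritt_operator ::
  "('b, 'm) normed_module_scheme \<Rightarrow> ('b \<Rightarrow> 'b) \<Rightarrow> real \<Rightarrow> bool" where
  "ritt_operator X S \<omega> \<longleftrightarrow>
     0 \<le> \<omega> \<and> \<omega> < pi / 2 \<and> bounded_op X S \<and>
     spectrum X S \<subseteq> ball 0 1 \<union> {1} \<and>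
     (\<forall>\<omega>'. \<omega> < \<omega>' \<and> \<omega>' < pi \<longrightarrow>
        (\<exists>C\<ge>1. \<forall>z. z \<notin> (\<lambda>w. 1 - w) ` closure (sector \<omega>') \<longrightarrow>
           z \<notin> spectrum X S \<and> op_norm X (resolvent X S z) \<le> C / cmod (z - 1)))"

end

theory Submission
  imports Defs "HOL-Complex_Analysis.Complex_Analysis"
begin

text \<open>
  The implication from (ii) to (i) is the one-dimensional case: on the space \<open>\<complex>\<close>, multiplication by
  a point \<open>w\<close> of the disc is power bounded and \<open>h(T)\<close> is multiplication by \<open>h w\<close>, so \<open>h w\<close> belongs to
  the spectrum of a Ritt operator of angle \<open>\<gamma>\<close>. This forces \<open>1 - h w\<close> into every closed sector
  of angle larger than \<open>\<gamma>\<close>, hence into the closed sector of angle \<open>\<gamma>\<close>.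

  For the converse, the resolvent of \<open>h(T)\<close> at \<open>z\<close> is \<open>f(T)\<close> with \<open>f = 1 / (z - h)\<close>, provided that the
  Taylor coefficients of \<open>f\<close> are absolutely summable, and its norm is at most a constant times
  \<open>\<Sum>n. \<bar>f\<^sub>n\<bar>\<close>. Everything therefore rests on an estimate of this sum by a multiple of
  \<open>1 / \<bar>1 - z\<bar>\<close>. By Hardy's inequality the sum is controlled by the integral of \<open>\<bar>f'\<bar>\<close> over circles, where
  \<open>f' = h' / (z - h)\<^sup>2\<close>. For a regular Hausdorff function, \<open>1 - h(w)\<close> is the product of \<open>1 - w\<close> and an
  integral of the kernels \<open>1 / (1 - t w)\<close>, and \<open>h'(w)\<close> is an integral of their squares. The kernels are comparable in size with their values at the
  real number \<open>1 - x\<close>, where \<open>x = \<bar>1 - w\<bar>\<close>. With \<open>\<psi>(x) = 1 - h(1 - x)\<close> one gets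
  \<open>\<bar>h'(w)\<bar> \<le> 2 \<psi>'(x)\<close> and \<open>\<psi>(x) \<le> \<surd>2 \<bar>1 - h(w)\<bar>\<close> (\<open>norm_deriv_h_le\<close> and \<open>norm_one_minus_h_ge\<close>).
  If \<open>\<bar>z - h\<bar> \<ge> \<kappa> (a + \<bar>1 - h\<bar>)\<close> on the disc, then \<open>\<bar>f'\<bar>\<close> is bounded by a multiple of
  \<open>\<psi>' / (a + \<psi>)\<^sup>2\<close>, which is the derivative of \<open>- 1 / (a + \<psi>)\<close>; so its integral is at most a multiple
  of \<open>1 / a\<close>, whatever \<open>h\<close> is (\<open>inverse_coefficients_bound\<close>).

  Such a lower bound for \<open>\<bar>z - h\<bar>\<close> is available in the two situations that the definition of a Ritt
  operator asks about. If \<open>1 - h\<close> has values in the closed sector of angle \<open>\<gamma>\<close> and \<open>1 - z\<close> lies outside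
  a larger closed sector, then the angle between \<open>1 - h\<close> and \<open>1 - z\<close> is bounded below, and one
  may take \<open>a = \<bar>1 - z\<bar>\<close> (\<open>sectors_separated\<close>). If \<open>\<bar>z\<bar> \<ge> 1\<close> and \<open>z \<noteq> 1\<close>, then \<open>h\<close> stays away from \<open>z\<close> by
  compactness, because on the closed disc \<open>\<bar>h\<bar> < 1\<close> except at the point \<open>1\<close>; the only regular
  Hausdorff functions violating this are \<open>1\<close>, which is constant, and \<open>h(w) = w\<close>, which does not
  satisfy (i) (\<open>far_outside_disc\<close>).
\<close>

section \<open>Hardy's inequality for derivatives that are squares\<close>

text \<open>The summand is dominated by four times the increment of \<open>arctan (sqrt (x / m))\<close> over \<open>[k, k + 1]\<close>, and
  this function is bounded by \<open>pi / 2\<close>.\<close>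

lemma sum_Hilbert_weights_le:
  fixes m :: real
  assumes m: "m \<ge> 1"
  shows "(\<Sum>k<N. sqrt m / (sqrt (real (Suc k)) * (m + real k))) \<le> 2 * pi"
proof -
  define g where "g x = arctan (sqrt (x / m))" for x
  have step: "sqrt m / (sqrt (real (Suc k)) * (m + real k)) \<le> 4 * (g (Suc k) - g k)" for k
  proof -
    have D: "(g has_real_derivative sqrt m / (2 * (sqrt x * (m + x)))) (at x)" if "x > 0" for x
    proof -
      have "x / m > 0" using that m by simp
      then have "(g has_real_derivative
          inverse (1 + (sqrt (x / m))\<^sup>2) * (inverse (sqrt (x / m)) / 2 * (1 / m))) (at x)"
        unfolding g_def using m by (auto intro!: derivative_eq_intros)
      moreover have "inverse (1 + (sqrt (x / m))\<^sup>2) = m / (m + x)"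
        using that m by (simp add: field_simps)
      moreover have "inverse (sqrt (x / m)) = sqrt m / sqrt x"
        by (simp add: real_sqrt_divide)
      ultimately have "(g has_real_derivative m / (m + x) * (sqrt m / sqrt x / 2 * (1 / m))) (at x)"
        by simp
      also have "m / (m + x) * (sqrt m / sqrt x / 2 * (1 / m)) = sqrt m / (2 * (sqrt x * (m + x)))"
        using m by simp
      finally show ?thesis .
    qed
    have "continuous_on {real k..real (Suc k)} g"
      unfolding g_def using m by (intro continuous_intros) auto
    moreover have "g differentiable (at x)" if "real k < x" for x
      using D[of x] that real_differentiable_def by force
    ultimately obtain l x where x: "real k < x" "x < real (Suc k)" "DERIV g x :> l"
        "g (Suc k) - g k = (real (Suc k) - k) * l"
      using MVT[of "real k" "real (Suc k)" g] by auto
    then have l: "g (Suc k) - g k = sqrt m / (2 * (sqrt x * (m + x)))"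
      using DERIV_unique[OF D[of x]] by simp
    have "sqrt x * (m + x) \<le> sqrt (real (Suc k)) * (2 * (m + real k))"
      using x m by (intro mult_mono) auto
    moreover have "0 < sqrt x * (m + x)" using x(1) m by (intro mult_pos_pos) auto
    ultimately have "sqrt m / (sqrt (real (Suc k)) * (2 * (m + real k))) \<le> sqrt m / (sqrt x * (m + x))"
      using m by (intro divide_left_mono mult_pos_pos) (use x in auto)
    also have "\<dots> = 2 * (sqrt m / (2 * (sqrt x * (m + x))))" by simp
    finally have "sqrt m / (sqrt (real (Suc k)) * (2 * (m + real k)))
        \<le> 2 * (g (Suc k) - g k)" unfolding l .
    moreover have "sqrt m / (sqrt (real (Suc k)) * (2 * (m + real k)))
        = sqrt m / (sqrt (real (Suc k)) * (m + real k)) / 2"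
      by (simp add: mult_ac)
    moreover have "x / 2 \<le> 2 * y \<Longrightarrow> x \<le> 4 * y" for x y :: real by simp
    ultimately show ?thesis by (simp only:)
  qed
  have "(\<Sum>k<N. sqrt m / (sqrt (real (Suc k)) * (m + real k))) \<le> (\<Sum>k<N. 4 * (g (Suc k) - g k))"
    by (intro sum_mono step)
  also have "\<dots> = 4 * (g N - g 0)"
    using sum_lessThan_telescope[of "\<lambda>k. g (real k)" N] by (simp only: sum_distrib_left[symmetric] of_nat_0)
  also have "\<dots> \<le> 2 * pi"
    using arctan_ubound[of "sqrt (N / m)"] by (simp add: g_def)
  finally show ?thesis .
qed

text \<open>This is the Schur test with the weights \<open>sqrt (j + 1)\<close>. The sharp constant would be \<open>pi\<close>.\<close>

lemma Hilbert_inequality: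
  fixes a :: "nat \<Rightarrow> real"
  shows "(\<Sum>j<N. \<Sum>k<N. a j * a k / real (Suc (j + k))) \<le> 2 * pi * (\<Sum>k<N. (a k)\<^sup>2)"
proof -
  define w where "w j k = sqrt (real (Suc j)) / (sqrt (real (Suc k)) * real (Suc (j + k)))" for j k
  have "a j * a k / real (Suc (j + k)) \<le> ((a j)\<^sup>2 * w j k + (a k)\<^sup>2 * w k j) / 2" for j k
  proof -
    define p q where "p = sqrt (real (Suc j))" and "q = sqrt (real (Suc k))"
    have pq: "p > 0" "q > 0" by (simp_all add: p_def q_def)
    \<comment> \<open>weighted inequality between the arithmetic and the geometric mean\<close>
    have "0 \<le> (a j * p - a k * q)\<^sup>2 / (p * q)" using pq by simp
    also have "\<dots> = (a j)\<^sup>2 * (p / q) + (a k)\<^sup>2 * (q / p) - 2 * (a j * a k)"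
      using pq by (simp add: power2_eq_square field_simps)
    finally have "a j * a k \<le> ((a j)\<^sup>2 * (p / q) + (a k)\<^sup>2 * (q / p)) / 2" by simp
    then have "a j * a k / real (Suc (j + k)) \<le>
        ((a j)\<^sup>2 * (p / q) + (a k)\<^sup>2 * (q / p)) / 2 / real (Suc (j + k))"
      by (intro divide_right_mono) auto
    also have "\<dots> = ((a j)\<^sup>2 * w j k + (a k)\<^sup>2 * w k j) / 2"
      by (simp add: w_def p_def q_def add_divide_distrib add.commute mult_ac)
    finally show ?thesis .
  qed
  then have "(\<Sum>j<N. \<Sum>k<N. a j * a k / real (Suc (j + k)))
      \<le> (\<Sum>j<N. \<Sum>k<N. ((a j)\<^sup>2 * w j k + (a k)\<^sup>2 * w k j) / 2)"
    by (intro sum_mono)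
  also have "\<dots> = ((\<Sum>j<N. \<Sum>k<N. (a j)\<^sup>2 * w j k) + (\<Sum>j<N. \<Sum>k<N. (a k)\<^sup>2 * w k j)) / 2"
    by (simp add: sum.distrib sum_divide_distrib[symmetric] add_divide_distrib)
  also have "(\<Sum>j<N. \<Sum>k<N. (a k)\<^sup>2 * w k j) = (\<Sum>j<N. \<Sum>k<N. (a j)\<^sup>2 * w j k)"
    by (rule sum.swap)
  also have "((\<Sum>j<N. \<Sum>k<N. (a j)\<^sup>2 * w j k) + (\<Sum>j<N. \<Sum>k<N. (a j)\<^sup>2 * w j k)) / 2
      = (\<Sum>j<N. (a j)\<^sup>2 * (\<Sum>k<N. w j k))"
    by (simp add: sum_distrib_left[symmetric])
  also have "\<dots> \<le> (\<Sum>j<N. (a j)\<^sup>2 * (2 * pi))"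
  proof (intro sum_mono mult_left_mono)
    fix j
    show "(\<Sum>k<N. w j k) \<le> 2 * pi"
      using sum_Hilbert_weights_le[of "real (Suc j)" N] by (simp add: w_def add.assoc)
  qed auto
  also have "\<dots> = 2 * pi * (\<Sum>k<N. (a k)\<^sup>2)"
    by (subst sum_distrib_right[symmetric]) (rule mult.commute)
  finally show ?thesis .
qed

lemma circle_Fourier_coefficient:
  fixes G :: "complex \<Rightarrow> complex" and r :: real
  assumes "G holomorphic_on ball 0 1" "0 < r" "r < 1"
  shows "((\<lambda>t. G (r * cis t) * cis (- (real k * t))) has_integral
           2 * pi * (fps_nth (fps_expansion G 0) k * r ^ k)) {0..2*pi}"
proof -
  have "continuous_on (cball 0 r) G" "G holomorphic_on ball 0 r"
    using assms by (auto intro!: holomorphic_on_imp_continuous_on intro: holomorphic_on_subset)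
  then have "((\<lambda>u. G u / (u - 0) ^ Suc k) has_contour_integral
      (2 * pi * \<i>) / fact k * (deriv ^^ k) G 0) (circlepath 0 r)"
    using assms by (intro Cauchy_has_contour_integral_higher_derivative_circlepath) auto
  then have "((\<lambda>u. G u / u ^ Suc k) has_contour_integral
      (2 * pi * \<i>) * fps_nth (fps_expansion G 0) k) (part_circlepath 0 r 0 (2 * pi))"
    by (simp add: circlepath_def fps_expansion_def)
  then have "((\<lambda>t. G (r * cis t) / (r * cis t) ^ Suc k * r * \<i> * cis t) has_integral
      (2 * pi * \<i>) * fps_nth (fps_expansion G 0) k) {0..2*pi}"
    by (subst (asm) has_contour_integral_part_circlepath_iff) auto
  then have "((\<lambda>t. G (r * cis t) / (r * cis t) ^ Suc k * r * \<i> * cis t * (r ^ k / \<i>)) has_integral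
      (2 * pi * \<i>) * fps_nth (fps_expansion G 0) k * (r ^ k / \<i>)) {0..2*pi}"
    by (rule has_integral_mult_left)
  moreover have "G (r * cis t) / (r * cis t) ^ Suc k * r * \<i> * cis t * (r ^ k / \<i>)
      = G (r * cis t) * cis (- (real k * t))" for t
  proof -
    have "cis (- (real k * t)) = inverse (cis t ^ k)"
      by (simp add: Complex.DeMoivre)
    then show ?thesis using assms by (simp add: field_simps power_mult_distrib)
  qed
  moreover have "(2 * pi * \<i>) * fps_nth (fps_expansion G 0) k * (r ^ k / \<i>) =
      2 * pi * (fps_nth (fps_expansion G 0) k * r ^ k)"
  proof -
    have "p * \<i> * q * (s / \<i>) = p * (q * s) * (\<i> / \<i>)" for p q s :: complex
      by (simp only: times_divide_eq_right times_divide_eq_left mult_ac)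
    then have "p * \<i> * q * (s / \<i>) = p * (q * s)" for p q s :: complex
      by (simp only: divide_self[OF complex_i_not_zero] mult_1_right)
    then show ?thesis by (simp only:)
  qed
  ultimately show ?thesis by (simp only:)
qed

lemma has_integral_cis_int:
  fixes m :: int
  shows "((\<lambda>t. cis (m * t)) has_integral (if m = 0 then 2 * pi else 0)) {0..2*pi}"
proof (cases "m = 0")
  case True
  then show ?thesis
    using has_integral_const_real[of "1::complex" 0 "2 * pi"] by (simp add: scaleR_conv_of_real)
next
  case False
  have "((\<lambda>t. cis (m * t)) has_integral
      (cis (m * (2 * pi)) / (\<i> * m) - cis (real_of_int m * 0) / (\<i> * m))) {0..2*pi}"
  proof (rule fundamental_theorem_of_calculus)
    fix t :: real
    have "((\<lambda>t. cis (m * t) / (\<i> * m)) has_vector_derivative cis (m * t)) (at t)"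
      unfolding cis_conv_exp using False
      by (auto intro!: derivative_eq_intros has_vector_derivative_real_field simp: mult_ac)
    then show "((\<lambda>t. cis (m * t) / (\<i> * m)) has_vector_derivative cis (m * t)) (at t within {0..2*pi})"
      by (rule has_vector_derivative_at_within)
  qed simp
  moreover have "cis (m * (2 * pi)) = 1"
    by (metis Ints_of_int cis_multiple_2pi mult.assoc mult.commute)
  ultimately show ?thesis using False by simp
qed

lemma Bessel_inequality_circle:
  fixes G :: "complex \<Rightarrow> complex" and r :: real
  assumes G: "G holomorphic_on ball 0 1" and r: "0 < r" "r < 1"
  shows "2 * pi * (\<Sum>k<N. (cmod (fps_nth (fps_expansion G 0) k) * r ^ k)\<^sup>2)
           \<le> integral {0..2*pi} (\<lambda>t. (cmod (G (r * cis t)))\<^sup>2)"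
proof -
  define g where "g k = fps_nth (fps_expansion G 0) k * r ^ k" for k
  define P where "P t = (\<Sum>k<N. g k * cis (real k * t))" for t
  have cnjP: "cnj (P t) = (\<Sum>k<N. cnj (g k) * cis (- (real k * t)))" for t
    by (simp add: P_def cis_cnj)
  have 1: "((\<lambda>t. G (r * cis t) * cnj (P t)) has_integral (\<Sum>k<N. cnj (g k) * (2 * pi * g k))) {0..2*pi}"
  proof -
    have "((\<lambda>t. \<Sum>k<N. cnj (g k) * (G (r * cis t) * cis (- (real k * t))))
        has_integral (\<Sum>k<N. cnj (g k) * (2 * pi * g k))) {0..2*pi}"
      using circle_Fourier_coefficient[OF G r]
      by (intro has_integral_sum has_integral_mult_right) (auto simp: g_def)
    then show ?thesis by (simp add: cnjP sum_distrib_left mult_ac)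
  qed
  have 2: "((\<lambda>t. P t * cnj (P t)) has_integral (\<Sum>k<N. cnj (g k) * (2 * pi * g k))) {0..2*pi}"
  proof -
    have "((\<lambda>t. \<Sum>k<N. \<Sum>j<N. cnj (g k) * (g j * cis ((int j - int k) * t))) has_integral
       (\<Sum>k<N. \<Sum>j<N. cnj (g k) * (g j * (if int j - int k = 0 then 2 * pi else 0)))) {0..2*pi}"
      by (intro has_integral_sum has_integral_mult_right has_integral_cis_int) auto
    moreover have "(\<Sum>k<N. \<Sum>j<N. cnj (g k) * (g j * (if int j - int k = 0 then 2 * pi else 0)))
        = (\<Sum>k<N. cnj (g k) * (2 * pi * g k))"
    proof (intro sum.cong refl)
      fix k assume "k \<in> {..<N}"
      have "(\<Sum>j<N. cnj (g k) * (g j * (if int j - int k = 0 then 2 * pi else 0)))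
          = (\<Sum>j<N. if j = k then cnj (g k) * (2 * pi * g k) else 0)"
        by (intro sum.cong) auto
      then show "(\<Sum>j<N. cnj (g k) * (g j * (if int j - int k = 0 then 2 * pi else 0)))
          = cnj (g k) * (2 * pi * g k)"
        using \<open>k \<in> {..<N}\<close> by (simp add: sum.delta)
    qed
    moreover have "(\<Sum>k<N. \<Sum>j<N. cnj (g k) * (g j * cis ((int j - int k) * t))) = P t * cnj (P t)" for t :: real
    proof -
      have "cis ((int j - int k) * t) = cis (real j * t) * cis (- (real k * t))" for j k
        by (simp add: cis_mult algebra_simps)
      then show ?thesis
        by (subst sum.swap, unfold cnjP, unfold P_def sum_product) (simp only: mult_ac)
    qed
    ultimately show ?thesis by simp
  qed
  have e: "(\<Sum>k<N. cnj (g k) * (2 * pi * g k)) =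
      of_real (2 * pi * (\<Sum>k<N. (cmod (fps_nth (fps_expansion G 0) k) * r ^ k)\<^sup>2))"
  proof -
    have "cnj (g k) * (2 * pi * g k) = of_real (2 * pi * (cmod (g k))\<^sup>2)" for k
      unfolding of_real_mult complex_norm_square by (simp add: mult_ac)
    moreover have "cmod (g k) = cmod (fps_nth (fps_expansion G 0) k) * r ^ k" for k
      using r by (simp add: g_def norm_mult norm_power)
    ultimately show ?thesis by (simp only: sum_distrib_left of_real_sum)
  qed
  \<comment> \<open>integrate \<open>0 \<le> \<bar>G - P\<bar>\<^sup>2\<close> for the Taylor polynomial \<open>P\<close>\<close>
  have "((\<lambda>t. 2 * Re (G (r * cis t) * cnj (P t)) - Re (P t * cnj (P t))) has_integral
      2 * Re (\<Sum>k<N. cnj (g k) * (2 * pi * g k)) - Re (\<Sum>k<N. cnj (g k) * (2 * pi * g k))) {0..2*pi}"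
    using 1 2 by (intro has_integral_diff has_integral_mult_right has_integral_Re)
  then have "((\<lambda>t. 2 * Re (G (r * cis t) * cnj (P t)) - Re (P t * cnj (P t))) has_integral
      2 * pi * (\<Sum>k<N. (cmod (fps_nth (fps_expansion G 0) k) * r ^ k)\<^sup>2)) {0..2*pi}"
    unfolding e by (simp add: mult.assoc)
  moreover have "continuous_on {0..2*pi} (\<lambda>t. (cmod (G (r * cis t)))\<^sup>2)"
    using r by (intro continuous_intros continuous_on_compose2[OF holomorphic_on_imp_continuous_on[OF G]])
       (auto simp: norm_mult)
  then have "((\<lambda>t. (cmod (G (r * cis t)))\<^sup>2) has_integral
      integral {0..2*pi} (\<lambda>t. (cmod (G (r * cis t)))\<^sup>2)) {0..2*pi}"
    by (intro integrable_integral integrable_continuous_interval)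
  moreover have "2 * Re (z * cnj w) - Re (w * cnj w) \<le> (cmod z)\<^sup>2" for z w :: complex
  proof -
    have "(cmod (z - w))\<^sup>2 = (cmod z)\<^sup>2 - (2 * Re (z * cnj w) - Re (w * cnj w))"
      unfolding cmod_power2 by (simp add: power2_eq_square algebra_simps)
    then show ?thesis using zero_le_power2[of "cmod (z - w)"] by linarith
  qed
  ultimately show ?thesis by (rule has_integral_le)
qed

text \<open>Write \<open>g\<close> for the coefficients of \<open>G\<close>. Since \<open>f' = G\<^sup>2\<close>, the coefficient \<open>f\<^bsub>n+1\<^esub>\<close> equals
  \<open>\<Sum>i\<le>n. g\<^sub>i g\<^bsub>n-i\<^esub> / (n + 1)\<close>. Hilbert's inequality bounds the sum of these by a multiple of \<open>\<Sum>k. \<bar>g\<^sub>k\<bar>\<^sup>2\<close>, and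
  Bessel's inequality bounds the latter by the integral of \<open>\<bar>G\<bar>\<^sup>2 = \<bar>f'\<bar>\<close>.\<close>

lemma Hardy_inequality_square:
  fixes f G :: "complex \<Rightarrow> complex" and r :: real
  assumes f: "f holomorphic_on ball 0 1" and G: "G holomorphic_on ball 0 1"
    and fG: "\<And>z. z \<in> ball 0 1 \<Longrightarrow> deriv f z = (G z)\<^sup>2"
    and r: "0 < r" "r < 1"
  shows "(\<Sum>n<N. cmod (fps_nth (fps_expansion f 0) (Suc n)) * r ^ n)
           \<le> integral {0..2*pi} (\<lambda>t. cmod (deriv f (r * cis t)))"
proof -
  define a where "a k = cmod (fps_nth (fps_expansion G 0) k) * r ^ k" for k
  have a0: "a k \<ge> 0" for k using r by (simp add: a_def)
  have "f has_fps_expansion fps_expansion f 0" "G has_fps_expansion fps_expansion G 0"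
    using f G by (auto intro!: has_fps_expansion_fps_expansion[of "ball 0 1"])
  then have fd: "deriv f has_fps_expansion fps_deriv (fps_expansion f 0)"
    and GG: "(\<lambda>z. G z * G z) has_fps_expansion fps_expansion G 0 * fps_expansion G 0"
    by (auto intro: has_fps_expansion_deriv has_fps_expansion_mult)
  have "eventually (\<lambda>z. deriv f z = G z * G z) (nhds 0)"
    using eventually_nhds_in_open[of "ball 0 1" "0::complex"]
    by (auto elim!: eventually_mono simp: fG power2_eq_square)
  with fd GG have that: "fps_deriv (fps_expansion f 0) = fps_expansion G 0 * fps_expansion G 0"
    by (intro fps_expansion_unique_complex[of "deriv f"]) (simp_all add: has_fps_expansion_cong)
  then have eq: "of_nat (Suc n) * fps_nth (fps_expansion f 0) (Suc n) =
      (\<Sum>i\<le>n. fps_nth (fps_expansion G 0) i * fps_nth (fps_expansion G 0) (n - i))" for n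
  proof -
    have "fps_nth (fps_deriv (fps_expansion f 0)) n = fps_nth (fps_expansion G 0 * fps_expansion G 0) n"
      by (simp only: that)
    then show ?thesis by (simp only: fps_deriv_nth fps_mult_nth atLeast0AtMost Suc_eq_plus1)
  qed
  have "cmod (fps_nth (fps_expansion f 0) (Suc n)) * r ^ n
      \<le> (\<Sum>i\<le>n. a i * a (n - i) / real (Suc (i + (n - i))))" for n
  proof -
    have "real (Suc n) * cmod (fps_nth (fps_expansion f 0) (Suc n)) * r ^ n =
        cmod (\<Sum>i\<le>n. fps_nth (fps_expansion G 0) i * fps_nth (fps_expansion G 0) (n - i)) * r ^ n"
      unfolding eq[symmetric] by (simp add: norm_mult del: of_nat_Suc)
    also have "\<dots> \<le> (\<Sum>i\<le>n. cmod (fps_nth (fps_expansion G 0) i) * cmod (fps_nth (fps_expansion G 0) (n - i))) * r ^ n"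
      using r by (intro mult_right_mono sum_norm_le) (auto simp: norm_mult)
    also have "\<dots> = (\<Sum>i\<le>n. a i * a (n - i))"
    proof -
      have "r ^ n = r ^ i * r ^ (n - i)" if "i \<le> n" for i
        using that by (simp flip: power_add)
      then show ?thesis unfolding a_def sum_distrib_right by (intro sum.cong) (simp_all add: mult_ac)
    qed
    finally have "cmod (fps_nth (fps_expansion f 0) (Suc n)) * r ^ n
        \<le> (\<Sum>i\<le>n. a i * a (n - i)) / real (Suc n)"
      by (simp add: field_simps del: of_nat_Suc)
    then show ?thesis by (simp add: sum_divide_distrib)
  qed
  then have "(\<Sum>n<N. cmod (fps_nth (fps_expansion f 0) (Suc n)) * r ^ n)
      \<le> (\<Sum>n<N. \<Sum>i\<le>n. a i * a (n - i) / real (Suc (i + (n - i))))"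
    by (intro sum_mono)
  also have "\<dots> = (\<Sum>(i,j)\<in>{(i,j). i + j < N}. a i * a j / real (Suc (i + j)))"
    by (rule sum.triangle_reindex[symmetric])
  also have "\<dots> \<le> (\<Sum>(i,j)\<in>{..<N} \<times> {..<N}. a i * a j / real (Suc (i + j)))"
    using a0 by (intro sum_mono2) auto
  also have "\<dots> = (\<Sum>i<N. \<Sum>j<N. a i * a j / real (Suc (i + j)))"
    by (rule sum.cartesian_product[symmetric])
  also have "\<dots> \<le> 2 * pi * (\<Sum>k<N. (a k)\<^sup>2)"
    by (rule Hilbert_inequality)
  also have "\<dots> \<le> integral {0..2*pi} (\<lambda>t. (cmod (G (r * cis t)))\<^sup>2)"
    unfolding a_def by (rule Bessel_inequality_circle[OF G r])
  also have "\<dots> = integral {0..2*pi} (\<lambda>t. cmod (deriv f (r * cis t)))"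
    using r by (intro integral_cong) (simp add: fG norm_mult norm_power)
  finally show ?thesis .
qed

section \<open>Integral representation of regular Hausdorff functions\<close>

lemma norm_scaled_le:
  fixes z :: complex
  assumes "0 \<le> t" "t < 1"
  shows "cmod (of_real t * z) \<le> cmod z"
  using assms mult_left_le_one_le[of "cmod z" t] by (simp add: norm_mult)

lemma one_minus_norm_le_kernel:
  assumes "0 \<le> t" "t < 1"
  shows "1 - cmod z \<le> cmod (1 - of_real t * z)"
  using norm_scaled_le[OF assms, of z] norm_triangle_ineq2[of 1 "of_real t * z"] by simp

lemma kernel_le:
  assumes "0 \<le> t" "t < 1"
  shows "cmod (1 - of_real t * z) \<le> 1 - t + t * cmod (1 - z)"
proof -
  have "1 - of_real t * z = of_real (1 - t) + of_real t * (1 - z)" by (simp add: algebra_simps)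
  then show ?thesis
    using norm_triangle_ineq[of "of_real (1 - t)" "of_real t * (1 - z)"] assms
    by (simp add: norm_mult del: of_real_diff)
qed

text \<open>The cross term in the expansion of \<open>\<bar>(1 - t) + t (1 - z)\<bar>\<^sup>2\<close> is nonnegative because \<open>1 - z\<close> has positive
  real part. So the kernels \<open>1 / (1 - t z)\<close> at \<open>z\<close> and at the real point \<open>1 - \<bar>1 - z\<bar>\<close> are comparable,
  uniformly in \<open>t\<close>; the other inequality is \<open>kernel_le\<close>.\<close>

lemma kernel_ge:
  assumes t: "0 \<le> t" "t < 1" and z: "cmod z < 1"
  shows "0 < 1 - t + t * cmod (1 - z)"
    and "(1 - t + t * cmod (1 - z))\<^sup>2 \<le> 2 * (cmod (1 - of_real t * z))\<^sup>2"
proof -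
  show "0 < 1 - t + t * cmod (1 - z)" using t by (intro add_pos_nonneg) auto
  have "0 \<le> 1 - Re z" using complex_Re_le_cmod[of z] z by simp
  then have m: "0 \<le> 2 * (1 - t) * t * (1 - Re z)" using t by (intro mult_nonneg_nonneg) auto
  have "(cmod (1 - of_real t * z))\<^sup>2 = (1 - t)\<^sup>2 + (t * cmod (1 - z))\<^sup>2 + 2 * (1 - t) * t * (1 - Re z)"
    unfolding power_mult_distrib cmod_power2 by (simp add: power2_eq_square algebra_simps)
  with m have "(1 - t)\<^sup>2 + (t * cmod (1 - z))\<^sup>2 \<le> (cmod (1 - of_real t * z))\<^sup>2" by simp
  moreover have "(p + q)\<^sup>2 \<le> 2 * (p\<^sup>2 + q\<^sup>2)" for p q :: real
    using zero_le_power2[of "p - q"] by (simp add: power2_eq_square algebra_simps)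
  ultimately show "(1 - t + t * cmod (1 - z))\<^sup>2 \<le> 2 * (cmod (1 - of_real t * z))\<^sup>2"
    by (meson mult_left_mono order_trans zero_le_numeral)
qed

lemma kernel_nonzero:
  assumes "0 \<le> t" "t < 1" "cmod z < 1"
  shows "1 - of_real t * z \<noteq> 0"
  using kernel_ge[OF assms] by (auto simp: power2_eq_square mult_le_0_iff)

text \<open>With \<open>w = 1 - z\<close> and \<open>d = 1 - t z = (1 - t) + t w\<close>, all three terms of the expansion of \<open>w (cnj d)\<^sup>2\<close>
  have nonnegative real part. Integrating over \<open>t\<close> shows that \<open>h'\<close> has no zeros, so that \<open>h'\<close> is the
  square of a holomorphic function, as Hardy's inequality requires.\<close>

lemma kernel_square_half_plane:
  assumes t: "0 \<le> t" "t < 1" and z: "cmod z < 1"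
  shows "0 < Re ((1 - z) * (1 / (1 - of_real t * z)\<^sup>2))"
proof -
  define w where "w = 1 - z"
  have "0 < 1 - Re z" using complex_Re_le_cmod[of z] z by simp
  then have w: "0 < Re w" by (simp add: w_def)
  have d: "1 - of_real t * z = of_real (1 - t) + of_real t * w" by (simp add: w_def algebra_simps)
  have "w * cnj ((1 - of_real t * z)\<^sup>2) =
      of_real ((1 - t)\<^sup>2) * w + of_real (2 * (1 - t) * t) * (w * cnj w) + of_real (t\<^sup>2) * (w * cnj w) * cnj w"
    unfolding d by (simp add: power2_eq_square algebra_simps)
  also have "w * cnj w = of_real ((cmod w)\<^sup>2)" by (rule complex_norm_square[symmetric])
  finally have "Re (w * cnj ((1 - of_real t * z)\<^sup>2)) =
      (1 - t)\<^sup>2 * Re w + 2 * (1 - t) * t * (cmod w)\<^sup>2 + t\<^sup>2 * (cmod w)\<^sup>2 * Re w"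
    by (simp add: mult.assoc del: of_real_mult of_real_power of_real_diff flip: of_real_mult)
  also have "\<dots> > 0" using t w by (intro add_pos_nonneg) auto
  finally have "0 < Re (w / (1 - of_real t * z)\<^sup>2)" by (simp only: Re_complex_div_gt_0)
  then show ?thesis by (simp add: w_def)
qed

text \<open>The values of the kernel for fixed \<open>z\<close> lie in one quadrant, hence a common direction.\<close>

text \<open>For fixed \<open>z\<close> the values of \<open>1 / (1 - t z)\<close> lie in one quadrant. Projecting them to the
  diagonal of that quadrant, by means of the factor \<open>v\<close>, shows that no cancellation occurs when they are integrated over \<open>t\<close>.\<close>

lemma kernel_quadrant:
  assumes z: "cmod z < 1"
  obtains v where "cmod v = sqrt 2"
    and "\<And>t. 0 \<le> t \<Longrightarrow> t < 1 \<Longrightarrow> 1 / cmod (1 - of_real t * z) \<le> Re (v / (1 - of_real t * z))"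
proof
  define v where "v = Complex 1 (if Im z \<ge> 0 then -1 else 1)"
  show "cmod v = sqrt 2" by (simp add: v_def cmod_def)
  fix t :: real assume t: "0 \<le> t" "t < 1"
  define d where "d = 1 - of_real t * z"
  have dn: "d \<noteq> 0" using kernel_nonzero[OF t z] by (simp add: d_def)
  have "t * Re z \<le> t * 1" using t complex_Re_le_cmod[of z] z by (intro mult_left_mono) auto
  then have "Re d \<ge> 0" using t by (simp add: d_def)
  moreover have "Im v * Im d = \<bar>Im d\<bar>"
    using t by (cases "Im z \<ge> 0") (simp_all add: v_def d_def abs_mult)
  ultimately have "cmod d \<le> Re v * Re d + Im v * Im d"
    using cmod_le[of d] by (simp add: v_def)
  then have "cmod d / (cmod d)\<^sup>2 \<le> (Re v * Re d + Im v * Im d) / (cmod d)\<^sup>2"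
    by (intro divide_right_mono) auto
  also have "\<dots> = Re (v / d)" by (simp add: Re_divide cmod_power2)
  finally show "1 / cmod (1 - of_real t * z) \<le> Re (v / (1 - of_real t * z))"
    using dn by (simp add: d_def[symmetric] power2_eq_square)
qed

text \<open>Fixing one representing measure makes estimates for \<open>h\<close> and \<open>h'\<close> a matter of estimates for the
  kernels, pointwise in \<open>t\<close>.\<close>

locale hausdorff_representation =
  fixes h :: "complex \<Rightarrow> complex" and c :: "nat \<Rightarrow> real" and \<nu> :: "real measure"
  assumes h_sums: "\<And>z. z \<in> ball 0 1 \<Longrightarrow> (\<lambda>n. complex_of_real (c n) * z ^ n) sums h z"
    and c0_nonneg: "0 \<le> c 0"
    and finite: "finite_measure \<nu>"
    and sets_eq: "sets \<nu> = sets (restrict_space borel {0..<1})"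
    and moments: "\<And>n. c (Suc n) = (\<integral>t. t ^ n \<partial>\<nu>)"
    and mass: "ennreal (c 0) + (\<integral>\<^sup>+ t. ennreal (1 / (1 - t)) \<partial>\<nu>) = 1"
begin

lemma space_eq: "space \<nu> = {0..<1}"
  using sets_eq_imp_space_eq[OF sets_eq] by (simp add: space_restrict_space)

lemma measurable_borel [measurable (raw)]:
  assumes "f \<in> borel_measurable borel"
  shows "f \<in> borel_measurable \<nu>"
  using measurable_restrict_space1[OF assms, of "{0..<1}"] measurable_cong_sets[OF sets_eq refl] by blast

lemma integrable_bounded:
  fixes f :: "real \<Rightarrow> 'a::{banach, second_countable_topology}"
  assumes "f \<in> borel_measurable borel" "\<And>t. 0 \<le> t \<Longrightarrow> t < 1 \<Longrightarrow> norm (f t) \<le> B"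
  shows "integrable \<nu> f"
  using assms measurable_borel
  by (intro finite_measure.integrable_const_bound[OF finite, of f B]) (auto simp: space_eq)

lemma integral_mono_unit:
  fixes f g :: "real \<Rightarrow> real"
  assumes "integrable \<nu> f" "integrable \<nu> g" "\<And>t. 0 \<le> t \<Longrightarrow> t < 1 \<Longrightarrow> f t \<le> g t"
  shows "(\<integral>t. f t \<partial>\<nu>) \<le> (\<integral>t. g t \<partial>\<nu>)"
  using assms by (intro integral_mono) (auto simp: space_eq)

lemma integrable_power: "integrable \<nu> (\<lambda>t. t ^ n)"
  by (rule integrable_bounded[where B=1]) (auto simp: power_le_one)

lemma coeff_nonneg: "0 \<le> c n"
  using c0_nonneg moments by (cases n) (auto intro!: integral_nonneg_AE AE_I2 simp: space_eq)

lemma coeff_Suc_antimono: "m \<le> n \<Longrightarrow> c (Suc n) \<le> c (Suc m)"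
  unfolding moments by (intro integral_mono_unit integrable_power power_decreasing) auto

lemma mass_sums: "(\<lambda>n. ennreal (c (Suc n))) sums (\<integral>\<^sup>+ t. ennreal (1 / (1 - t)) \<partial>\<nu>)"
proof -
  have "(\<integral>\<^sup>+ t. ennreal (1 / (1 - t)) \<partial>\<nu>) = (\<integral>\<^sup>+ t. (\<Sum>n. ennreal (t ^ n)) \<partial>\<nu>)"
  proof (intro nn_integral_cong)
    fix t assume t: "t \<in> space \<nu>"
    then have "(\<lambda>n. t ^ n) sums (1 / (1 - t))" by (intro geometric_sums) (auto simp: space_eq)
    then show "ennreal (1 / (1 - t)) = (\<Sum>n. ennreal (t ^ n))"
      using t by (subst suminf_ennreal_eq) (auto simp: space_eq)
  qed
  also have "\<dots> = (\<Sum>n. \<integral>\<^sup>+ t. ennreal (t ^ n) \<partial>\<nu>)"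
    by (intro nn_integral_suminf measurable_compose[OF _ measurable_ennreal] measurable_borel) auto
  also have "\<dots> = (\<Sum>n. ennreal (c (Suc n)))"
    unfolding moments
    by (intro arg_cong[where f=suminf] ext nn_integral_eq_integral integrable_power AE_I2)
       (auto simp: space_eq)
  finally show ?thesis by (simp add: summableI summable_sums)
qed

lemma coeff_sums: "c sums 1"
proof -
  have fin: "(\<Sum>n. ennreal (c (Suc n))) \<noteq> \<infinity>"
    unfolding sums_unique[OF mass_sums, symmetric] using mass by (auto simp: infinity_ennreal_def)
  then have s: "summable (\<lambda>n. c (Suc n))"
    by (intro summable_suminf_not_top) (auto simp: coeff_nonneg infinity_ennreal_def)
  then have "ennreal (c 0) + ennreal (\<Sum>n. c (Suc n)) = 1"
    using mass unfolding sums_unique[OF mass_sums] suminf_ennreal2[OF coeff_nonneg s] by simp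
  moreover have nn: "0 \<le> (\<Sum>n. c (Suc n))" by (intro suminf_nonneg s coeff_nonneg)
  ultimately have "ennreal (c 0 + (\<Sum>n. c (Suc n))) = ennreal 1"
    using c0_nonneg by (simp add: ennreal_plus)
  then have "c 0 + (\<Sum>n. c (Suc n)) = 1"
    using c0_nonneg nn by (subst (asm) ennreal_inj) auto
  moreover have "c sums ((\<Sum>n. c (Suc n)) + c 0)"
    using summable_sums[OF s] by (simp add: sums_Suc_iff)
  ultimately show ?thesis by (simp add: add.commute)
qed

lemma integrable_inverse: "integrable \<nu> (\<lambda>t. 1 / (1 - t))"
  and integral_inverse: "(\<integral>t. 1 / (1 - t) \<partial>\<nu>) = 1 - c 0"
proof -
  have fin: "(\<integral>\<^sup>+ t. ennreal (1 / (1 - t)) \<partial>\<nu>) < \<infinity>"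
    using mass by (auto simp: infinity_ennreal_def less_top[symmetric])
  show i: "integrable \<nu> (\<lambda>t. 1 / (1 - t))"
    using fin by (intro integrableI_nonneg measurable_borel AE_I2) (auto simp: space_eq)
  have "(\<integral>\<^sup>+ t. ennreal (1 / (1 - t)) \<partial>\<nu>) = ennreal (\<integral>t. 1 / (1 - t) \<partial>\<nu>)"
    using i by (intro nn_integral_eq_integral AE_I2) (auto simp: space_eq)
  moreover have nn: "0 \<le> (\<integral>t. 1 / (1 - t) \<partial>\<nu>)"
    by (intro integral_nonneg_AE AE_I2) (auto simp: space_eq)
  ultimately have "ennreal (c 0 + (\<integral>t. 1 / (1 - t) \<partial>\<nu>)) = ennreal 1"
    using mass c0_nonneg by (simp add: ennreal_plus)
  then have "c 0 + (\<integral>t. 1 / (1 - t) \<partial>\<nu>) = 1"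
    using c0_nonneg nn by (subst (asm) ennreal_inj) auto
  then show "(\<integral>t. 1 / (1 - t) \<partial>\<nu>) = 1 - c 0" by simp
qed

text \<open>Interchange of sum and integral; the moments are bounded by \<open>c 1\<close>. The lemma is used with \<open>a n = 1\<close> for \<open>h\<close>
  and with \<open>a n = n + 1\<close> for \<open>h'\<close>.\<close>

lemma moment_series:
  fixes z :: complex and a :: "nat \<Rightarrow> real"
  assumes a: "\<And>n. 0 \<le> a n" and s: "summable (\<lambda>n. a n * cmod z ^ n)"
  shows "(\<lambda>n. of_real (a n * c (Suc n)) * z ^ n) sums (\<integral>t. (\<Sum>n. of_real (a n) * (of_real t * z) ^ n) \<partial>\<nu>)"
proof -
  have int: "integrable \<nu> (\<lambda>t. of_real (a n) * (of_real t * z) ^ n)" for n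
  proof (rule integrable_bounded[where B="a n * cmod z ^ n"])
    fix t :: real assume t: "0 \<le> t" "t < 1"
    have "a n * cmod z ^ n * t ^ n \<le> a n * cmod z ^ n * 1"
      using t a by (intro mult_left_mono power_le_one) auto
    then show "norm (of_real (a n) * (of_real t * z) ^ n) \<le> a n * cmod z ^ n"
      using t a by (simp add: norm_mult norm_power power_mult_distrib mult_ac)
  qed measurable
  have n: "norm (of_real (a n) * (of_real t * z) ^ n) = a n * cmod z ^ n * t ^ n" if "t \<in> space \<nu>" for t n
    using that a by (simp add: space_eq norm_mult norm_power power_mult_distrib mult_ac)
  have "(\<integral>t. norm (of_real (a n) * (of_real t * z) ^ n) \<partial>\<nu>) = a n * cmod z ^ n * c (Suc n)" for n
  proof -
    have "(\<integral>t. norm (of_real (a n) * (of_real t * z) ^ n) \<partial>\<nu>) = (\<integral>t. a n * cmod z ^ n * t ^ n \<partial>\<nu>)"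
      by (rule Bochner_Integration.integral_cong[OF refl n])
    then show ?thesis unfolding moments by simp
  qed
  moreover have "summable (\<lambda>n. a n * cmod z ^ n * c (Suc n))"
  proof (rule summable_comparison_test')
    show "summable (\<lambda>n. a n * cmod z ^ n * c (Suc 0))" using s by (rule summable_mult2)
    show "norm (a n * cmod z ^ n * c (Suc n)) \<le> a n * cmod z ^ n * c (Suc 0)" for n
      using a coeff_nonneg coeff_Suc_antimono[of 0 n] by (auto simp: abs_mult intro!: mult_left_mono)
  qed
  moreover have "summable (\<lambda>n. norm (of_real (a n) * (of_real t * z) ^ n))" if "t \<in> space \<nu>" for t
    unfolding n[OF that]
  proof (rule summable_comparison_test'[OF s])
    show "norm (a n * cmod z ^ n * t ^ n) \<le> a n * cmod z ^ n" for n
      using that a mult_left_mono[of "t ^ n" 1 "a n * cmod z ^ n"]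
      by (simp add: space_eq power_le_one abs_mult)
  qed
  ultimately have "(\<lambda>n. \<integral>t. of_real (a n) * (of_real t * z) ^ n \<partial>\<nu>) sums
      (\<integral>t. (\<Sum>n. of_real (a n) * (of_real t * z) ^ n) \<partial>\<nu>)"
    by (intro sums_integral int) auto
  moreover have "(\<integral>t. of_real (a n) * (of_real t * z) ^ n \<partial>\<nu>) = of_real (a n * c (Suc n)) * z ^ n" for n
  proof -
    have "(\<integral>t. of_real (a n) * (of_real t * z) ^ n \<partial>\<nu>) = (\<integral>t. of_real (t ^ n) * (of_real (a n) * z ^ n) \<partial>\<nu>)"
      by (simp add: power_mult_distrib mult_ac)
    also have "\<dots> = of_real (\<integral>t. t ^ n \<partial>\<nu>) * (of_real (a n) * z ^ n)"
      unfolding integral_of_real[OF integrable_power, symmetric]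
      by (intro Bochner_Integration.integral_mult_left integrable_of_real[OF integrable_power])
    finally show ?thesis by (simp add: moments mult_ac)
  qed
  ultimately show ?thesis by (simp only:)
qed

lemma integrable_kernel:
  assumes "cmod z < 1"
  shows "integrable \<nu> (\<lambda>t. 1 / (1 - of_real t * z) ^ k)"
proof (rule integrable_bounded[where B="1 / (1 - cmod z) ^ k"])
  fix t :: real assume t: "0 \<le> t" "t < 1"
  from one_minus_norm_le_kernel[OF t, of z] show "norm (1 / (1 - of_real t * z) ^ k) \<le> 1 / (1 - cmod z) ^ k"
    using assms by (auto simp: norm_divide norm_power intro!: divide_left_mono power_mono mult_pos_pos zero_less_power)
qed measurable

text \<open>The normalisation \<open>c 0 + \<integral>t. 1 / (1 - t) \<partial>\<nu> = 1\<close> turns \<open>1 - h\<close> into the integral of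
  \<open>1 / (1 - t) - z / (1 - t z) = (1 - z) / ((1 - t) (1 - t z))\<close>.\<close>

lemma one_minus_h:
  assumes z: "cmod z < 1"
  shows "1 - h z = (1 - z) * (\<integral>t. of_real (1 / (1 - t)) / (1 - of_real t * z) \<partial>\<nu>)"
    and "integrable \<nu> (\<lambda>t. of_real (1 / (1 - t)) / (1 - of_real t * z))"
proof -
  have tz: "cmod (of_real t * z) < 1" if "t \<in> space \<nu>" for t
    using norm_scaled_le[of t z] that z unfolding space_eq atLeastLessThan_iff by linarith
  have nz: "1 - of_real t * z \<noteq> 0" if "t \<in> space \<nu>" for t
    using tz[OF that] by auto
  have "(\<lambda>n. of_real (1 * c (Suc n)) * z ^ n) sums (\<integral>t. (\<Sum>n. of_real 1 * (of_real t * z) ^ n) \<partial>\<nu>)"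
    using z by (intro moment_series) (auto intro: summable_geometric)
  also have "(\<integral>t. (\<Sum>n. of_real 1 * (of_real t * z) ^ n) \<partial>\<nu>) = (\<integral>t. 1 / (1 - of_real t * z) ^ 1 \<partial>\<nu>)"
    by (intro Bochner_Integration.integral_cong refl) (simp add: suminf_geometric[OF tz])
  finally have "(\<lambda>n. of_real (c (Suc n)) * z ^ n) sums (\<integral>t. 1 / (1 - of_real t * z) ^ 1 \<partial>\<nu>)" (is "_ sums ?I")
    by simp
  from sums_mult2[OF this, of z] have "(\<lambda>n. of_real (c (Suc n)) * z ^ Suc n) sums (?I * z)"
    by (simp add: mult_ac)
  then have "(\<lambda>n. of_real (c n) * z ^ n) sums (?I * z + of_real (c 0) * z ^ 0)"
    by (subst sums_Suc_iff[symmetric]) auto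
  with h_sums[of z] z have "h z = of_real (c 0) + z * ?I"
    by (auto dest: sums_unique2 simp: add.commute mult.commute)
  then have "1 - h z = of_real (\<integral>t. 1 / (1 - t) \<partial>\<nu>) - z * ?I"
    by (simp add: integral_inverse)
  also have "of_real (\<integral>t. 1 / (1 - t) \<partial>\<nu>) = (\<integral>t. of_real (1 / (1 - t)) \<partial>\<nu>)"
    by (rule integral_of_real[OF integrable_inverse, symmetric])
  also have "z * ?I = (\<integral>t. z * (1 / (1 - of_real t * z) ^ 1) \<partial>\<nu>)"
    by (intro Bochner_Integration.integral_mult_right[symmetric] integrable_kernel z)
  also have "(\<integral>t. of_real (1 / (1 - t)) \<partial>\<nu>) - (\<integral>t. z * (1 / (1 - of_real t * z) ^ 1) \<partial>\<nu>)
      = (\<integral>t. of_real (1 / (1 - t)) - z * (1 / (1 - of_real t * z) ^ 1) \<partial>\<nu>)"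
  proof (rule Bochner_Integration.integral_diff[symmetric])
    show "integrable \<nu> (\<lambda>t. complex_of_real (1 / (1 - t)))"
      by (rule integrable_of_real[OF integrable_inverse])
    show "integrable \<nu> (\<lambda>t. z * (1 / (1 - of_real t * z) ^ 1))"
      by (intro integrable_mult_right integrable_kernel z)
  qed
  also have "\<dots> = (\<integral>t. (1 - z) * (of_real (1 / (1 - t)) / (1 - of_real t * z)) \<partial>\<nu>)"
  proof (intro Bochner_Integration.integral_cong refl)
    fix t assume t: "t \<in> space \<nu>"
    have "complex_of_real (1 - t) \<noteq> 0" using t by (simp add: space_eq)
    then show "of_real (1 / (1 - t)) - z * (1 / (1 - of_real t * z) ^ 1) =
        (1 - z) * (of_real (1 / (1 - t)) / (1 - of_real t * z))"
      using nz[OF t] by (simp add: divide_simps) (simp add: algebra_simps)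
  qed
  finally have e: "1 - h z = \<dots>" .
  show i: "integrable \<nu> (\<lambda>t. of_real (1 / (1 - t)) / (1 - of_real t * z))"
  proof (rule Bochner_Integration.integrable_bound)
    show "integrable \<nu> (\<lambda>t. 1 / (1 - cmod z) * (1 / (1 - t)))"
      by (intro integrable_mult_right integrable_inverse)
    show "(\<lambda>t. of_real (1 / (1 - t)) / (1 - of_real t * z)) \<in> borel_measurable \<nu>"
      by (rule measurable_borel) measurable
    show "AE t in \<nu>. norm (of_real (1 / (1 - t)) / (1 - of_real t * z)) \<le> norm (1 / (1 - cmod z) * (1 / (1 - t)))"
    proof (rule AE_I2)
      fix t assume t: "t \<in> space \<nu>"
      have "1 - cmod z \<le> cmod (1 - of_real t * z)"
        using t by (intro one_minus_norm_le_kernel) (auto simp: space_eq)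
      then have "1 / (1 - t) / cmod (1 - of_real t * z) \<le> 1 / (1 - t) / (1 - cmod z)"
        using z t by (intro divide_left_mono mult_pos_pos) (auto simp: space_eq)
      moreover have "norm (of_real (1 / (1 - t)) / (1 - of_real t * z)) = 1 / (1 - t) / cmod (1 - of_real t * z)"
        using t unfolding norm_divide norm_of_real by (simp add: space_eq)
      moreover have "norm (1 / (1 - cmod z) * (1 / (1 - t))) = 1 / (1 - t) / (1 - cmod z)"
        using z t by (simp add: space_eq abs_mult)
      ultimately show "norm (of_real (1 / (1 - t)) / (1 - of_real t * z)) \<le> norm (1 / (1 - cmod z) * (1 / (1 - t)))"
        by (simp only:)
    qed
  qed
  show "1 - h z = (1 - z) * (\<integral>t. of_real (1 / (1 - t)) / (1 - of_real t * z) \<partial>\<nu>)"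
    unfolding e by (intro Bochner_Integration.integral_mult_right i)
qed

lemma h_has_field_derivative:
  assumes z: "cmod z < 1"
  shows "(h has_field_derivative (\<integral>t. 1 / (1 - of_real t * z)\<^sup>2 \<partial>\<nu>)) (at z)"
proof -
  have tz: "cmod (of_real t * z) < 1" if "t \<in> space \<nu>" for t
    using norm_scaled_le[of t z] that z unfolding space_eq atLeastLessThan_iff by linarith
  have h_summable: "summable (\<lambda>n. complex_of_real (c n) * w ^ n)"
    and h_suminf: "(\<Sum>n. complex_of_real (c n) * w ^ n) = h w" if "cmod w < 1" for w
    using h_sums[of w] that by (auto simp: sums_iff)
  have "((\<lambda>z. \<Sum>n. complex_of_real (c n) * z ^ n) has_field_derivative
      (\<Sum>n. diffs (\<lambda>n. complex_of_real (c n)) n * z ^ n)) (at z)"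
    by (rule termdiffs_strong'[where K=1]) (use z h_summable in auto)
  then have D: "(h has_field_derivative (\<Sum>n. diffs (\<lambda>n. complex_of_real (c n)) n * z ^ n)) (at z)"
    by (rule has_field_derivative_transform_within_open[where S="ball 0 1"]) (use z h_suminf in auto)
  have sm: "summable (\<lambda>n. real (Suc n) * cmod z ^ n)"
    using geometric_deriv_sums[of "cmod z"] z by (simp only: sums_iff real_norm_def abs_norm_cancel)
  have "(\<lambda>n. of_real (real (Suc n) * c (Suc n)) * z ^ n) sums
      (\<integral>t. (\<Sum>n. of_real (real (Suc n)) * (of_real t * z) ^ n) \<partial>\<nu>)"
    by (rule moment_series[OF _ sm]) simp
  moreover have "(\<integral>t. (\<Sum>n. of_real (real (Suc n)) * (of_real t * z) ^ n) \<partial>\<nu>) =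
      (\<integral>t. 1 / (1 - of_real t * z)\<^sup>2 \<partial>\<nu>)"
  proof (intro Bochner_Integration.integral_cong refl)
    fix t assume "t \<in> space \<nu>"
    from geometric_deriv_sums[OF tz[OF this]]
    show "(\<Sum>n. of_real (real (Suc n)) * (of_real t * z) ^ n) = 1 / (1 - of_real t * z)\<^sup>2"
      by (simp only: sums_iff of_real_of_nat_eq)
  qed
  moreover have "of_real (real (Suc n) * c (Suc n)) = diffs (\<lambda>n. complex_of_real (c n)) n" for n
    by (simp only: diffs_def of_real_mult of_real_of_nat_eq)
  ultimately have "(\<Sum>n. diffs (\<lambda>n. complex_of_real (c n)) n * z ^ n) = (\<integral>t. 1 / (1 - of_real t * z)\<^sup>2 \<partial>\<nu>)"
    by (simp only: sums_iff)
  with D show ?thesis by simp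
qed


text \<open>In the variable \<open>x = 1 - w\<close>, the function \<open>1 - h\<close> is a complete Bernstein function; this is its
  restriction to the real axis, with derivative \<open>psi'\<close>.\<close>

definition psi :: "real \<Rightarrow> real" where "psi x = 1 - Re (h (of_real (1 - x)))"

definition psi' :: "real \<Rightarrow> real" where "psi' x = (\<integral>t. 1 / (1 - t + t * x)\<^sup>2 \<partial>\<nu>)"

lemma psi_integral:
  assumes x: "0 < x" "x < 2"
  shows "psi x = (\<integral>t. x * (1 / (1 - t) / (1 - t + t * x)) \<partial>\<nu>)"
    and "integrable \<nu> (\<lambda>t. x * (1 / (1 - t) / (1 - t + t * x)))"
proof -
  have c: "cmod (of_real (1 - x)) < 1" using x by (simp only: norm_of_real)
  have e: "of_real (1 / (1 - t)) / (1 - of_real t * of_real (1 - x)) = complex_of_real (1 / (1 - t) / (1 - t + t * x))" for t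
    by (simp add: algebra_simps)
  have i: "integrable \<nu> (\<lambda>t. complex_of_real (1 / (1 - t) / (1 - t + t * x)))"
    using one_minus_h(2)[OF c] unfolding e .
  have i': "integrable \<nu> (\<lambda>t. 1 / (1 - t) / (1 - t + t * x))"
    using integrable_Re[OF i] by simp
  show "integrable \<nu> (\<lambda>t. x * (1 / (1 - t) / (1 - t + t * x)))"
    using i' by (rule integrable_mult_right)
  have "1 - h (of_real (1 - x)) = (1 - of_real (1 - x)) * of_real (\<integral>t. 1 / (1 - t) / (1 - t + t * x) \<partial>\<nu>)"
    using one_minus_h(1)[OF c] unfolding e integral_of_real[OF i'] .
  then have "Re (1 - h (of_real (1 - x))) = x * (\<integral>t. 1 / (1 - t) / (1 - t + t * x) \<partial>\<nu>)"
    by simp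
  also have "\<dots> = (\<integral>t. x * (1 / (1 - t) / (1 - t + t * x)) \<partial>\<nu>)"
    by (rule Bochner_Integration.integral_mult_right_zero[symmetric])
  finally show "psi x = (\<integral>t. x * (1 / (1 - t) / (1 - t + t * x)) \<partial>\<nu>)"
    by (simp only: psi_def minus_complex.simps one_complex.simps)
qed

lemma psi_nonneg: "0 < x \<Longrightarrow> x < 2 \<Longrightarrow> 0 \<le> psi x"
  unfolding psi_integral(1) by (intro integral_nonneg_AE AE_I2) (auto simp: space_eq)

lemma psi_mono:
  assumes "0 < x" "x \<le> y" "y < 2"
  shows "psi x \<le> psi y"
proof -
  have le: "x * (1 / (1 - t) / (1 - t + t * x)) \<le> y * (1 / (1 - t) / (1 - t + t * y))" if t: "0 \<le> t" "t < 1" for t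
  proof -
    have p: "0 < 1 - t + t * x" "0 < 1 - t + t * y"
      using t assms by (intro add_pos_nonneg mult_nonneg_nonneg; simp)+
    have "x * (1 - t) \<le> y * (1 - t)" using assms t by (intro mult_right_mono) auto
    then have "x * (1 - t + t * y) \<le> y * (1 - t + t * x)" by (simp add: algebra_simps)
    moreover have "a / P \<le> b / Q" if "0 < P" "0 < Q" "a * Q \<le> b * P" for a b P Q :: real
      using that by (simp add: field_simps)
    ultimately have "x / (1 - t + t * x) \<le> y / (1 - t + t * y)"
      using p by blast
    then have "x / (1 - t + t * x) / (1 - t) \<le> y / (1 - t + t * y) / (1 - t)"
      by (rule divide_right_mono) (use t in simp)
    moreover have "z * (1 / (1 - t) / (1 - t + t * z)) = z / (1 - t + t * z) / (1 - t)" for z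
      by simp
    ultimately show ?thesis by (simp only:)
  qed
  have x2: "x < 2" and y0: "0 < y" using assms by auto
  show ?thesis
    unfolding psi_integral(1)[OF assms(1) x2] psi_integral(1)[OF y0 assms(3)]
    by (rule integral_mono_unit[OF psi_integral(2)[OF assms(1) x2] psi_integral(2)[OF y0 assms(3)] le])
qed

lemma integrable_psi':
  assumes "0 < x"
  shows "integrable \<nu> (\<lambda>t. 1 / (1 - t + t * x)\<^sup>2)"
proof (rule integrable_bounded[where B="1 / (min 1 x)\<^sup>2"])
  fix t :: real assume t: "0 \<le> t" "t < 1"
  have "(1 - t) * min 1 x + t * min 1 x \<le> (1 - t) * 1 + t * x"
    using t assms by (intro add_mono mult_left_mono) auto
  then have "min 1 x \<le> 1 - t + t * x" by (simp add: algebra_simps)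
  then have "1 / (1 - t + t * x)\<^sup>2 \<le> 1 / (min 1 x)\<^sup>2"
    using assms by (intro divide_left_mono power_mono mult_pos_pos zero_less_power) auto
  then show "norm (1 / (1 - t + t * x)\<^sup>2) \<le> 1 / (min 1 x)\<^sup>2" by simp
qed measurable

lemma psi'_nonneg: "0 \<le> psi' x"
  unfolding psi'_def by (intro integral_nonneg_AE AE_I2) auto

lemma psi'_antimono:
  assumes "0 < x" "x \<le> y"
  shows "psi' y \<le> psi' x"
  unfolding psi'_def
proof (rule integral_mono_unit)
  fix t :: real assume t: "0 \<le> t" "t < 1"
  have "0 < 1 - t + t * x" using t assms by (intro add_pos_nonneg mult_nonneg_nonneg) auto
  moreover have "1 - t + t * x \<le> 1 - t + t * y" using t assms by (intro add_left_mono mult_left_mono) auto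
  ultimately show "1 / (1 - t + t * y)\<^sup>2 \<le> 1 / (1 - t + t * x)\<^sup>2"
    by (intro divide_left_mono power_mono mult_pos_pos zero_less_power) auto
qed (use assms in \<open>auto intro: integrable_psi'\<close>)

lemma psi_has_derivative:
  assumes x: "0 < x" "x < 2"
  shows "(psi has_real_derivative psi' x) (at x)"
proof -
  have c: "cmod (of_real (1 - x)) < 1" using x by (simp only: norm_of_real)
  have "(\<integral>t. 1 / (1 - of_real t * of_real (1 - x))\<^sup>2 \<partial>\<nu>) = (\<integral>t. complex_of_real (1 / (1 - t + t * x)\<^sup>2) \<partial>\<nu>)"
    by (intro Bochner_Integration.integral_cong refl) (simp add: algebra_simps)
  also have "\<dots> = of_real (psi' x)"
    unfolding psi'_def by (rule integral_of_real[OF integrable_psi'[OF x(1)]])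
  finally have "(h has_field_derivative of_real (psi' x)) (at (of_real (1 - x)))"
    using h_has_field_derivative[OF c] by simp
  moreover have "((\<lambda>x. complex_of_real (1 - x)) has_vector_derivative - 1) (at x)"
    by (auto intro!: derivative_eq_intros)
  ultimately have "(h \<circ> (\<lambda>x. complex_of_real (1 - x)) has_vector_derivative - 1 * of_real (psi' x)) (at x)"
    by (intro field_vector_diff_chain_at)
  then have "((\<lambda>x. Re (h (of_real (1 - x)))) has_vector_derivative - psi' x) (at x)"
    using bounded_linear.has_vector_derivative[OF bounded_linear_Re] by (fastforce simp: o_def)
  then have "((\<lambda>x. Re (h (of_real (1 - x)))) has_real_derivative - psi' x) (at x)"
    by (simp add: has_real_derivative_iff_has_vector_derivative)
  then have "((\<lambda>x. 1 - Re (h (of_real (1 - x)))) has_real_derivative 0 - (- psi' x)) (at x)"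
    by (intro DERIV_diff DERIV_const)
  then show ?thesis by (simp only: psi_def[abs_def] diff_minus_eq_add add_0)
qed

lemma deriv_h: "cmod z < 1 \<Longrightarrow> deriv h z = (\<integral>t. 1 / (1 - of_real t * z)\<^sup>2 \<partial>\<nu>)"
  by (rule DERIV_imp_deriv[OF h_has_field_derivative])

lemma h_holomorphic: "h holomorphic_on ball 0 1"
  unfolding holomorphic_on_open[OF open_ball]
  by (intro ballI exI, rule h_has_field_derivative) simp

text \<open>The estimate \<open>\<bar>1 / (1 - t z)\<^sup>2\<bar> \<le> 2 / (1 - t + t x)\<^sup>2\<close> with \<open>x = \<bar>1 - z\<bar>\<close> holds for every \<open>t\<close> and is
  integrated.\<close>

lemma norm_deriv_h_le:
  assumes z: "cmod z < 1"
  shows "cmod (deriv h z) \<le> 2 * psi' (cmod (1 - z))"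
proof -
  have x: "0 < cmod (1 - z)" using z by auto
  have "cmod (deriv h z) \<le> (\<integral>t. norm (1 / (1 - of_real t * z)\<^sup>2) \<partial>\<nu>)"
    unfolding deriv_h[OF z] by (rule integral_norm_bound)
  also have "\<dots> \<le> (\<integral>t. 2 * (1 / (1 - t + t * cmod (1 - z))\<^sup>2) \<partial>\<nu>)"
  proof (intro integral_mono_unit integrable_norm integrable_kernel integrable_mult_right integrable_psi' z x)
    fix t :: real assume t: "0 \<le> t" "t < 1"
    have "0 < (1 - t + t * cmod (1 - z))\<^sup>2" using kernel_ge(1)[OF t z] by simp
    moreover have "0 < (cmod (1 - of_real t * z))\<^sup>2" using kernel_nonzero[OF t z] by simp
    ultimately show "norm (1 / (1 - of_real t * z)\<^sup>2) \<le> 2 * (1 / (1 - t + t * cmod (1 - z))\<^sup>2)"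
      using kernel_ge(2)[OF t z] by (simp add: norm_divide norm_power divide_simps)
  qed
  also have "\<dots> = 2 * psi' (cmod (1 - z))" unfolding psi'_def
    by (rule Bochner_Integration.integral_mult_right_zero)
  finally show ?thesis .
qed

text \<open>In the representation of \<open>1 - h z\<close> as an integral there is no cancellation
  by \<open>kernel_quadrant\<close>, so that \<open>\<bar>1 - h z\<bar>\<close> is comparable to the integral of the absolute values, which
  dominates \<open>psi\<close> by \<open>kernel_le\<close>.\<close>

lemma norm_one_minus_h_ge:
  assumes z: "cmod z < 1"
  shows "psi (cmod (1 - z)) \<le> sqrt 2 * cmod (1 - h z)"
proof -
  define x where "x = cmod (1 - z)"
  have x: "0 < x" "x < 2" using z norm_triangle_ineq4[of 1 z] by (auto simp: x_def)
  obtain v where v: "cmod v = sqrt 2"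
    and vt: "\<And>t. 0 \<le> t \<Longrightarrow> t < 1 \<Longrightarrow> 1 / cmod (1 - of_real t * z) \<le> Re (v / (1 - of_real t * z))"
    using kernel_quadrant[OF z] by blast
  define I where "I = (\<integral>t. of_real (1 / (1 - t)) / (1 - of_real t * z) \<partial>\<nu>)"
  have i: "integrable \<nu> (\<lambda>t. v * (of_real (1 / (1 - t)) / (1 - of_real t * z)))"
    by (intro integrable_mult_right one_minus_h(2) z)
  have "psi x = (\<integral>t. x * (1 / (1 - t) / (1 - t + t * x)) \<partial>\<nu>)" by (rule psi_integral(1)[OF x])
  also have "\<dots> \<le> (\<integral>t. x * Re (v * (of_real (1 / (1 - t)) / (1 - of_real t * z))) \<partial>\<nu>)"
  proof (intro integral_mono_unit psi_integral(2) x)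
    show "integrable \<nu> (\<lambda>t. x * Re (v * (of_real (1 / (1 - t)) / (1 - of_real t * z))))"
      by (rule integrable_mult_right[OF integrable_Re[OF i]])
  next
    fix t :: real assume t: "0 \<le> t" "t < 1"
    have "1 / (1 - t + t * x) \<le> 1 / cmod (1 - of_real t * z)"
      using kernel_le[OF t, of z] kernel_ge(1)[OF t z] kernel_nonzero[OF t z]
      by (intro divide_left_mono mult_pos_pos) (auto simp: x_def)
    also have "\<dots> \<le> Re (v / (1 - of_real t * z))" by (rule vt[OF t])
    finally have "x * (1 / (1 - t)) * (1 / (1 - t + t * x)) \<le> x * (1 / (1 - t)) * Re (v / (1 - of_real t * z))"
      using x t by (intro mult_left_mono) auto
    also have "\<dots> = x * ((1 / (1 - t)) * Re (v / (1 - of_real t * z)))" by (rule mult.assoc)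
    also have "(1 / (1 - t)) * Re (v / (1 - of_real t * z)) = Re (of_real (1 / (1 - t)) * (v / (1 - of_real t * z)))"
      by (simp only: Re_complex_of_real times_complex.simps Im_complex_of_real mult_zero_left diff_zero)
    also have "of_real (1 / (1 - t)) * (v / (1 - of_real t * z)) = v * (of_real (1 / (1 - t)) / (1 - of_real t * z))"
      by (simp only: times_divide_eq_right mult.commute)
    also have "x * (1 / (1 - t)) * (1 / (1 - t + t * x)) = x * (1 / (1 - t) / (1 - t + t * x))" by simp
    finally show "x * (1 / (1 - t) / (1 - t + t * x)) \<le> x * Re (v * (of_real (1 / (1 - t)) / (1 - of_real t * z)))" .
  qed
  also have "\<dots> = x * (\<integral>t. Re (v * (of_real (1 / (1 - t)) / (1 - of_real t * z))) \<partial>\<nu>)" by simp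
  also have "(\<integral>t. Re (v * (of_real (1 / (1 - t)) / (1 - of_real t * z))) \<partial>\<nu>) = Re (v * I)"
    unfolding I_def integral_Re[OF i] Bochner_Integration.integral_mult_right_zero ..
  also have "x * Re (v * I) \<le> x * (sqrt 2 * cmod I)"
    using complex_Re_le_cmod[of "v * I"] x v by (intro mult_left_mono) (auto simp: norm_mult)
  also have "\<dots> = sqrt 2 * cmod (1 - h z)"
    using one_minus_h(1)[OF z] by (simp add: I_def norm_mult x_def)
  finally show ?thesis by (simp add: x_def)
qed

lemma deriv_h_half_plane:
  assumes z: "cmod z < 1" and c1: "c 1 \<noteq> 0"
  shows "0 < Re ((1 - z) * deriv h z)"
proof -
  have i: "integrable \<nu> (\<lambda>t. (1 - z) * (1 / (1 - of_real t * z)\<^sup>2))"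
    by (intro integrable_mult_right integrable_kernel z)
  have pos: "0 < Re ((1 - z) * (1 / (1 - of_real t * z)\<^sup>2))" if "t \<in> space \<nu>" for t
    using kernel_square_half_plane[OF _ _ z] that by (simp only: space_eq atLeastLessThan_iff)
  have nn: "AE t in \<nu>. 0 \<le> Re ((1 - z) * (1 / (1 - of_real t * z)\<^sup>2))"
    using pos by (intro AE_I2 less_imp_le)
  have "Re ((1 - z) * deriv h z) = (\<integral>t. Re ((1 - z) * (1 / (1 - of_real t * z)\<^sup>2)) \<partial>\<nu>)"
    unfolding deriv_h[OF z] integral_Re[OF i] Bochner_Integration.integral_mult_right_zero ..
  moreover have "(\<integral>t. Re ((1 - z) * (1 / (1 - of_real t * z)\<^sup>2)) \<partial>\<nu>) \<noteq> 0"
  proof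
    assume "(\<integral>t. Re ((1 - z) * (1 / (1 - of_real t * z)\<^sup>2)) \<partial>\<nu>) = 0"
    then have "AE t in \<nu>. Re ((1 - z) * (1 / (1 - of_real t * z)\<^sup>2)) = 0"
      using integral_nonneg_eq_0_iff_AE[OF integrable_Re[OF i] nn] by blast
    then have "AE t in \<nu>. False" using AE_space by eventually_elim (use pos in force)
    then have "emeasure \<nu> (space \<nu>) = 0" 
      by (simp add: ae_filter_eq_bot_iff[symmetric] trivial_limit_def)
    then have "measure \<nu> (space \<nu>) = 0" by (simp add: measure_def)
    then show False using c1 moments[of 0] by simp
  qed
  moreover have "0 \<le> (\<integral>t. Re ((1 - z) * (1 / (1 - of_real t * z)\<^sup>2)) \<partial>\<nu>)"
    by (rule integral_nonneg_AE[OF nn])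
  ultimately show ?thesis by linarith
qed

end

section \<open>Absolutely summable inverses\<close>

lemma sin_ge_mult_cos:
  assumes "0 \<le> y" "y \<le> pi"
  shows "y * cos y \<le> sin (y::real)"
proof -
  have "(\<lambda>y. sin y - y * cos y) 0 \<le> (\<lambda>y. sin y - y * cos y) y"
  proof (rule DERIV_nonneg_imp_nondecreasing[OF assms(1)])
    fix x :: real assume x: "0 \<le> x" "x \<le> y"
    have "((\<lambda>y. sin y - y * cos y) has_real_derivative x * sin x) (at x)"
      by (auto intro!: derivative_eq_intros)
    moreover have "0 \<le> x * sin x" using x assms by (intro mult_nonneg_nonneg sin_ge_zero) auto
    ultimately show "\<exists>D. ((\<lambda>y. sin y - y * cos y) has_real_derivative D) (at x) \<and> 0 \<le> D" by blast
  qed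
  then show ?thesis by simp
qed

text \<open>Both \<open>1 - r\<close> and \<open>\<theta> / 4\<close> are lower bounds for the distance, and so is their mean. A bound that is affine in \<open>\<theta>\<close> makes
  the substitution from \<open>\<theta>\<close> to the argument of \<open>psi\<close> trivial, and the summand \<open>1 - r\<close> keeps this argument away from
  \<open>0\<close>, where \<open>psi'\<close> may be unbounded.\<close>

lemma norm_one_minus_circle_ge:
  fixes r \<theta> :: real
  assumes r: "1/4 \<le> r" "r < 1" and \<theta>: "0 \<le> \<theta>" "\<theta> \<le> pi"
  shows "((1 - r) + \<theta> / 4) / 2 \<le> cmod (1 - r * cis \<theta>)"
proof -
  define y where "y = \<theta> / 4"
  have y: "0 \<le> y" "y \<le> pi / 4" using \<theta> by (auto simp: y_def)
  have "cos (pi / 4) \<le> cos y" using y by (subst cos_mono_le_eq) auto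
  then have cy: "sqrt 2 / 2 \<le> cos y" by (simp add: cos_45)
  have "(sqrt 2 / 2)\<^sup>2 \<le> (cos y)\<^sup>2" using cy by (intro power_mono) auto
  then have c2: "1 / 2 \<le> (cos y)\<^sup>2" by (simp add: power_divide)
  have "y \<le> 2 * y * (cos y)\<^sup>2" using mult_left_mono[OF c2, of "2 * y"] y by simp
  also have "\<dots> = 2 * (y * cos y) * cos y" by (simp add: power2_eq_square)
  also have "\<dots> \<le> 2 * sin y * cos y"
    using sin_ge_mult_cos[of y] y cy by (intro mult_right_mono) (auto intro: order_trans[OF _ cy])
  also have "\<dots> = sin (2 * y)" by (simp add: sin_double)
  finally have s: "y \<le> sin (2 * y)" .
  have "(cmod (1 - r * cis \<theta>))\<^sup>2 = (1 - r)\<^sup>2 + 2 * r * (1 - cos \<theta>)"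
  proof -
    have "(cmod (1 - r * cis \<theta>))\<^sup>2 = (1 - r * cos \<theta>)\<^sup>2 + (r * sin \<theta>)\<^sup>2"
      by (simp add: cmod_power2)
    also have "\<dots> = 1 - 2 * r * cos \<theta> + r\<^sup>2 * ((cos \<theta>)\<^sup>2 + (sin \<theta>)\<^sup>2)"
    proof -
      have "(1 - r * p)\<^sup>2 + (r * q)\<^sup>2 = 1 - 2 * r * p + r\<^sup>2 * (p\<^sup>2 + q\<^sup>2)" for p q :: real
        by (simp add: power2_eq_square algebra_simps)
      then show ?thesis .
    qed
    finally show ?thesis by (simp add: power2_eq_square algebra_simps)
  qed
  also have "1 - cos \<theta> = 2 * (sin (2 * y))\<^sup>2"
    using cos_double_sin[of "2 * y"] by (simp add: y_def)
  finally have n: "(cmod (1 - r * cis \<theta>))\<^sup>2 = (1 - r)\<^sup>2 + 4 * r * (sin (2 * y))\<^sup>2" by simp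
  have "1 - r \<le> cmod (1 - r * cis \<theta>)"
  proof (rule power2_le_imp_le)
    show "(1 - r)\<^sup>2 \<le> (cmod (1 - r * cis \<theta>))\<^sup>2" unfolding n using r by simp
  qed simp
  moreover have "y \<le> cmod (1 - r * cis \<theta>)"
  proof (rule power2_le_imp_le)
    have "y\<^sup>2 \<le> (sin (2 * y))\<^sup>2" using s y by (intro power_mono)
    also have "\<dots> \<le> 4 * r * (sin (2 * y))\<^sup>2" using r mult_right_mono[of 1 "4 * r" "(sin (2 * y))\<^sup>2"] by simp
    finally show "y\<^sup>2 \<le> (cmod (1 - r * cis \<theta>))\<^sup>2" unfolding n by (simp add: add_increasing)
  qed simp
  ultimately show ?thesis by (simp add: y_def)
qed

context hausdorff_representation
begin

lemma h_fps_expansion: "fps_expansion h 0 = Abs_fps (\<lambda>n. of_real (c n))"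
proof (rule fps_expansion_eqI, rule has_fps_expansionI)
  have "eventually (\<lambda>u::complex. u \<in> ball 0 1) (nhds 0)" by (intro eventually_nhds_in_open) auto
  then show "eventually (\<lambda>u. (\<lambda>n. fps_nth (Abs_fps (\<lambda>n. complex_of_real (c n))) n * u ^ n) sums h u) (nhds 0)"
    by eventually_elim (use h_sums in simp)
qed

text \<open>The coefficients of \<open>1 / (z - h)\<close> are the convolution inverse of those of \<open>z - h\<close>, which is the
  algebraic identity behind the formula for the resolvent.\<close>

lemma inverse_coefficients:
  assumes nz: "\<And>w. w \<in> ball 0 1 \<Longrightarrow> z \<noteq> h w"
  shows "(fps_const z - Abs_fps (\<lambda>n. of_real (c n))) * fps_expansion (\<lambda>w. 1 / (z - h w)) 0 = 1"
proof -
  have "(\<lambda>w. 1 / (z - h w)) holomorphic_on ball 0 1"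
    using nz by (intro holomorphic_intros h_holomorphic) auto
  then have f: "(\<lambda>w. 1 / (z - h w)) has_fps_expansion fps_expansion (\<lambda>w. 1 / (z - h w)) 0"
    by (intro has_fps_expansion_fps_expansion[of "ball 0 1"]) auto
  have "h has_fps_expansion fps_expansion h 0"
    using h_holomorphic by (intro has_fps_expansion_fps_expansion[of "ball 0 1"]) auto
  then have "(\<lambda>w. z - h w) has_fps_expansion fps_const z - Abs_fps (\<lambda>n. of_real (c n))"
    unfolding h_fps_expansion by (intro has_fps_expansion_diff has_fps_expansion_const)
  then have p: "(\<lambda>w. (z - h w) * (1 / (z - h w))) has_fps_expansion
      (fps_const z - Abs_fps (\<lambda>n. of_real (c n))) * fps_expansion (\<lambda>w. 1 / (z - h w)) 0"
    by (rule has_fps_expansion_mult[OF _ f])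
  have "eventually (\<lambda>u::complex. u \<in> ball 0 1) (nhds 0)" by (intro eventually_nhds_in_open) auto
  then have ev: "eventually (\<lambda>w. (z - h w) * (1 / (z - h w)) = 1) (nhds 0)"
    by eventually_elim (use nz in simp)
  have "(\<lambda>w. 1) has_fps_expansion
      (fps_const z - Abs_fps (\<lambda>n. of_real (c n))) * fps_expansion (\<lambda>w. 1 / (z - h w)) 0"
    using p unfolding has_fps_expansion_cong[OF ev refl] .
  then show ?thesis
    using fps_expansion_unique_complex has_fps_expansion_1 by blast
qed

text \<open>The integrand is, up to the factor \<open>m\<close>, the derivative of \<open>- 1 / (a + psi (s \<theta>))\<close>, and this function takes values in
  an interval of length \<open>1 / a\<close>. The parameter \<open>m\<close> has two signs because the two halves
  of the circle are traversed in opposite directions as seen from the point \<open>1\<close>.\<close>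

lemma integral_psi_quotient_le:
  assumes s: "\<And>\<theta>. \<theta> \<in> {u..v} \<Longrightarrow> s \<theta> \<in> {0<..<2}" and uv: "u \<le> v"
    and ds: "\<And>\<theta>. (s has_real_derivative m) (at \<theta>)" and m: "\<bar>m\<bar> = 1 / 8" and a: "0 < a"
  obtains I where "((\<lambda>\<theta>. psi' (s \<theta>) / (a + psi (s \<theta>))\<^sup>2) has_integral I) {u..v}" "I \<le> 8 / a"
proof
  define E where "E \<theta> = - (1 / m) / (a + psi (s \<theta>))" for \<theta>
  have pos: "0 < a + psi (s \<theta>)" if "\<theta> \<in> {u..v}" for \<theta>
    using psi_nonneg[of "s \<theta>"] s[OF that] a by auto
  show "((\<lambda>\<theta>. psi' (s \<theta>) / (a + psi (s \<theta>))\<^sup>2) has_integral (E v - E u)) {u..v}"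
  proof (rule fundamental_theorem_of_calculus[OF uv])
    fix \<theta> assume \<theta>: "\<theta> \<in> {u..v}"
    have "((\<lambda>\<theta>. psi (s \<theta>)) has_real_derivative psi' (s \<theta>) * m) (at \<theta>)"
      using s[OF \<theta>] by (intro DERIV_chain2[OF psi_has_derivative ds]) auto
    then have "(E has_real_derivative psi' (s \<theta>) / (a + psi (s \<theta>))\<^sup>2) (at \<theta>)"
      unfolding E_def using pos[OF \<theta>] m
      by (auto intro!: derivative_eq_intros simp: power2_eq_square)
    then show "(E has_vector_derivative psi' (s \<theta>) / (a + psi (s \<theta>))\<^sup>2) (at \<theta> within {u..v})"
      by (simp add: has_real_derivative_iff_has_vector_derivative has_vector_derivative_at_within)
  qed
  have b: "0 \<le> 1 / (a + psi (s \<theta>))" "1 / (a + psi (s \<theta>)) \<le> 1 / a" if "\<theta> \<in> {u..v}" for \<theta>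
    using pos[OF that] psi_nonneg[of "s \<theta>"] s[OF that] a by (auto intro!: divide_left_mono)
  have "E v - E u = (1 / m) * (1 / (a + psi (s u)) - 1 / (a + psi (s v)))"
    by (simp add: E_def right_diff_distrib)
  also have "\<dots> \<le> \<bar>1 / m\<bar> * \<bar>1 / (a + psi (s u)) - 1 / (a + psi (s v))\<bar>"
    unfolding abs_mult[symmetric] by (rule abs_ge_self)
  also have "\<dots> \<le> 8 * (1 / a)"
  proof (intro mult_mono)
    show "\<bar>1 / m\<bar> \<le> 8" unfolding abs_divide m by simp
    show "\<bar>1 / (a + psi (s u)) - 1 / (a + psi (s v))\<bar> \<le> 1 / a"
      using b[of u] b[of v] uv unfolding atLeastAtMost_iff by linarith
  qed auto
  finally show "E v - E u \<le> 8 / a" by simp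
qed

text \<open>The central estimate. Its form matters in that the bound depends on \<open>h\<close> and \<open>z\<close> only through \<open>\<kappa>\<close>
  and \<open>a\<close>, and is of order \<open>1 / a\<close> for fixed \<open>\<kappa>\<close>.\<close>

lemma inverse_coefficients_bound:
  assumes c1: "c 1 \<noteq> 0" and \<kappa>: "0 < \<kappa>" and a: "0 < a"
    and far: "\<And>w. w \<in> ball 0 1 \<Longrightarrow> \<kappa> * (a + cmod (1 - h w)) \<le> cmod (z - h w)"
  shows "summable (\<lambda>n. cmod (fps_nth (fps_expansion (\<lambda>w. 1 / (z - h w)) 0) n))"
    and "(\<Sum>n. cmod (fps_nth (fps_expansion (\<lambda>w. 1 / (z - h w)) 0) n)) \<le> 1 / (\<kappa> * a) + 64 / (\<kappa>\<^sup>2 * a)"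
proof -
  define f where "f w = 1 / (z - h w)" for w
  define F where "F n = cmod (fps_nth (fps_expansion f 0) n)" for n
  have zh: "0 < cmod (z - h w)" if "w \<in> ball 0 1" for w
    by (rule less_le_trans[OF _ far[OF that]]) (intro mult_pos_pos add_pos_nonneg \<kappa> a norm_ge_zero)
  then have nz: "z - h w \<noteq> 0" if "w \<in> ball 0 1" for w
    using that by force
  have f: "f holomorphic_on ball 0 1"
    unfolding f_def using nz by (intro holomorphic_intros h_holomorphic) auto
  have df: "deriv f w = deriv h w / (z - h w)\<^sup>2" if "w \<in> ball 0 1" for w
  proof -
    have "(h has_field_derivative deriv h w) (at w)"
      using h_holomorphic that holomorphic_derivI by blast
    then have "(f has_field_derivative deriv h w / (z - h w)\<^sup>2) (at w)"
      unfolding f_def using nz[OF that] by (auto intro!: derivative_eq_intros simp: power2_eq_square)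
    then show ?thesis by (rule DERIV_imp_deriv)
  qed
  \<comment> \<open>a square root of \<open>f'\<close>: both radicands have positive real part, so the principal branch is holomorphic\<close>
  define G where "G w = csqrt ((1 - w) * deriv h w) / (csqrt (1 - w) * (z - h w))" for w
  have Re1: "0 < Re (1 - w)" if "w \<in> ball 0 1" for w
    using complex_Re_le_cmod[of w] that by simp
  have G: "G holomorphic_on ball 0 1"
  proof -
    have "u \<notin> \<real>\<^sub>\<le>\<^sub>0" if "0 < Re u" for u using that by (auto simp: complex_nonpos_Reals_iff)
    then show ?thesis
      unfolding G_def using nz Re1 deriv_h_half_plane[OF _ c1]
      by (intro holomorphic_intros h_holomorphic) (auto simp del: times_complex.simps minus_complex.simps)
  qed
  have fG: "deriv f w = (G w)\<^sup>2" if "w \<in> ball 0 1" for w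
    using Re1[OF that] by (auto simp: G_def df[OF that] power_divide power_mult_distrib)
  have pointwise: "cmod (deriv f w) \<le> 4 / \<kappa>\<^sup>2 * (psi' s / (a + psi s)\<^sup>2)"
    if w: "w \<in> ball 0 1" and s: "0 < s" "s \<le> cmod (1 - w)" for w s
  proof -
    define x where "x = cmod (1 - w)"
    have x: "0 < x" "x < 2" using w s norm_triangle_ineq4[of 1 w] by (auto simp: x_def)
    \<comment> \<open>the monotonicity of \<open>psi\<close> and \<open>psi'\<close> permits replacing \<open>x\<close> by any smaller \<open>s\<close>\<close>
    have "psi s \<le> psi x" using s x by (intro psi_mono) (auto simp: x_def)
    moreover have "0 \<le> psi s" using s x by (intro psi_nonneg) (auto simp: x_def)
    moreover have "psi x \<le> sqrt 2 * cmod (1 - h w)" using norm_one_minus_h_ge[of w] w by (simp add: x_def)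
    moreover have "a \<le> sqrt 2 * a" using a by simp
    ultimately have "a + psi s \<le> sqrt 2 * (a + cmod (1 - h w))" and p: "0 < a + psi s"
      unfolding distrib_left using a by linarith+
    then have "(a + psi s)\<^sup>2 \<le> (sqrt 2 * (a + cmod (1 - h w)))\<^sup>2" by (intro power_mono) auto
    also have "\<dots> = 2 * (a + cmod (1 - h w))\<^sup>2" by (simp add: power_mult_distrib)
    finally have "\<kappa>\<^sup>2 * (a + psi s)\<^sup>2 \<le> \<kappa>\<^sup>2 * (2 * (a + cmod (1 - h w))\<^sup>2)"
      by (rule mult_left_mono) simp
    also have "\<dots> = 2 * (\<kappa> * (a + cmod (1 - h w)))\<^sup>2" by (simp add: power_mult_distrib)
    also have "\<dots> \<le> 2 * (cmod (z - h w))\<^sup>2"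
      using far[OF w] \<kappa> a by (intro mult_left_mono power_mono) auto
    finally have den: "\<kappa>\<^sup>2 * (a + psi s)\<^sup>2 / 2 \<le> (cmod (z - h w))\<^sup>2" by simp
    have num: "cmod (deriv h w) \<le> 2 * psi' s"
      using norm_deriv_h_le[of w] w psi'_antimono[OF s] by simp
    have "cmod (deriv f w) = cmod (deriv h w) / (cmod (z - h w))\<^sup>2"
      by (simp add: df[OF w] norm_divide norm_power)
    also have "\<dots> \<le> 2 * psi' s / (\<kappa>\<^sup>2 * (a + psi s)\<^sup>2 / 2)"
      using num den p \<kappa> by (intro frac_le) (auto simp: psi'_nonneg)
    finally show ?thesis by simp
  qed
  have bound_r: "(\<Sum>n<N. F (Suc n) * r ^ n) \<le> 64 / (\<kappa>\<^sup>2 * a)" if r: "1/4 \<le> r" "r < 1" for r :: real and N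
  proof -
    define g where "g t = cmod (deriv f (r * cis t))" for t
    have cont: "continuous_on S g" for S
      unfolding g_def using r holomorphic_deriv[OF f]
      by (intro continuous_intros continuous_on_compose2[OF holomorphic_on_imp_continuous_on[of "deriv f" "ball 0 1"]])
         (auto simp: norm_mult)
    \<comment> \<open>the estimate on one half of the circle, with an affine lower bound \<open>s\<close> of the distance to \<open>1\<close>\<close>
    have half: "integral {u..v} g \<le> 32 / (\<kappa>\<^sup>2 * a)"
      if uv: "u \<le> v" and s: "\<And>t. t \<in> {u..v} \<Longrightarrow> 0 < s t \<and> s t < 2 \<and> s t \<le> cmod (1 - r * cis t)"
        and ds: "\<And>t. (s has_real_derivative m) (at t)" and m: "\<bar>m\<bar> = 1 / 8" for u v s m
    proof -
      obtain I where I: "((\<lambda>t. psi' (s t) / (a + psi (s t))\<^sup>2) has_integral I) {u..v}" "I \<le> 8 / a"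
        using integral_psi_quotient_le[of u v s m a] s uv ds m a by auto
      have "integral {u..v} g \<le> 4 / \<kappa>\<^sup>2 * I"
      proof (rule has_integral_le)
        show "(g has_integral integral {u..v} g) {u..v}"
          by (intro integrable_integral integrable_continuous_interval cont)
        show "((\<lambda>t. 4 / \<kappa>\<^sup>2 * (psi' (s t) / (a + psi (s t))\<^sup>2)) has_integral 4 / \<kappa>\<^sup>2 * I) {u..v}"
          by (intro has_integral_mult_right I)
        fix t assume "t \<in> {u..v}"
        then show "g t \<le> 4 / \<kappa>\<^sup>2 * (psi' (s t) / (a + psi (s t))\<^sup>2)"
          unfolding g_def using s[of t] r by (intro pointwise) (auto simp: norm_mult)
      qed
      also have "\<dots> \<le> 4 / \<kappa>\<^sup>2 * (8 / a)" using I \<kappa> by (intro mult_left_mono) auto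
      finally show ?thesis by simp
    qed
    have "integral {0..2*pi} g = integral {0..pi} g + integral {pi..2*pi} g"
      by (intro Henstock_Kurzweil_Integration.integral_combine[symmetric] integrable_continuous_interval cont) auto
    also have "integral {0..pi} g \<le> 32 / (\<kappa>\<^sup>2 * a)"
    proof (rule half[where s="\<lambda>t. ((1 - r) + t / 4) / 2" and m="1/8"])
      fix t assume "t \<in> {0..pi}"
      then show "0 < ((1 - r) + t / 4) / 2 \<and> ((1 - r) + t / 4) / 2 < 2 \<and> ((1 - r) + t / 4) / 2 \<le> cmod (1 - r * cis t)"
        using r norm_one_minus_circle_ge[OF r, of t] pi_less_4 by auto
    qed (auto intro!: derivative_eq_intros)
    also have "integral {pi..2*pi} g \<le> 32 / (\<kappa>\<^sup>2 * a)"
    proof (rule half[where s="\<lambda>t. ((1 - r) + (2 * pi - t) / 4) / 2" and m="-1/8"])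
      fix t assume t: "t \<in> {pi..2*pi}"
      have "cis (2 * pi - t) = cnj (cis t)" by (simp add: complex_eq_iff cos_diff sin_diff)
      then have "cmod (1 - r * cis (2 * pi - t)) = cmod (cnj (1 - r * cis t))"
        by (simp del: complex_mod_cnj)
      also have "\<dots> = cmod (1 - r * cis t)" by (rule complex_mod_cnj)
      finally show "0 < ((1 - r) + (2 * pi - t) / 4) / 2 \<and> ((1 - r) + (2 * pi - t) / 4) / 2 < 2
          \<and> ((1 - r) + (2 * pi - t) / 4) / 2 \<le> cmod (1 - r * cis t)"
        using t r norm_one_minus_circle_ge[OF r, of "2 * pi - t"] pi_less_4
        by (simp only: atLeastAtMost_iff) (auto simp: field_simps)
    qed (auto intro!: derivative_eq_intros)
    finally have "integral {0..2*pi} g \<le> 64 / (\<kappa>\<^sup>2 * a)" by (simp add: mult.commute)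
    moreover have "(\<Sum>n<N. F (Suc n) * r ^ n) \<le> integral {0..2*pi} g"
      unfolding F_def g_def using r by (intro Hardy_inequality_square[OF f G fG]) auto
    ultimately show ?thesis by linarith
  qed
  \<comment> \<open>the bound is uniform in \<open>r\<close>, so it persists for \<open>r \<rightarrow> 1\<close>\<close>
  have bound: "(\<Sum>n<N. F (Suc n)) \<le> 64 / (\<kappa>\<^sup>2 * a)" for N
  proof (rule tendsto_upperbound)
    have "((\<lambda>r. \<Sum>n<N. F (Suc n) * r ^ n) \<longlongrightarrow> (\<Sum>n<N. F (Suc n) * 1 ^ n)) (at_left 1)"
      by (intro tendsto_intros)
    then show "((\<lambda>r. \<Sum>n<N. F (Suc n) * r ^ n) \<longlongrightarrow> (\<Sum>n<N. F (Suc n))) (at_left 1)" by simp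
    have "eventually (\<lambda>r. r \<in> {1/4<..<1}) (at_left (1::real))" by (intro eventually_at_left_real) auto
    then show "eventually (\<lambda>r. (\<Sum>n<N. F (Suc n) * r ^ n) \<le> 64 / (\<kappa>\<^sup>2 * a)) (at_left 1)"
      by eventually_elim (auto intro: bound_r)
  qed simp
  have F0: "F 0 \<le> 1 / (\<kappa> * a)"
  proof -
    have "\<kappa> * a \<le> \<kappa> * (a + cmod (1 - h 0))" using \<kappa> by simp
    also have "\<dots> \<le> cmod (z - h 0)" by (rule far) simp
    finally have "1 / cmod (z - h 0) \<le> 1 / (\<kappa> * a)" using \<kappa> a zh[of 0] by (intro divide_left_mono) auto
    then show ?thesis by (simp add: F_def f_def fps_expansion_def norm_divide)
  qed
  have s: "summable (\<lambda>n. F (Suc n))"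
    by (rule bounded_imp_summable[OF _ bound[of "Suc _", unfolded lessThan_Suc_atMost]]) (simp add: F_def)
  then have s': "summable F" by (simp add: summable_Suc_iff)
  have "(\<Sum>n. F n) = F 0 + (\<Sum>n. F (Suc n))" using suminf_split_head[OF s'] by simp
  also have "\<dots> \<le> 1 / (\<kappa> * a) + 64 / (\<kappa>\<^sup>2 * a)"
    by (intro add_mono F0 suminf_le_const[OF s bound])
  finally show "(\<Sum>n. cmod (fps_nth (fps_expansion (\<lambda>w. 1 / (z - h w)) 0) n)) \<le> 1 / (\<kappa> * a) + 64 / (\<kappa>\<^sup>2 * a)"
    unfolding F_def[abs_def] f_def[abs_def] .
  show "summable (\<lambda>n. cmod (fps_nth (fps_expansion (\<lambda>w. 1 / (z - h w)) 0) n))"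
    using s' unfolding F_def[abs_def] f_def[abs_def] .
qed

end

section \<open>Sectors and the range of a regular Hausdorff function\<close>

lemma cos_abs_mono_iff:
  fixes x y :: real
  assumes "\<bar>x\<bar> \<le> pi" "0 \<le> y" "y \<le> pi"
  shows "cos y \<le> cos x \<longleftrightarrow> \<bar>x\<bar> \<le> y"
  using cos_mono_le_eq[of y "\<bar>x\<bar>"] assms by simp

lemma abs_Arg_le_pi: "\<bar>Arg z\<bar> \<le> pi"
  using Arg_bounded[of z] by (auto simp: abs_le_iff)

lemma Re_eq_norm_cos_Arg: "Re z = cmod z * cos (Arg z)"
  by (metis Re_rcis rcis_cmod_Arg)

lemma Im_eq_norm_sin_Arg: "Im z = cmod z * sin (Arg z)"
  by (metis Im_rcis rcis_cmod_Arg)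

text \<open>The right-hand side is a closed condition. Conversely, a point that satisfies it is
  approached from within the sector by shrinking its argument; the modulus is enlarged at the same
  time in order to treat the vertex in the same way.\<close>

lemma closure_sector_iff_cos:
  assumes \<beta>: "0 < \<beta>" "\<beta> < pi"
  shows "v \<in> closure (sector \<beta>) \<longleftrightarrow> cmod v * cos \<beta> \<le> Re v"
proof
  have "sector \<beta> \<subseteq> {v. cmod v * cos \<beta> \<le> Re v}"
  proof safe
    fix v assume "v \<in> sector \<beta>"
    then have "cos \<beta> \<le> cos (Arg v)"
      using \<beta> cos_abs_mono_iff[OF abs_Arg_le_pi, of \<beta> v] by (simp add: sector_def)
    then show "cmod v * cos \<beta> \<le> Re v"
      unfolding Re_eq_norm_cos_Arg by (intro mult_left_mono) auto
  qed
  moreover have "closed {v. cmod v * cos \<beta> \<le> Re v}"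
    by (intro closed_Collect_le continuous_intros)
  ultimately have "closure (sector \<beta>) \<subseteq> {v. cmod v * cos \<beta> \<le> Re v}"
    by (rule closure_minimal)
  then show "v \<in> closure (sector \<beta>) \<Longrightarrow> cmod v * cos \<beta> \<le> Re v" by blast
next
  assume v: "cmod v * cos \<beta> \<le> Re v"
  have Arg: "\<bar>Arg v\<bar> \<le> \<beta>"
  proof (cases "v = 0")
    case False
    then have "cos \<beta> \<le> cos (Arg v)" using v unfolding Re_eq_norm_cos_Arg by simp
    then show ?thesis using \<beta> cos_abs_mono_iff[OF abs_Arg_le_pi, of \<beta> v] by simp
  qed (use \<beta> in \<open>simp add: Arg_zero\<close>)
  define g where "g s = of_real (cmod v + (1 - s)) * cis (s * Arg v)" for s
  have "g s \<in> sector \<beta>" if s: "0 < s" "s < 1" for s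
  proof -
    have "s * \<bar>Arg v\<bar> < \<beta>"
    proof (cases "Arg v = 0")
      case False
      then have "s * \<bar>Arg v\<bar> < 1 * \<bar>Arg v\<bar>" using s by (intro mult_strict_right_mono) auto
      with Arg show ?thesis by simp
    qed (use \<beta> in simp)
    then have *: "\<bar>s * Arg v\<bar> < \<beta>" using s by (simp add: abs_mult)
    have r: "0 < cmod v + (1 - s)" using s by (intro add_nonneg_pos) auto
    then have "g s \<noteq> 0" unfolding g_def by (simp del: of_real_add of_real_diff)
    moreover have "Arg (g s) = s * Arg v"
      using * \<beta> by (intro Arg_unique[OF _ r]) (auto simp: g_def cis_conv_exp)
    ultimately show ?thesis using * by (simp add: sector_def)
  qed
  moreover have "eventually (\<lambda>s. s \<in> {0<..<1}) (at_left (1::real))" by (intro eventually_at_left_real) auto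
  ultimately have "eventually (\<lambda>s. g s \<in> closure (sector \<beta>)) (at_left 1)"
    by (auto elim!: eventually_mono intro: closure_subset[THEN subsetD])
  moreover have "(g \<longlongrightarrow> g 1) (at_left 1)"
    unfolding g_def by (intro tendsto_intros)
  moreover have "g 1 = v" by (simp add: g_def rcis_cmod_Arg[unfolded rcis_def])
  ultimately show "v \<in> closure (sector \<beta>)"
    using Lim_in_closed_set[OF closed_closure] trivial_limit_at_left_real by metis
qed

lemma closure_sector_iff_Arg:
  assumes \<beta>: "0 < \<beta>" "\<beta> < pi"
  shows "v \<in> closure (sector \<beta>) \<longleftrightarrow> v = 0 \<or> \<bar>Arg v\<bar> \<le> \<beta>"
  unfolding closure_sector_iff_cos[OF \<beta>] Re_eq_norm_cos_Arg
  using \<beta> cos_abs_mono_iff[OF abs_Arg_le_pi, of \<beta> v] by (cases "v = 0") auto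

text \<open>The arguments of \<open>v\<close> and \<open>w\<close> differ by an angle of at least \<open>\<omega> - \<gamma>\<close>. The law of cosines
  then gives the constant, which is \<open>sin ((\<omega> - \<gamma>) / 2)\<close>.\<close>

lemma sectors_separated:
  assumes \<gamma>: "0 < \<gamma>" "\<gamma> < \<omega>" "\<omega> < pi"
    and v: "v \<in> closure (sector \<gamma>)" and w: "w \<notin> closure (sector \<omega>)"
  shows "sqrt ((1 - cos (\<omega> - \<gamma>)) / 2) * (cmod v + cmod w) \<le> cmod (v - w)"
proof -
  define q where "q = cos (\<omega> - \<gamma>)"
  have q: "-1 \<le> q" "q \<le> 1" by (simp_all add: q_def)
  have key: "Re (v * cnj w) \<le> cmod v * cmod w * q"
  proof (cases "v = 0")
    case False
    define \<alpha> \<beta> where "\<alpha> = \<bar>Arg v\<bar>" and "\<beta> = \<bar>Arg w\<bar>"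
    have \<alpha>: "0 \<le> \<alpha>" "\<alpha> \<le> \<gamma>" using v False \<gamma> closure_sector_iff_Arg[of \<gamma> v] by (auto simp: \<alpha>_def)
    have \<beta>: "\<omega> \<le> \<beta>" "\<beta> \<le> pi" using w \<gamma> closure_sector_iff_Arg[of \<omega> w] abs_Arg_le_pi[of w] by (auto simp: \<beta>_def)
    have sa: "\<bar>sin x\<bar> = sin \<bar>x\<bar>" if "\<bar>x\<bar> \<le> pi" for x :: real
      using that sin_ge_zero[of "\<bar>x\<bar>"] by (cases "x \<ge> 0") auto
    have "sin (Arg v) * sin (Arg w) \<le> \<bar>sin (Arg v)\<bar> * \<bar>sin (Arg w)\<bar>"
      unfolding abs_mult[symmetric] by (rule abs_ge_self)
    also have "\<dots> = sin \<beta> * sin \<alpha>" by (simp add: sa abs_Arg_le_pi \<alpha>_def \<beta>_def)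
    finally have "cos (Arg v) * cos (Arg w) + sin (Arg v) * sin (Arg w) \<le> cos (\<beta> - \<alpha>)"
      by (simp add: cos_diff \<alpha>_def \<beta>_def)
    also have "\<dots> \<le> q" unfolding q_def using \<alpha> \<beta> \<gamma> by (intro cos_monotone_0_pi_le) auto
    finally have "cmod v * cmod w * (cos (Arg v) * cos (Arg w) + sin (Arg v) * sin (Arg w)) \<le> cmod v * cmod w * q"
      by (intro mult_left_mono) auto
    then show ?thesis
      by (simp add: Re_eq_norm_cos_Arg[of v] Re_eq_norm_cos_Arg[of w] Im_eq_norm_sin_Arg[of v] Im_eq_norm_sin_Arg[of w] algebra_simps)
  qed simp
  have "0 \<le> (1 + q) / 2 * (cmod v - cmod w)\<^sup>2" using q by simp
  also have "\<dots> = (cmod v)\<^sup>2 + (cmod w)\<^sup>2 - 2 * (cmod v * cmod w * q) - (1 - q) / 2 * (cmod v + cmod w)\<^sup>2"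
    by (simp add: power2_eq_square field_simps)
  finally have "(1 - q) / 2 * (cmod v + cmod w)\<^sup>2 \<le> (cmod v)\<^sup>2 + (cmod w)\<^sup>2 - 2 * Re (v * cnj w)"
    using key by linarith
  also have "\<dots> = (cmod (v - w))\<^sup>2"
    unfolding cmod_power2 by (simp add: power2_eq_square algebra_simps)
  finally have "(sqrt ((1 - q) / 2) * (cmod v + cmod w))\<^sup>2 \<le> (cmod (v - w))\<^sup>2"
    using q by (simp add: power_mult_distrib)
  then show ?thesis unfolding q_def by (rule power2_le_imp_le) simp
qed

context hausdorff_representation
begin

text \<open>The continuous extension of \<open>h\<close> to the closed disc.\<close>

definition boundary_h :: "complex \<Rightarrow> complex" where
  "boundary_h w = (\<Sum>n. of_real (c n) * w ^ n)"

lemma boundary_h_sums: "cmod w \<le> 1 \<Longrightarrow> (\<lambda>n. of_real (c n) * w ^ n) sums boundary_h w"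
  unfolding boundary_h_def
proof (intro summable_sums summable_comparison_test'[OF sums_summable[OF coeff_sums]])
  show "norm (of_real (c n) * w ^ n) \<le> c n" if "cmod w \<le> 1" for n
    using that coeff_nonneg[of n] by (simp add: norm_mult norm_power mult_left_le power_le_one)
qed

lemma boundary_h_eq: "w \<in> ball 0 1 \<Longrightarrow> boundary_h w = h w"
  unfolding boundary_h_def using h_sums by (simp add: sums_iff)

lemma boundary_h_1: "boundary_h 1 = 1"
proof -
  have "(\<lambda>n. complex_of_real (c n)) sums 1" using sums_of_real[OF coeff_sums, where 'a=complex] by simp
  then show ?thesis by (simp add: boundary_h_def sums_iff)
qed

lemma continuous_on_boundary_h: "continuous_on (cball 0 1) boundary_h"
proof (rule uniform_limit_theorem)
  show "uniform_limit (cball 0 1) (\<lambda>N w. \<Sum>n<N. of_real (c n) * w ^ n) boundary_h sequentially"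
    unfolding boundary_h_def
  proof (rule Weierstrass_m_test[OF _ sums_summable[OF coeff_sums]])
    show "norm (of_real (c n) * w ^ n) \<le> c n" if "w \<in> cball 0 1" for n and w :: complex
      using that coeff_nonneg[of n] by (simp add: norm_mult norm_power mult_left_le power_le_one)
  qed
qed (auto intro!: always_eventually continuous_intros)

text \<open>Equality in the triangle inequality \<open>\<bar>\<Sum>n. c n w\<^sup>n\<bar> \<le> \<Sum>n. c n = 1\<close> forces all powers \<open>w\<^sup>n\<close> with \<open>c n \<noteq> 0\<close>
  to coincide. Two different such powers, \<open>w\<close> and either \<open>w\<^sup>0\<close> or \<open>w\<^sup>2\<close>, give \<open>w = 1\<close>.\<close>

lemma boundary_h_peak:
  assumes c1: "c 1 \<noteq> 0" and m: "c m \<noteq> 0" "m = 0 \<or> m = 2"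
    and w: "cmod w \<le> 1" and peak: "1 \<le> cmod (boundary_h w)"
  shows "w = 1"
proof -
  define u where "u = sgn (boundary_h w)"
  have u: "cmod u = 1" using peak by (auto simp: u_def norm_sgn)
  have "boundary_h w = of_real (cmod (boundary_h w)) * u" by (simp add: u_def sgn_eq)
  then have "cnj u * boundary_h w = of_real (cmod (boundary_h w)) * (u * cnj u)"
    by (metis mult.assoc mult.commute)
  also have "u * cnj u = 1" using u complex_norm_square[of u] by simp
  finally have r: "Re (cnj u * boundary_h w) = cmod (boundary_h w)"
    by (simp only: mult_1_right Re_complex_of_real)
  have "(\<lambda>n. Re (cnj u * (of_real (c n) * w ^ n))) sums Re (cnj u * boundary_h w)"
    by (intro sums_Re sums_mult boundary_h_sums w)
  then have "(\<lambda>n. c n - Re (cnj u * (of_real (c n) * w ^ n))) sums (1 - cmod (boundary_h w))"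
    unfolding r by (intro sums_diff coeff_sums)
  then have s: "(\<lambda>n. c n * (1 - Re (cnj u * w ^ n))) sums (1 - cmod (boundary_h w))"
    by (simp add: algebra_simps)
  have le: "cmod (cnj u * w ^ n) \<le> 1" for n
    using u w by (simp add: norm_mult norm_power power_le_one)
  have nn: "0 \<le> c n * (1 - Re (cnj u * w ^ n))" for n
    using coeff_nonneg[of n] complex_Re_le_cmod[of "cnj u * w ^ n"] le[of n] by (intro mult_nonneg_nonneg) auto
  have "(\<Sum>n. c n * (1 - Re (cnj u * w ^ n))) = 0"
    using s peak suminf_nonneg[OF sums_summable[OF s] nn] by (simp add: sums_iff)
  then have zero: "c n * (1 - Re (cnj u * w ^ n)) = 0" for n
    using suminf_eq_zero_iff[OF sums_summable[OF s] nn] by simp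
  have power: "w ^ n = u" if "c n \<noteq> 0" for n
  proof -
    have R: "Re (cnj u * w ^ n) = 1" using zero[of n] that by simp
    have "(Re (cnj u * w ^ n))\<^sup>2 + (Im (cnj u * w ^ n))\<^sup>2 \<le> 1"
      unfolding cmod_power2[symmetric] using le[of n] by (simp add: power_le_one)
    then have "Im (cnj u * w ^ n) = 0" unfolding R by simp
    with R have "cnj u * w ^ n = 1" by (simp add: complex_eq_iff)
    then have "u * cnj u * w ^ n = u" by (simp add: mult.assoc)
    moreover have "u * cnj u = 1" using u complex_norm_square[of u] by simp
    ultimately show ?thesis by simp
  qed
  have "w = u" using power[OF c1] by simp
  moreover have "u \<noteq> 0" using u by auto
  ultimately show ?thesis using power[OF m(1)] m(2) by (auto simp: power2_eq_square)
qed

text \<open>The point \<open>z\<close> has positive distance from the compact image of the closed disc, and \<open>\<bar>1 - h\<bar> \<le> 2\<close>.\<close>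

lemma far_outside_disc:
  assumes c1: "c 1 \<noteq> 0" and m: "c 0 \<noteq> 0 \<or> c 2 \<noteq> 0" and z: "1 \<le> cmod z" "z \<noteq> 1"
  obtains \<kappa> where "0 < \<kappa>" "\<And>w. w \<in> ball 0 1 \<Longrightarrow> \<kappa> * (1 + cmod (1 - h w)) \<le> cmod (z - h w)"
proof -
  have "\<exists>x\<in>cball 0 1. \<forall>y\<in>cball 0 1. cmod (z - boundary_h x) \<le> cmod (z - boundary_h y)"
    by (intro continuous_attains_inf continuous_intros continuous_on_boundary_h) auto
  then obtain x where x: "cmod x \<le> 1" and le: "\<And>y. cmod y \<le> 1 \<Longrightarrow> cmod (z - boundary_h x) \<le> cmod (z - boundary_h y)"
    by auto
  define \<delta> where "\<delta> = cmod (z - boundary_h x)"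
  have "boundary_h x \<noteq> z"
  proof
    assume eq: "boundary_h x = z"
    then have "x = 1" using boundary_h_peak[OF c1 _ _ x] m z by auto
    then show False using eq z boundary_h_1 by simp
  qed
  then have \<delta>: "0 < \<delta>" by (simp add: \<delta>_def)
  show ?thesis
  proof
    show "0 < \<delta> / 3" using \<delta> by simp
    fix w :: complex assume w: "w \<in> ball 0 1"
    have "cmod (boundary_h w) \<le> 1"
    proof -
      have "(\<lambda>n. of_real (c n) * w ^ n) sums boundary_h w" using w by (intro boundary_h_sums) auto
      moreover have "norm (of_real (c n) * w ^ n) \<le> c n" for n
        using w coeff_nonneg[of n] by (simp add: norm_mult norm_power mult_left_le power_le_one)
      ultimately show ?thesis using norm_sums_le[OF _ coeff_sums] by blast
    qed
    then have "cmod (1 - h w) \<le> 2"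
      using norm_triangle_ineq4[of 1 "h w"] boundary_h_eq[OF w] by simp
    then have "\<delta> / 3 * (1 + cmod (1 - h w)) \<le> \<delta> / 3 * 3" using \<delta> by (intro mult_left_mono) auto
    also have "\<dots> \<le> cmod (z - h w)" using le[of w] w boundary_h_eq[OF w] by (simp add: \<delta>_def)
    finally show "\<delta> / 3 * (1 + cmod (1 - h w)) \<le> cmod (z - h w)" .
  qed
qed

text \<open>If \<open>c 2 = 0\<close> then \<open>c n = 0\<close> for all \<open>n \<ge> 2\<close>, since moments on \<open>[0,1)\<close> decrease. With \<open>c 0 = 0\<close> this leaves \<open>h w = w\<close>; but
  \<open>1 - w\<close> takes values on every ray in the open right half-plane.\<close>

lemma sector_imp_not_identity:
  assumes \<gamma>: "0 < \<gamma>" "\<gamma> < pi / 2"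
    and sect: "\<And>w. w \<in> ball 0 1 \<Longrightarrow> 1 - h w \<in> closure (sector \<gamma>)"
  shows "c 0 \<noteq> 0 \<or> c 2 \<noteq> 0"
proof (rule ccontr)
  assume "\<not> (c 0 \<noteq> 0 \<or> c 2 \<noteq> 0)"
  then have z: "c 0 = 0" "c 2 = 0" by auto
  have cn: "c n = (if n = 1 then c 1 else 0)" for n
  proof -
    have "c (Suc k) = 0" if "1 \<le> k" for k
      using coeff_Suc_antimono[OF that] coeff_nonneg[of "Suc k"] z by (simp add: numeral_2_eq_2)
    from this[of "n - 1"] show ?thesis using z by (cases "n = 0"; cases "n = 1") auto
  qed
  have "(\<lambda>n. if n = 1 then c 1 else 0) sums c 1" by (rule sums_single)
  moreover have "(\<lambda>n. if n = 1 then c 1 else 0) = c" by (rule ext) (rule cn[symmetric])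
  ultimately have "c sums c 1" by (simp only:)
  then have c1: "c 1 = 1" using coeff_sums sums_unique2 by blast
  have h: "h w = w" if "w \<in> ball 0 1" for w
  proof -
    have "(\<lambda>n. if n = 1 then w ^ n else 0) sums w ^ 1" by (rule sums_single)
    moreover have "of_real (c n) * w ^ n = (if n = 1 then w ^ n else 0)" for n
      using cn[of n] c1 by (cases "n = 1") auto
    ultimately have "(\<lambda>n. of_real (c n) * w ^ n) sums w" by simp
    then show ?thesis using h_sums[OF that] sums_unique2 by blast
  qed
  \<comment> \<open>a point \<open>w\<close> of the disc for which \<open>1 - w\<close> has argument \<open>\<phi> > \<gamma>\<close>\<close>
  define \<phi> where "\<phi> = (\<gamma> + pi / 2) / 2"
  have \<phi>: "\<gamma> < \<phi>" "\<phi> < pi / 2" using \<gamma> by (auto simp: \<phi>_def)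
  have cp: "0 < cos \<phi>" using \<phi> \<gamma> by (intro cos_gt_zero_pi) auto
  define w where "w = 1 - of_real (cos \<phi>) * cis \<phi>"
  have "(cmod w)\<^sup>2 = (1 - (cos \<phi>)\<^sup>2)\<^sup>2 + (cos \<phi>)\<^sup>2 * (sin \<phi>)\<^sup>2"
    unfolding cmod_power2 by (simp add: w_def power2_eq_square algebra_simps)
  also have "(sin \<phi>)\<^sup>2 = 1 - (cos \<phi>)\<^sup>2" by (simp add: sin_squared_eq)
  finally have "(cmod w)\<^sup>2 = 1 - (cos \<phi>)\<^sup>2" by (simp add: power2_eq_square algebra_simps)
  then have "(cmod w)\<^sup>2 < 1\<^sup>2" using cp by simp
  then have "w \<in> ball 0 1" using power2_less_imp_less by fastforce
  from sect[OF this] h[OF this] have "cmod (1 - w) * cos \<gamma> \<le> Re (1 - w)"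
    using \<gamma> by (simp add: closure_sector_iff_cos)
  then have "cos \<gamma> \<le> cos \<phi>" using cp by (simp add: w_def norm_mult)
  moreover have "cos \<phi> < cos \<gamma>" using \<gamma> \<phi> by (intro cos_monotone_0_pi) auto
  ultimately show False by simp
qed

end

section \<open>Absolutely summable power series and bounded operators\<close>

text \<open>Members of the Wiener algebra are represented by formal power series, so that multiplication is available as
  the Cauchy product and identities between coefficients are identities of series.\<close>

definition absolutely_summable :: "complex fps \<Rightarrow> bool" where
  "absolutely_summable F \<longleftrightarrow> summable (\<lambda>n. cmod (fps_nth F n))"

definition coeff_norm :: "complex fps \<Rightarrow> real" where
  "coeff_norm F = (\<Sum>n. cmod (fps_nth F n))"

lemma coeff_norm_nonneg: "absolutely_summable F \<Longrightarrow> 0 \<le> coeff_norm F"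
  unfolding coeff_norm_def absolutely_summable_def by (intro suminf_nonneg) auto

lemma absolutely_summable_add:
  "absolutely_summable F \<Longrightarrow> absolutely_summable G \<Longrightarrow> absolutely_summable (F + G)"
  unfolding absolutely_summable_def fps_add_nth
  by (rule summable_comparison_test'[OF summable_add[of "\<lambda>n. cmod (fps_nth F n)" "\<lambda>n. cmod (fps_nth G n)"]])
     (auto intro: norm_triangle_ineq)

lemma absolutely_summable_const_mult:
  "absolutely_summable F \<Longrightarrow> absolutely_summable (fps_const b * F)"
  unfolding absolutely_summable_def by (simp add: norm_mult summable_mult)

lemma absolutely_summable_uminus: "absolutely_summable F \<Longrightarrow> absolutely_summable (- F)"
  unfolding absolutely_summable_def by simp

lemma absolutely_summable_finite:
  "(\<And>n. n \<ge> N \<Longrightarrow> fps_nth F n = 0) \<Longrightarrow> absolutely_summable F"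
  unfolding absolutely_summable_def by (rule summable_finite[of "{..<N}"]) auto

lemma coeff_norm_mult:
  assumes "absolutely_summable F" "absolutely_summable G"
  shows "absolutely_summable (F * G)" and "coeff_norm (F * G) \<le> coeff_norm F * coeff_norm G"
proof -
  have s: "(\<lambda>n. \<Sum>i\<le>n. cmod (fps_nth F i) * cmod (fps_nth G (n - i))) sums (coeff_norm F * coeff_norm G)"
    unfolding coeff_norm_def using assms unfolding absolutely_summable_def
    by (intro Cauchy_product_sums) auto
  have le: "cmod (fps_nth (F * G) n) \<le> (\<Sum>i\<le>n. cmod (fps_nth F i) * cmod (fps_nth G (n - i)))" for n
    unfolding fps_mult_nth atLeast0AtMost by (intro sum_norm_le) (simp add: norm_mult)
  show a: "absolutely_summable (F * G)"
    unfolding absolutely_summable_def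
    by (rule summable_comparison_test'[OF sums_summable[OF s]]) (use le in simp)
  show "coeff_norm (F * G) \<le> coeff_norm F * coeff_norm G"
    unfolding sums_unique[OF s] coeff_norm_def[of "F * G"]
    using a[unfolded absolutely_summable_def] by (intro suminf_le le sums_summable[OF s])
qed

lemma coeff_norm_tail:
  assumes "absolutely_summable F"
  shows "absolutely_summable (F - fps_cutoff n F)"
    and "(\<lambda>n. coeff_norm (F - fps_cutoff n F)) \<longlonglongrightarrow> 0"
proof -
  have s: "summable (\<lambda>k. cmod (fps_nth F k))" using assms by (simp add: absolutely_summable_def)
  have eq: "cmod (fps_nth (F - fps_cutoff n F) (k + n)) = cmod (fps_nth F (k + n))" for n k
    by simp
  have z: "(\<Sum>k<n. cmod (fps_nth (F - fps_cutoff n F) k)) = 0" for n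
    by (intro sum.neutral) auto
  have s': "summable (\<lambda>k. cmod (fps_nth (F - fps_cutoff n F) k))" for n
    using s summable_iff_shift[of "\<lambda>k. cmod (fps_nth (F - fps_cutoff n F) k)" n]
      summable_iff_shift[of "\<lambda>k. cmod (fps_nth F k)" n] by (simp only: eq)
  show "absolutely_summable (F - fps_cutoff n F)" unfolding absolutely_summable_def by (rule s')
  have "coeff_norm (F - fps_cutoff n F) = (\<Sum>k. cmod (fps_nth F (k + n)))" for n
    unfolding coeff_norm_def using suminf_split_initial_segment[OF s'[of n], of n] by (simp only: eq z add_0_right)
  then show "(\<lambda>n. coeff_norm (F - fps_cutoff n F)) \<longlonglongrightarrow> 0"
    using suminf_exist_split2[OF s] by simp
qed

context complex_normed_space
begin

lemma smult_carrier [simp, intro]: "x \<in> carrier X \<Longrightarrow> a \<odot>\<^bsub>X\<^esub> x \<in> carrier X"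
  using smult_closed[of a x] by (simp add: complex_ring_def)

lemma smult_add_left: "x \<in> carrier X \<Longrightarrow> (a + b) \<odot>\<^bsub>X\<^esub> x = a \<odot>\<^bsub>X\<^esub> x \<oplus> b \<odot>\<^bsub>X\<^esub> x"
  using smult_l_distr[of a b x] by (simp add: complex_ring_def)

lemma smult_add_right:
  "x \<in> carrier X \<Longrightarrow> y \<in> carrier X \<Longrightarrow> a \<odot>\<^bsub>X\<^esub> (x \<oplus> y) = a \<odot>\<^bsub>X\<^esub> x \<oplus> a \<odot>\<^bsub>X\<^esub> y"
  using smult_r_distr[of a x y] by (simp add: complex_ring_def)

lemma smult_smult: "x \<in> carrier X \<Longrightarrow> a \<odot>\<^bsub>X\<^esub> (b \<odot>\<^bsub>X\<^esub> x) = (a * b) \<odot>\<^bsub>X\<^esub> x"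
  using smult_assoc1[of a b x] by (simp add: complex_ring_def)

lemma smult_1: "x \<in> carrier X \<Longrightarrow> 1 \<odot>\<^bsub>X\<^esub> x = x"
  using smult_one[of x] by (simp add: complex_ring_def)

lemma vnorm_zero [simp]: "vnorm X \<zero> = 0"
  using vnorm_eq_0_iff[of \<zero>] by simp

lemma smult_0: "x \<in> carrier X \<Longrightarrow> 0 \<odot>\<^bsub>X\<^esub> x = \<zero>"
  using vnorm_smult[of x 0] vnorm_eq_0_iff[of "0 \<odot>\<^bsub>X\<^esub> x"] by simp

lemma smult_zero: "a \<odot>\<^bsub>X\<^esub> \<zero> = \<zero>"
  using vnorm_smult[of \<zero> a] vnorm_eq_0_iff[of "a \<odot>\<^bsub>X\<^esub> \<zero>"] by simp

lemma minus_conv: "x \<in> carrier X \<Longrightarrow> y \<in> carrier X \<Longrightarrow> x \<ominus> y = x \<oplus> (-1) \<odot>\<^bsub>X\<^esub> y"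
  by (simp add: smult_minus_one M.minus_eq)

lemma minus_self: "x \<in> carrier X \<Longrightarrow> x \<ominus> x = \<zero>"
  by (simp add: M.minus_eq M.r_neg)

lemma add_minus_add:
  assumes "x \<in> carrier X" "y \<in> carrier X" "x' \<in> carrier X" "y' \<in> carrier X"
  shows "(x \<oplus> y) \<ominus> (x' \<oplus> y') = (x \<ominus> x') \<oplus> (y \<ominus> y')"
  using assms by (simp add: minus_conv smult_add_right M.a_ac)

lemma smult_minus:
  assumes "x \<in> carrier X" "y \<in> carrier X"
  shows "a \<odot>\<^bsub>X\<^esub> (x \<ominus> y) = a \<odot>\<^bsub>X\<^esub> x \<ominus> a \<odot>\<^bsub>X\<^esub> y"
  using assms by (simp add: minus_conv smult_add_right smult_smult)

text \<open>Convergence in norm in the carrier, stated with \<open>vnorm\<close> rather than with the topology of the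
  metric space because limits are only used together with norm estimates.\<close>

definition converges :: "(nat \<Rightarrow> 'a) \<Rightarrow> 'a \<Rightarrow> bool" where
  "converges s y \<longleftrightarrow> (\<forall>n. s n \<in> carrier X) \<and> y \<in> carrier X \<and> (\<lambda>n. vnorm X (s n \<ominus> y)) \<longlonglongrightarrow> 0"

lemma converges_squeeze:
  assumes "\<And>n. s n \<in> carrier X" "y \<in> carrier X" "\<And>n. vnorm X (s n \<ominus> y) \<le> b n" "b \<longlonglongrightarrow> 0"
  shows "converges s y"
  unfolding converges_def
proof (intro conjI allI assms)
  show "(\<lambda>n. vnorm X (s n \<ominus> y)) \<longlonglongrightarrow> 0"
    by (rule tendsto_sandwich[OF _ _ tendsto_const assms(4)])
       (use assms in \<open>auto intro!: always_eventually vnorm_nonneg\<close>)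
qed

lemma converges_unique:
  assumes "converges s y" "converges s y'"
  shows "y = y'"
proof -
  have c: "y \<in> carrier X" "y' \<in> carrier X" "s n \<in> carrier X" for n using assms by (auto simp: converges_def)
  have "vdist X y y' \<le> vdist X (s n) y + vdist X (s n) y'" for n
    using metric.triangle[of y "s n" y'] metric.commute[of y "s n"] c by simp
  then have "vdist X y y' \<le> vnorm X (s n \<ominus> y) + vnorm X (s n \<ominus> y')" for n
    using c by (simp add: vdist_def)
  moreover have "(\<lambda>n. vnorm X (s n \<ominus> y) + vnorm X (s n \<ominus> y')) \<longlonglongrightarrow> 0 + 0"
    using assms unfolding converges_def by (intro tendsto_add) auto
  ultimately have "vdist X y y' \<le> 0"
    by (intro LIMSEQ_le_const[of "\<lambda>n. vnorm X (s n \<ominus> y) + vnorm X (s n \<ominus> y')"]) auto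
  then show ?thesis using metric.zero[of y y'] metric.nonneg[of y y'] c by simp
qed

lemma converges_const: "y \<in> carrier X \<Longrightarrow> converges (\<lambda>n. y) y"
  by (simp add: converges_def minus_self)

lemma converges_add:
  assumes "converges s y" "converges s' y'"
  shows "converges (\<lambda>n. s n \<oplus> s' n) (y \<oplus> y')"
proof -
  have c: "y \<in> carrier X" "y' \<in> carrier X" "s n \<in> carrier X" "s' n \<in> carrier X" for n
    using assms by (auto simp: converges_def)
  show ?thesis
  proof (rule converges_squeeze)
    show "vnorm X ((s n \<oplus> s' n) \<ominus> (y \<oplus> y')) \<le> vnorm X (s n \<ominus> y) + vnorm X (s' n \<ominus> y')" for n
      using c by (simp add: add_minus_add vnorm_triangle)
    show "(\<lambda>n. vnorm X (s n \<ominus> y) + vnorm X (s' n \<ominus> y')) \<longlonglongrightarrow> 0"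
      using tendsto_add[of _ 0 _ _ 0] assms unfolding converges_def by fastforce
  qed (use c in auto)
qed

lemma bounded_op_closed: "bounded_op X T \<Longrightarrow> x \<in> carrier X \<Longrightarrow> T x \<in> carrier X"
  by (auto simp: bounded_op_def)

lemma bounded_op_add:
  "bounded_op X T \<Longrightarrow> x \<in> carrier X \<Longrightarrow> y \<in> carrier X \<Longrightarrow> T (x \<oplus> y) = T x \<oplus> T y"
  by (auto simp: bounded_op_def)

lemma bounded_op_smult:
  "bounded_op X T \<Longrightarrow> x \<in> carrier X \<Longrightarrow> T (a \<odot>\<^bsub>X\<^esub> x) = a \<odot>\<^bsub>X\<^esub> T x"
  by (auto simp: bounded_op_def)

lemma bounded_op_minus:
  "bounded_op X T \<Longrightarrow> x \<in> carrier X \<Longrightarrow> y \<in> carrier X \<Longrightarrow> T (x \<ominus> y) = T x \<ominus> T y"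
  by (simp add: minus_conv bounded_op_add bounded_op_smult bounded_op_closed)

lemma bounded_op_zero: "bounded_op X T \<Longrightarrow> T \<zero> = \<zero>"
  using bounded_op_smult[of T \<zero> 0] by (simp add: smult_0 bounded_op_closed)

lemma bounded_op_bound:
  assumes "bounded_op X T"
  obtains K where "0 \<le> K" "\<And>x. x \<in> carrier X \<Longrightarrow> vnorm X (T x) \<le> K * vnorm X x"
proof -
  obtain K where K: "\<And>x. x \<in> carrier X \<Longrightarrow> vnorm X (T x) \<le> K * vnorm X x"
    using assms unfolding bounded_op_def by blast
  show ?thesis
  proof (rule that[of "\<bar>K\<bar>"])
    show "vnorm X (T x) \<le> \<bar>K\<bar> * vnorm X x" if "x \<in> carrier X" for x
      using K[OF that] mult_right_mono[OF abs_ge_self, of "vnorm X x" K] vnorm_nonneg[OF that] by simp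
  qed simp
qed

lemma converges_bounded_op:
  assumes T: "bounded_op X T" and s: "converges s y"
  shows "converges (\<lambda>n. T (s n)) (T y)"
proof -
  obtain K where K: "0 \<le> K" "\<And>x. x \<in> carrier X \<Longrightarrow> vnorm X (T x) \<le> K * vnorm X x"
    using bounded_op_bound[OF T] by blast
  have c: "y \<in> carrier X" "s n \<in> carrier X" for n using s by (auto simp: converges_def)
  show ?thesis
  proof (rule converges_squeeze)
    show "vnorm X (T (s n) \<ominus> T y) \<le> K * vnorm X (s n \<ominus> y)" for n
      using K(2)[of "s n \<ominus> y"] c by (simp add: bounded_op_minus[OF T])
    show "(\<lambda>n. K * vnorm X (s n \<ominus> y)) \<longlonglongrightarrow> 0"
      using s unfolding converges_def by (intro tendsto_mult_right_zero) auto
  qed (use c bounded_op_closed[OF T] in auto)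
qed

lemma converges_norm_le:
  assumes s: "converges s y" and b: "\<And>n. vnorm X (s n) \<le> B"
  shows "vnorm X y \<le> B"
proof -
  have c: "y \<in> carrier X" "s n \<in> carrier X" for n using s by (auto simp: converges_def)
  have "vnorm X y \<le> vnorm X (s n \<ominus> y) + B" for n
  proof -
    have "y = s n \<ominus> (s n \<ominus> y)"
      using c by (simp add: minus_conv smult_add_right smult_smult smult_1 M.a_assoc[symmetric])
         (simp add: minus_conv[symmetric] minus_self)
    then have "vnorm X y = vnorm X (s n \<ominus> (s n \<ominus> y))" by (rule arg_cong)
    also have "\<dots> = vnorm X (s n \<oplus> (-1) \<odot>\<^bsub>X\<^esub> (s n \<ominus> y))"
      using c by (simp only: minus_conv[of "s n" "s n \<ominus> y"] M.minus_closed)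
    also have "\<dots> \<le> vnorm X (s n) + vnorm X ((-1) \<odot>\<^bsub>X\<^esub> (s n \<ominus> y))"
      using c by (intro vnorm_triangle) auto
    also have "\<dots> \<le> B + vnorm X (s n \<ominus> y)"
      using b[of n] c by (simp add: vnorm_smult)
    finally show ?thesis by simp
  qed
  moreover have "(\<lambda>n. vnorm X (s n \<ominus> y) + B) \<longlonglongrightarrow> 0 + B"
    using s unfolding converges_def by (intro tendsto_intros) auto
  ultimately show ?thesis
    by (intro LIMSEQ_le_const[of "\<lambda>n. vnorm X (s n \<ominus> y) + B"]) auto
qed

lemma op_norm_le:
  assumes "\<And>x. x \<in> carrier X \<Longrightarrow> vnorm X (T x) \<le> B * vnorm X x" and "0 \<le> B"
  shows "op_norm X T \<le> B"
  unfolding op_norm_def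
proof (rule cSUP_least)
  show "{x \<in> carrier X. vnorm X x \<le> 1} \<noteq> {}" using M.zero_closed by force
  fix x assume x: "x \<in> {x \<in> carrier X. vnorm X x \<le> 1}"
  then have "B * vnorm X x \<le> B" using assms(2) by (intro mult_left_le) auto
  then show "vnorm X (T x) \<le> B" using assms(1)[of x] x by simp
qed

lemma bdd_above_unit_ball:
  assumes "bounded_op X T"
  shows "bdd_above ((\<lambda>x. vnorm X (T x)) ` {x \<in> carrier X. vnorm X x \<le> 1})"
proof -
  obtain K where K: "0 \<le> K" "\<And>x. x \<in> carrier X \<Longrightarrow> vnorm X (T x) \<le> K * vnorm X x"
    using bounded_op_bound[OF assms] by blast
  show ?thesis
  proof (rule bdd_aboveI2)
    fix x assume x: "x \<in> {x \<in> carrier X. vnorm X x \<le> 1}"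
    then have "K * vnorm X x \<le> K" using K(1) by (intro mult_left_le) auto
    then show "vnorm X (T x) \<le> K" using K(2)[of x] x by simp
  qed
qed

lemma norm_le_op_norm:
  assumes T: "bounded_op X T" and x: "x \<in> carrier X"
  shows "vnorm X (T x) \<le> op_norm X T * vnorm X x"
proof (cases "vnorm X x = 0")
  case True
  then have "x = \<zero>" using vnorm_eq_0_iff[OF x] by simp
  then show ?thesis by (simp add: bounded_op_zero[OF T])
next
  case False
  then have p: "0 < vnorm X x" using vnorm_nonneg[OF x] by simp
  define y where "y = of_real (1 / vnorm X x) \<odot>\<^bsub>X\<^esub> x"
  have y: "y \<in> carrier X" "vnorm X y \<le> 1" using x p by (auto simp: y_def vnorm_smult norm_divide)
  have "vnorm X (T y) \<le> op_norm X T"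
    unfolding op_norm_def using y bdd_above_unit_ball[OF T] by (intro cSUP_upper) auto
  moreover have "vnorm X (T y) = vnorm X (T x) / vnorm X x"
    using p by (simp add: y_def bounded_op_smult[OF T x] vnorm_smult bounded_op_closed[OF T x] norm_divide)
  ultimately show ?thesis using p by (simp add: pos_divide_le_eq)
qed

lemma bounded_op_diff:
  assumes S: "bounded_op X S" and T: "bounded_op X T"
  shows "bounded_op X (\<lambda>x. S x \<ominus> T x)"
proof -
  obtain K where K: "0 \<le> K" "\<And>x. x \<in> carrier X \<Longrightarrow> vnorm X (S x) \<le> K * vnorm X x"
    using bounded_op_bound[OF S] by blast
  obtain L where L: "0 \<le> L" "\<And>x. x \<in> carrier X \<Longrightarrow> vnorm X (T x) \<le> L * vnorm X x"
    using bounded_op_bound[OF T] by blast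
  note closed = bounded_op_closed[OF S] bounded_op_closed[OF T]
  have "vnorm X (S x \<ominus> T x) \<le> (K + L) * vnorm X x" if x: "x \<in> carrier X" for x
    using vnorm_triangle[of "S x" "(-1) \<odot>\<^bsub>X\<^esub> T x"] K(2)[OF x] L(2)[OF x] x closed
    by (simp add: minus_conv vnorm_smult distrib_right)
  then show ?thesis
    unfolding bounded_op_def
    using closed bounded_op_add[OF S] bounded_op_add[OF T] bounded_op_smult[OF S] bounded_op_smult[OF T]
    by (auto simp: add_minus_add smult_minus)
qed

lemma bounded_op_power:
  assumes "bounded_op X T"
  shows "bounded_op X (T ^^ n)"
proof (induction n)
  case 0
  show ?case by (auto simp: bounded_op_def intro: exI[of _ 1])
next
  case (Suc n)
  obtain K where K: "0 \<le> K" "\<And>x. x \<in> carrier X \<Longrightarrow> vnorm X (T x) \<le> K * vnorm X x"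
    using bounded_op_bound[OF assms] by blast
  obtain L where L: "0 \<le> L" "\<And>x. x \<in> carrier X \<Longrightarrow> vnorm X ((T ^^ n) x) \<le> L * vnorm X x"
    using bounded_op_bound[OF Suc] by blast
  have "vnorm X (T ((T ^^ n) x)) \<le> K * L * vnorm X x" if x: "x \<in> carrier X" for x
    using K(2)[OF bounded_op_closed[OF Suc x]] mult_left_mono[OF L(2)[OF x] K(1)] by simp
  then show ?case
    unfolding bounded_op_def
    using bounded_op_closed[OF Suc] bounded_op_closed[OF assms] bounded_op_add[OF Suc] bounded_op_add[OF assms]
      bounded_op_smult[OF Suc] bounded_op_smult[OF assms]
    by auto
qed

end

section \<open>Power series of a power bounded operator\<close>

context complex_normed_space
begin

lemma op_norm_nonneg:
  assumes "bounded_op X T"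
  shows "0 \<le> op_norm X T"
proof -
  have "vnorm X (T \<zero>) \<le> op_norm X T"
    unfolding op_norm_def using bdd_above_unit_ball[OF assms] by (intro cSUP_upper) auto
  then show ?thesis by (simp add: bounded_op_zero[OF assms])
qed

lemma bounded_op_cong:
  assumes "\<And>x. x \<in> carrier X \<Longrightarrow> S x = T x"
  shows "bounded_op X S \<longleftrightarrow> bounded_op X T"
  unfolding bounded_op_def using assms by (auto simp: Pi_iff)

lemma op_norm_cong:
  assumes "\<And>x. x \<in> carrier X \<Longrightarrow> S x = T x"
  shows "op_norm X S = op_norm X T"
  unfolding op_norm_def using assms by (intro SUP_cong) auto

lemma converges_Suc_imp:
  assumes "converges (\<lambda>n. s (Suc n)) y" "\<And>n. s n \<in> carrier X"
  shows "converges s y"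
  using assms LIMSEQ_imp_Suc[of "\<lambda>n. vnorm X (s n \<ominus> y)"] by (auto simp: converges_def)

end

text \<open>The powers of \<open>T\<close> have a common bound, so every absolutely summable power series can be
  evaluated at \<open>T\<close>.\<close>

locale power_bounded_operator = complex_banach_space +
  fixes T :: "'a \<Rightarrow> 'a"
  assumes power_bounded: "power_bounded X T"
begin

lemma bounded_op_T: "bounded_op X T"
  using power_bounded by (simp add: power_bounded_def)

lemma ex_power_bound: "\<exists>K\<ge>0. \<forall>n. \<forall>x\<in>carrier X. vnorm X ((T ^^ n) x) \<le> K * vnorm X x"
proof -
  obtain K where K: "\<And>n. op_norm X (T ^^ n) \<le> K"
    using power_bounded by (auto simp: power_bounded_def bdd_above_def)
  have "vnorm X ((T ^^ n) x) \<le> K * vnorm X x" if "x \<in> carrier X" for n x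
    using norm_le_op_norm[OF bounded_op_power[OF bounded_op_T] that, of n]
      mult_right_mono[OF K[of n] vnorm_nonneg[OF that]] by linarith
  moreover have "0 \<le> K"
    using op_norm_nonneg[OF bounded_op_power[OF bounded_op_T], of 0] K[of 0] by linarith
  ultimately show ?thesis by blast
qed

definition power_constant :: real where
  "power_constant = (SOME K. 0 \<le> K \<and> (\<forall>n. \<forall>x\<in>carrier X. vnorm X ((T ^^ n) x) \<le> K * vnorm X x))"

lemma power_constant_nonneg: "0 \<le> power_constant"
  and power_le: "x \<in> carrier X \<Longrightarrow> vnorm X ((T ^^ n) x) \<le> power_constant * vnorm X x"
  using someI_ex[OF ex_power_bound] unfolding power_constant_def by blast+

lemma T_closed [simp, intro]: "x \<in> carrier X \<Longrightarrow> T x \<in> carrier X"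
  by (rule bounded_op_closed[OF bounded_op_T])

lemma power_closed [simp, intro]: "x \<in> carrier X \<Longrightarrow> (T ^^ n) x \<in> carrier X"
  by (rule bounded_op_closed[OF bounded_op_power[OF bounded_op_T]])

lemma power_add: "x \<in> carrier X \<Longrightarrow> y \<in> carrier X \<Longrightarrow> (T ^^ n) (x \<oplus> y) = (T ^^ n) x \<oplus> (T ^^ n) y"
  by (rule bounded_op_add[OF bounded_op_power[OF bounded_op_T]])

lemma power_smult: "x \<in> carrier X \<Longrightarrow> (T ^^ n) (a \<odot>\<^bsub>X\<^esub> x) = a \<odot>\<^bsub>X\<^esub> (T ^^ n) x"
  by (rule bounded_op_smult[OF bounded_op_power[OF bounded_op_T]])

definition partial_op :: "complex fps \<Rightarrow> nat \<Rightarrow> 'a \<Rightarrow> 'a" where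
  "partial_op F n x = (\<Oplus>\<^bsub>X\<^esub>k\<in>{..<n}. fps_nth F k \<odot>\<^bsub>X\<^esub> (T ^^ k) x)"

lemma partial_op_0 [simp]: "partial_op F 0 x = \<zero>"
  by (simp add: partial_op_def)

lemma partial_op_Suc:
  assumes "x \<in> carrier X"
  shows "partial_op F (Suc n) x = fps_nth F n \<odot>\<^bsub>X\<^esub> (T ^^ n) x \<oplus> partial_op F n x"
  unfolding partial_op_def lessThan_Suc using assms by (subst M.finsum_insert) auto

lemma partial_op_closed [simp, intro]: "x \<in> carrier X \<Longrightarrow> partial_op F n x \<in> carrier X"
  unfolding partial_op_def by (intro M.finsum_closed) auto

lemma partial_op_add:
  "x \<in> carrier X \<Longrightarrow> y \<in> carrier X \<Longrightarrow> partial_op F n (x \<oplus> y) = partial_op F n x \<oplus> partial_op F n y"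
  by (induction n) (simp_all add: partial_op_Suc power_add smult_add_right M.a_ac)

lemma partial_op_smult:
  "x \<in> carrier X \<Longrightarrow> partial_op F n (a \<odot>\<^bsub>X\<^esub> x) = a \<odot>\<^bsub>X\<^esub> partial_op F n x"
  by (induction n) (simp_all add: partial_op_Suc power_smult smult_add_right smult_smult smult_zero mult.commute)

lemma partial_op_fps_add:
  "x \<in> carrier X \<Longrightarrow> partial_op (F + G) n x = partial_op F n x \<oplus> partial_op G n x"
  by (induction n) (simp_all add: partial_op_Suc smult_add_left M.a_ac)

lemma partial_op_fps_const_mult:
  "x \<in> carrier X \<Longrightarrow> partial_op (fps_const b * F) n x = b \<odot>\<^bsub>X\<^esub> partial_op F n x"
  by (induction n) (simp_all add: partial_op_Suc smult_add_right smult_smult smult_zero)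

lemma partial_op_fps_X_mult:
  "x \<in> carrier X \<Longrightarrow> partial_op (fps_X * F) (Suc n) x = T (partial_op F n x)"
proof (induction n)
  case 0
  then show ?case by (simp add: partial_op_Suc smult_0 bounded_op_zero[OF bounded_op_T])
next
  case (Suc n)
  then show ?case
    by (subst partial_op_Suc) (simp_all add: partial_op_Suc[of x F] bounded_op_add[OF bounded_op_T] bounded_op_smult[OF bounded_op_T])
qed

lemma partial_op_diff_le:
  assumes x: "x \<in> carrier X" and "m \<le> n"
  shows "vnorm X (partial_op F n x \<ominus> partial_op F m x) \<le> power_constant * vnorm X x * (\<Sum>k\<in>{m..<n}. cmod (fps_nth F k))"
  using \<open>m \<le> n\<close>
proof (induction n rule: dec_induct)
  case base
  then show ?case using x by (simp add: minus_self)
next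
  case (step n)
  have "partial_op F (Suc n) x \<ominus> partial_op F m x =
      fps_nth F n \<odot>\<^bsub>X\<^esub> (T ^^ n) x \<oplus> (partial_op F n x \<ominus> partial_op F m x)"
    using x by (simp add: partial_op_Suc minus_conv M.a_ac)
  then have "vnorm X (partial_op F (Suc n) x \<ominus> partial_op F m x) \<le>
      cmod (fps_nth F n) * vnorm X ((T ^^ n) x) + vnorm X (partial_op F n x \<ominus> partial_op F m x)"
    using x vnorm_triangle[of "fps_nth F n \<odot>\<^bsub>X\<^esub> (T ^^ n) x" "partial_op F n x \<ominus> partial_op F m x"]
    by (simp add: vnorm_smult)
  also have "\<dots> \<le> cmod (fps_nth F n) * (power_constant * vnorm X x) + power_constant * vnorm X x * (\<Sum>k\<in>{m..<n}. cmod (fps_nth F k))"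
    using x by (intro add_mono mult_left_mono power_le step.IH) auto
  also have "\<dots> = power_constant * vnorm X x * (\<Sum>k\<in>{m..<Suc n}. cmod (fps_nth F k))"
    using step.hyps by (simp add: algebra_simps)
  finally show ?case .
qed

lemma partial_op_norm_le:
  assumes "x \<in> carrier X" "absolutely_summable F"
  shows "vnorm X (partial_op F n x) \<le> power_constant * vnorm X x * coeff_norm F"
proof -
  have "vnorm X (partial_op F n x) \<le> power_constant * vnorm X x * (\<Sum>k\<in>{0..<n}. cmod (fps_nth F k))"
    using partial_op_diff_le[OF assms(1), of 0 n F] assms(1) by (simp add: minus_conv smult_zero)
  also have "\<dots> \<le> power_constant * vnorm X x * coeff_norm F"
    unfolding coeff_norm_def using assms power_constant_nonneg vnorm_nonneg
    by (intro mult_left_mono sum_le_suminf mult_nonneg_nonneg) (auto simp: absolutely_summable_def)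
  finally show ?thesis .
qed

lemma ex_converges:
  assumes x: "x \<in> carrier X" and F: "absolutely_summable F"
  shows "\<exists>y. converges (\<lambda>n. partial_op F n x) y"
proof -
  have "metric.MCauchy (\<lambda>n. partial_op F n x)"
    unfolding metric.MCauchy_def
  proof (intro conjI allI impI)
    show "range (\<lambda>n. partial_op F n x) \<subseteq> carrier X" using x by auto
    fix e :: real assume e: "0 < e"
    have p: "0 < power_constant * vnorm X x + 1" using power_constant_nonneg vnorm_nonneg[OF x] by (intro add_nonneg_pos) auto
    have "0 < e / (power_constant * vnorm X x + 1)" using e p by simp
    then obtain N where N: "\<And>m n. N \<le> m \<Longrightarrow> norm (\<Sum>k\<in>{m..<n}. cmod (fps_nth F k)) < e / (power_constant * vnorm X x + 1)"
      using F unfolding absolutely_summable_def summable_Cauchy by meson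
    have "vdist X (partial_op F n x) (partial_op F m x) < e" if "N \<le> m" "m \<le> n" for m n
    proof -
      have "vdist X (partial_op F n x) (partial_op F m x) \<le> power_constant * vnorm X x * (\<Sum>k\<in>{m..<n}. cmod (fps_nth F k))"
        using partial_op_diff_le[OF x that(2)] x by (simp add: vdist_def)
      also have "\<dots> \<le> (power_constant * vnorm X x + 1) * (\<Sum>k\<in>{m..<n}. cmod (fps_nth F k))"
        by (intro mult_right_mono sum_nonneg) auto
      also have "\<dots> < (power_constant * vnorm X x + 1) * (e / (power_constant * vnorm X x + 1))"
        using N[OF that(1), of n] p by (intro mult_strict_left_mono) (auto simp: sum_nonneg)
      also have "\<dots> = e" using p by simp
      finally show ?thesis .
    qed
    then have "vdist X (partial_op F n x) (partial_op F m x) < e" if "N \<le> m" "N \<le> n" for m n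
      using that metric.commute by (metis linear)
    then show "\<exists>N. \<forall>n n'. N \<le> n \<longrightarrow> N \<le> n' \<longrightarrow> vdist X (partial_op F n x) (partial_op F n' x) < e" by blast
  qed
  then obtain y where "limitin metric.mtopology (\<lambda>n. partial_op F n x) y sequentially"
    using complete unfolding metric.mcomplete_def by blast
  then have y: "y \<in> carrier X" "\<And>e. 0 < e \<Longrightarrow> \<forall>\<^sub>F n in sequentially. vdist X (partial_op F n x) y < e"
    unfolding metric.limitin_metric by (auto elim: eventually_mono)
  have "(\<lambda>n. vnorm X (partial_op F n x \<ominus> y)) \<longlonglongrightarrow> 0"
  proof (rule tendstoI)
    fix e :: real assume "0 < e"
    from y(2)[OF this] show "\<forall>\<^sub>F n in sequentially. dist (vnorm X (partial_op F n x \<ominus> y)) 0 < e"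
      by eventually_elim (use x y vnorm_nonneg in \<open>simp add: vdist_def dist_real_def\<close>)
  qed
  then show ?thesis using x y unfolding converges_def by blast
qed

text \<open>The strong limit of the partial sums. Completeness and absolute summability make it exist, and
  by \<open>series_op_norm_le\<close> the convergence is in operator norm.\<close>

definition series_op :: "complex fps \<Rightarrow> 'a \<Rightarrow> 'a" where
  "series_op F x = (THE y. converges (\<lambda>n. partial_op F n x) y)"

lemma series_op_eqI: "converges (\<lambda>n. partial_op F n x) y \<Longrightarrow> series_op F x = y"
  unfolding series_op_def using converges_unique by (intro the_equality)

lemma series_op_converges:
  "x \<in> carrier X \<Longrightarrow> absolutely_summable F \<Longrightarrow> converges (\<lambda>n. partial_op F n x) (series_op F x)"
  using ex_converges series_op_eqI by metis

lemma series_op_closed [intro]: "x \<in> carrier X \<Longrightarrow> absolutely_summable F \<Longrightarrow> series_op F x \<in> carrier X"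
  using series_op_converges by (auto simp: converges_def)

lemma series_op_norm_le:
  assumes "x \<in> carrier X" "absolutely_summable F"
  shows "vnorm X (series_op F x) \<le> power_constant * coeff_norm F * vnorm X x"
  using converges_norm_le[OF series_op_converges partial_op_norm_le] assms by (simp add: mult_ac)

lemma converges_smult:
  assumes "converges s y"
  shows "converges (\<lambda>n. a \<odot>\<^bsub>X\<^esub> s n) (a \<odot>\<^bsub>X\<^esub> y)"
proof (rule converges_bounded_op[OF _ assms])
  show "bounded_op X (\<lambda>x. a \<odot>\<^bsub>X\<^esub> x)"
    unfolding bounded_op_def
    by (auto simp: smult_add_right smult_smult mult.commute vnorm_smult)
qed

lemma bounded_op_series_op:
  assumes F: "absolutely_summable F"
  shows "bounded_op X (series_op F)"
proof -
  have "series_op F (x \<oplus> y) = series_op F x \<oplus> series_op F y" if "x \<in> carrier X" "y \<in> carrier X" for x y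
    using converges_add[OF series_op_converges[OF that(1) F] series_op_converges[OF that(2) F]] that
    by (intro series_op_eqI) (simp add: partial_op_add)
  moreover have "series_op F (a \<odot>\<^bsub>X\<^esub> x) = a \<odot>\<^bsub>X\<^esub> series_op F x" if "x \<in> carrier X" for a x
    using converges_smult[OF series_op_converges[OF that F], of a] that
    by (intro series_op_eqI) (simp add: partial_op_smult)
  ultimately show ?thesis
    unfolding bounded_op_def using series_op_closed[OF _ F] series_op_norm_le[OF _ F] by blast
qed

lemma series_op_add:
  assumes "x \<in> carrier X" "absolutely_summable F" "absolutely_summable G"
  shows "series_op (F + G) x = series_op F x \<oplus> series_op G x"
  using converges_add[OF series_op_converges series_op_converges] assms
  by (intro series_op_eqI) (simp add: partial_op_fps_add)

lemma series_op_const_mult: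
  assumes "x \<in> carrier X" "absolutely_summable F"
  shows "series_op (fps_const b * F) x = b \<odot>\<^bsub>X\<^esub> series_op F x"
  using converges_smult[OF series_op_converges] assms
  by (intro series_op_eqI) (simp add: partial_op_fps_const_mult)

lemma series_op_diff:
  assumes x: "x \<in> carrier X" and F: "absolutely_summable F" and G: "absolutely_summable G"
  shows "series_op (F - G) x = series_op F x \<ominus> series_op G x"
proof -
  have "F - G = F + fps_const (-1) * G" by (simp add: fps_eq_iff)
  then show ?thesis
    using x F G series_op_closed
    by (simp only: series_op_add series_op_const_mult absolutely_summable_const_mult minus_conv)
qed

lemma series_op_X_mult:
  assumes "x \<in> carrier X" "absolutely_summable F"
  shows "series_op (fps_X * F) x = T (series_op F x)"
proof (rule series_op_eqI, rule converges_Suc_imp)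
  show "converges (\<lambda>n. partial_op (fps_X * F) (Suc n) x) (T (series_op F x))"
    unfolding partial_op_fps_X_mult[OF assms(1)]
    by (rule converges_bounded_op[OF bounded_op_T series_op_converges[OF assms]])
qed (use assms in auto)

lemma absolutely_summable_1: "absolutely_summable 1"
  by (rule absolutely_summable_finite[of 1]) simp

lemma absolutely_summable_X_power: "absolutely_summable (fps_X ^ n)"
  by (rule absolutely_summable_finite[of "Suc n"]) (simp add: fps_X_power_nth)

lemma series_op_X_power_mult:
  assumes "x \<in> carrier X" "absolutely_summable F"
  shows "series_op (fps_X ^ n * F) x = (T ^^ n) (series_op F x)"
proof (induction n)
  case (Suc n)
  then show ?case
    using assms series_op_X_mult[of x "fps_X ^ n * F"] coeff_norm_mult(1)[OF absolutely_summable_X_power]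
    by (simp add: mult.assoc)
qed simp

lemma series_op_1: "x \<in> carrier X \<Longrightarrow> series_op 1 x = x"
proof (rule series_op_eqI, rule converges_Suc_imp)
  assume x: "x \<in> carrier X"
  have "partial_op 1 (Suc n) x = x" for n
    using x by (induction n) (simp_all add: partial_op_Suc smult_1 smult_0)
  then show "converges (\<lambda>n. partial_op 1 (Suc n) x) x" using converges_const[OF x] by simp
qed auto

text \<open>The multiplicativity of the calculus for polynomials, by induction on the degree.\<close>

lemma series_op_cutoff_mult:
  assumes x: "x \<in> carrier X" and G: "absolutely_summable G"
  shows "series_op (fps_cutoff n F * G) x = partial_op F n (series_op G x)"
proof (induction n)
  case 0
  have "series_op (fps_const 0 * G) x = \<zero>"
    using series_op_const_mult[OF x G, of 0] series_op_closed[OF x G] by (simp only: smult_0)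
  then show ?case by (simp add: fps_cutoff_zero)
next
  case (Suc n)
  have e: "fps_cutoff (Suc n) F * G = fps_const (fps_nth F n) * (fps_X ^ n * G) + fps_cutoff n F * G"
  proof -
    have "fps_cutoff (Suc n) F = fps_const (fps_nth F n) * fps_X ^ n + fps_cutoff n F"
      by (auto simp: fps_eq_iff fps_X_power_nth less_Suc_eq)
    then show ?thesis by (simp only: distrib_right mult.assoc)
  qed
  have a: "absolutely_summable (fps_X ^ n * G)" "absolutely_summable (fps_cutoff n F * G)"
    using coeff_norm_mult(1)[OF absolutely_summable_X_power G]
      coeff_norm_mult(1)[OF absolutely_summable_finite[of n "fps_cutoff n F"] G] by auto
  show ?case
    unfolding e
    using x G a Suc series_op_closed
    by (simp add: series_op_add series_op_const_mult absolutely_summable_const_mult series_op_X_power_mult partial_op_Suc)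
qed

lemma series_op_cutoff: "x \<in> carrier X \<Longrightarrow> series_op (fps_cutoff n F) x = partial_op F n x"
  using series_op_cutoff_mult[OF _ absolutely_summable_1, of x n F] by (simp add: series_op_1)

text \<open>Approximating the first factor by polynomials, the error is controlled by
  \<open>coeff_norm_mult\<close>.\<close>

lemma series_op_mult:
  assumes x: "x \<in> carrier X" and F: "absolutely_summable F" and G: "absolutely_summable G"
  shows "series_op (F * G) x = series_op F (series_op G x)"
proof -
  note FG = coeff_norm_mult(1)[OF F G]
  have y: "series_op G x \<in> carrier X" using series_op_closed[OF x G] .
  have "converges (\<lambda>n. partial_op F n (series_op G x)) (series_op (F * G) x)"
  proof (rule converges_squeeze)
    fix n
    let ?R = "F - fps_cutoff n F"
    have cut: "absolutely_summable (fps_cutoff n F)" by (rule absolutely_summable_finite[of n]) simp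
    have R: "absolutely_summable ?R" by (rule coeff_norm_tail(1)[OF F])
    have "partial_op F n (series_op G x) \<ominus> series_op (F * G) x = series_op (fps_cutoff n F * G - F * G) x"
      using series_op_diff[OF x coeff_norm_mult(1)[OF cut G] FG] series_op_cutoff_mult[OF x G] by simp
    also have "fps_cutoff n F * G - F * G = fps_const (-1) * (?R * G)"
      by (simp add: algebra_simps fps_const_neg[symmetric] del: fps_const_neg)
    also have "series_op (fps_const (-1) * (?R * G)) x = (-1) \<odot>\<^bsub>X\<^esub> series_op (?R * G) x"
      by (rule series_op_const_mult[OF x coeff_norm_mult(1)[OF R G]])
    also have "vnorm X \<dots> = vnorm X (series_op (?R * G) x)"
      using series_op_closed[OF x coeff_norm_mult(1)[OF R G]] by (simp add: vnorm_smult)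
    also have "\<dots> \<le> power_constant * coeff_norm (?R * G) * vnorm X x"
      by (rule series_op_norm_le[OF x coeff_norm_mult(1)[OF R G]])
    also have "\<dots> \<le> power_constant * (coeff_norm ?R * coeff_norm G) * vnorm X x"
      using power_constant_nonneg vnorm_nonneg[OF x] coeff_norm_mult(2)[OF R G]
      by (intro mult_right_mono mult_left_mono) auto
    finally show "vnorm X (partial_op F n (series_op G x) \<ominus> series_op (F * G) x)
        \<le> power_constant * (coeff_norm ?R * coeff_norm G) * vnorm X x" .
  next
    have "(\<lambda>n. power_constant * (coeff_norm (F - fps_cutoff n F) * coeff_norm G) * vnorm X x)
        \<longlonglongrightarrow> power_constant * (0 * coeff_norm G) * vnorm X x"
      by (intro tendsto_intros coeff_norm_tail(2)[OF F])
    then show "(\<lambda>n. power_constant * (coeff_norm (F - fps_cutoff n F) * coeff_norm G) * vnorm X x) \<longlonglongrightarrow> 0" by simp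
  qed (use y x series_op_closed[OF x FG] in auto)
  then show ?thesis using converges_unique series_op_converges[OF y F] by blast
qed

text \<open>The operator-norm limit that defines \<open>op_series\<close> is the strong limit: the remainder is the
  operator of a tail of the series, and operator-norm limits are unique as extensional functions.\<close>

lemma op_series_eq:
  assumes c: "summable (\<lambda>n. \<bar>c n\<bar>)"
  shows "op_series X c T = restrict (series_op (Abs_fps (\<lambda>n. of_real (c n)))) (carrier X)"
proof -
  define F where "F = Abs_fps (\<lambda>n. complex_of_real (c n))"
  have F: "absolutely_summable F" using c by (simp add: absolutely_summable_def F_def)
  have part: "(\<Oplus>\<^bsub>X\<^esub>k\<in>{..<n}. complex_of_real (c k) \<odot>\<^bsub>X\<^esub> (T ^^ k) x) = partial_op F n x" for n x
    by (simp add: partial_op_def F_def)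
  have bp: "bounded_op X (partial_op F n)" for n
  proof -
    have "absolutely_summable (fps_cutoff n F)" by (rule absolutely_summable_finite[of n]) simp
    then show ?thesis
      using bounded_op_series_op bounded_op_cong[of "partial_op F n" "series_op (fps_cutoff n F)"] series_op_cutoff by simp
  qed
  show ?thesis
    unfolding op_series_def part F_def[symmetric]
  proof (rule the_equality, intro conjI)
    show b: "bounded_op X (restrict (series_op F) (carrier X))"
      using bounded_op_series_op[OF F] bounded_op_cong[of "restrict (series_op F) (carrier X)" "series_op F"] by simp
    show "restrict (series_op F) (carrier X) \<in> extensional (carrier X)" by simp
    show "(\<lambda>n. op_norm X (\<lambda>x. partial_op F n x \<ominus> restrict (series_op F) (carrier X) x)) \<longlonglongrightarrow> 0"
    proof (rule tendsto_sandwich[OF _ _ tendsto_const])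
      show "\<forall>\<^sub>F n in sequentially. 0 \<le> op_norm X (\<lambda>x. partial_op F n x \<ominus> restrict (series_op F) (carrier X) x)"
        by (intro always_eventually allI op_norm_nonneg bounded_op_diff bp b)
      have "op_norm X (\<lambda>x. partial_op F n x \<ominus> restrict (series_op F) (carrier X) x)
          \<le> power_constant * coeff_norm (F - fps_cutoff n F)" for n
      proof (rule op_norm_le)
        note R = coeff_norm_tail(1)[OF F, of n]
        show "0 \<le> power_constant * coeff_norm (F - fps_cutoff n F)"
          using power_constant_nonneg coeff_norm_nonneg[OF R] by simp
        fix x assume x: "x \<in> carrier X"
        have cut: "absolutely_summable (fps_cutoff n F)" by (rule absolutely_summable_finite[of n]) simp
        have "partial_op F n x \<ominus> restrict (series_op F) (carrier X) x = series_op (fps_cutoff n F - F) x"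
          using x by (simp add: series_op_diff[OF x cut F] series_op_cutoff)
        also have "fps_cutoff n F - F = fps_const (-1) * (F - fps_cutoff n F)"
          by (simp add: fps_eq_iff)
        finally have "vnorm X (partial_op F n x \<ominus> restrict (series_op F) (carrier X) x) = vnorm X (series_op (F - fps_cutoff n F) x)"
          using series_op_closed[OF x R] by (simp only: series_op_const_mult[OF x R] vnorm_smult) simp
        then show "vnorm X (partial_op F n x \<ominus> restrict (series_op F) (carrier X) x)
            \<le> power_constant * coeff_norm (F - fps_cutoff n F) * vnorm X x"
          using series_op_norm_le[OF x R] by simp
      qed
      then show "\<forall>\<^sub>F n in sequentially. op_norm X (\<lambda>x. partial_op F n x \<ominus> restrict (series_op F) (carrier X) x)
          \<le> power_constant * coeff_norm (F - fps_cutoff n F)"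
        by (intro always_eventually allI)
      show "(\<lambda>n. power_constant * coeff_norm (F - fps_cutoff n F)) \<longlonglongrightarrow> 0"
        by (intro tendsto_mult_right_zero coeff_norm_tail(2)[OF F])
    qed
  next
    fix S assume S: "bounded_op X S \<and> S \<in> extensional (carrier X) \<and>
      (\<lambda>n. op_norm X (\<lambda>x. partial_op F n x \<ominus> S x)) \<longlonglongrightarrow> 0"
    have "S x = series_op F x" if x: "x \<in> carrier X" for x
    proof (rule series_op_eqI[symmetric], rule converges_squeeze)
      show "S x \<in> carrier X" using S x bounded_op_closed by blast
      show "vnorm X (partial_op F n x \<ominus> S x) \<le> op_norm X (\<lambda>x. partial_op F n x \<ominus> S x) * vnorm X x" for n
        using norm_le_op_norm[OF bounded_op_diff[OF bp] x] S by blast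
      show "(\<lambda>n. op_norm X (\<lambda>x. partial_op F n x \<ominus> S x) * vnorm X x) \<longlonglongrightarrow> 0"
        using S by (intro tendsto_mult_left_zero) auto
    qed (use x in auto)
    then show "S = restrict (series_op F) (carrier X)"
      using S by (intro extensionalityI[of S "carrier X"]) auto
  qed
qed

text \<open>Multiplicativity of the calculus turns the convolution inverse \<open>F\<close> of \<open>z - c\<close> into a two-sided inverse
  of \<open>z - h(T)\<close>.\<close>

lemma resolvent_op_series:
  assumes c: "summable (\<lambda>n. \<bar>c n\<bar>)" and F: "absolutely_summable F"
    and inv: "(fps_const z - Abs_fps (\<lambda>n. of_real (c n))) * F = 1"
  shows "z \<notin> spectrum X (op_series X c T)"
    and "op_norm X (resolvent X (op_series X c T) z) \<le> power_constant * coeff_norm F"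
proof -
  define H where "H = Abs_fps (\<lambda>n. complex_of_real (c n))"
  have H: "absolutely_summable H" using c by (simp add: absolutely_summable_def H_def)
  have C: "absolutely_summable (fps_const z * 1)"
    by (rule absolutely_summable_const_mult[OF absolutely_summable_1])
  then have zH: "absolutely_summable (fps_const z - H)"
    using absolutely_summable_add[OF C absolutely_summable_uminus[OF H]] by simp
  define f where "f x = z \<odot>\<^bsub>X\<^esub> x \<ominus> op_series X c T x" for x
  have f: "f x = series_op (fps_const z - H) x" if x: "x \<in> carrier X" for x
    using series_op_diff[OF x C H] series_op_const_mult[OF x absolutely_summable_1, of z] x
    by (simp add: f_def op_series_eq[OF c] H_def series_op_1)
  have closed: "f x \<in> carrier X" "series_op F x \<in> carrier X" if "x \<in> carrier X" for x
    using that series_op_closed[OF that zH] series_op_closed[OF that F] by (auto simp: f)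
  have fg: "f (series_op F x) = x" if x: "x \<in> carrier X" for x
    using series_op_mult[OF x zH F] inv x closed by (simp add: f H_def series_op_1)
  have gf: "series_op F (f x) = x" if x: "x \<in> carrier X" for x
    using series_op_mult[OF x F zH] inv x closed by (simp add: f H_def series_op_1 mult.commute)
  have bij: "bij_betw f (carrier X) (carrier X)"
    by (rule bij_betw_byWitness[where f'="series_op F"]) (use fg gf closed in auto)
  have res: "resolvent X (op_series X c T) z y = series_op F y" if y: "y \<in> carrier X" for y
    unfolding resolvent_def f_def[symmetric]
    using bij fg[OF y] closed(2)[OF y] by (intro inv_into_f_eq) (auto simp: bij_betw_def)
  have "bounded_op X (resolvent X (op_series X c T) z)"
    using bounded_op_cong[of _ "series_op F"] res bounded_op_series_op[OF F] by blast
  then show "z \<notin> spectrum X (op_series X c T)"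
    using bij by (simp add: spectrum_def f_def[abs_def])
  have "op_norm X (resolvent X (op_series X c T) z) = op_norm X (series_op F)"
    by (rule op_norm_cong) (rule res)
  also have "\<dots> \<le> power_constant * coeff_norm F"
    using series_op_norm_le[OF _ F] power_constant_nonneg coeff_norm_nonneg[OF F] by (intro op_norm_le) auto
  finally show "op_norm X (resolvent X (op_series X c T) z) \<le> power_constant * coeff_norm F" .
qed

end

section \<open>The Ritt property\<close>

lemma regular_hausdorff_imp_representation:
  assumes "regular_hausdorff h c"
  obtains \<nu> where "hausdorff_representation h c \<nu>"
proof -
  obtain \<nu> :: "real measure" where \<nu>: "finite_measure \<nu>" "sets \<nu> = sets (restrict_space borel {0..<1})"
      "\<And>n. n \<ge> 1 \<Longrightarrow> c n = (\<integral>t. t ^ (n - 1) \<partial>\<nu>)"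
      "ennreal (c 0) + (\<integral>\<^sup>+ t. ennreal (1 / (1 - t)) \<partial>\<nu>) = 1"
    using assms unfolding regular_hausdorff_def by blast
  show ?thesis
  proof (rule that, rule hausdorff_representation.intro)
    show "c (Suc n) = (\<integral>t. t ^ n \<partial>\<nu>)" for n using \<nu>(3)[of "Suc n"] by simp
  qed (use assms \<nu> in \<open>auto simp: regular_hausdorff_def\<close>)
qed

context hausdorff_representation
begin

lemma coeff_1_nonzero:
  assumes "\<not> h constant_on ball 0 1"
  shows "c 1 \<noteq> 0"
proof
  assume c1: "c 1 = 0"
  have z: "c (Suc n) = 0" for n
    using coeff_Suc_antimono[of 0 n] coeff_nonneg[of "Suc n"] c1 by simp
  have "h w = of_real (c 0)" if "w \<in> ball 0 1" for w
  proof -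
    have "(\<lambda>n. of_real (c n) * w ^ n) sums (\<Sum>n\<in>{0}. of_real (c n) * w ^ n)"
    proof (rule sums_finite)
      show "of_real (c n) * w ^ n = 0" if "n \<notin> {0}" for n
        using that z[of "n - 1"] by simp
    qed simp
    then show ?thesis using h_sums[OF that] sums_unique2 by fastforce
  qed
  then show False using assms by (auto simp: constant_on_def)
qed

text \<open>The two lower bounds for \<open>\<bar>z - h\<bar>\<close> are inserted into the resolvent estimate: \<open>far_outside_disc\<close> with \<open>a = 1\<close>
  locates the spectrum, and \<open>sectors_separated\<close> with \<open>a = \<bar>1 - z\<bar>\<close> gives the bound \<open>C / \<bar>z - 1\<bar>\<close>.\<close>

lemma ritt_operator_op_series:
  assumes X: "complex_banach_space X" and T: "power_bounded X T"
    and nonconst: "\<not> h constant_on ball 0 1" and \<gamma>: "0 < \<gamma>" "\<gamma> < pi / 2"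
    and sect: "\<And>w. w \<in> ball 0 1 \<Longrightarrow> 1 - h w \<in> closure (sector \<gamma>)"
  shows "ritt_operator X (op_series X c T) \<gamma>"
proof -
  interpret power_bounded_operator X T
    using X T by (simp add: power_bounded_operator_def power_bounded_operator_axioms_def)
  note c1 = coeff_1_nonzero[OF nonconst]
  have abs_c: "summable (\<lambda>n. \<bar>c n\<bar>)"
    using sums_summable[OF coeff_sums] coeff_nonneg by simp
  have resolvent: "z \<notin> spectrum X (op_series X c T)"
      "op_norm X (resolvent X (op_series X c T) z) \<le> power_constant * (1 / (\<kappa> * a) + 64 / (\<kappa>\<^sup>2 * a))"
    if \<kappa>: "0 < \<kappa>" and a: "0 < a"
      and far: "\<And>w. w \<in> ball 0 1 \<Longrightarrow> \<kappa> * (a + cmod (1 - h w)) \<le> cmod (z - h w)" for z \<kappa> a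
  proof -
    define F where "F = fps_expansion (\<lambda>w. 1 / (z - h w)) 0"
    have F: "absolutely_summable F" and bound: "coeff_norm F \<le> 1 / (\<kappa> * a) + 64 / (\<kappa>\<^sup>2 * a)"
      using inverse_coefficients_bound[OF c1 \<kappa> a far]
      by (auto simp: F_def absolutely_summable_def coeff_norm_def)
    have "z \<noteq> h w" if "w \<in> ball 0 1" for w
    proof -
      have "0 < \<kappa> * (a + cmod (1 - h w))" by (intro mult_pos_pos add_pos_nonneg \<kappa> a norm_ge_zero)
      then show ?thesis using far[OF that] by auto
    qed
    then have inv: "(fps_const z - Abs_fps (\<lambda>n. of_real (c n))) * F = 1"
      unfolding F_def by (rule inverse_coefficients)
    show "z \<notin> spectrum X (op_series X c T)" by (rule resolvent_op_series(1)[OF abs_c F inv])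
    show "op_norm X (resolvent X (op_series X c T) z) \<le> power_constant * (1 / (\<kappa> * a) + 64 / (\<kappa>\<^sup>2 * a))"
      using resolvent_op_series(2)[OF abs_c F inv] mult_left_mono[OF bound power_constant_nonneg] by linarith
  qed
  show ?thesis
    unfolding ritt_operator_def
  proof (intro conjI allI impI)
    have "absolutely_summable (Abs_fps (\<lambda>n. complex_of_real (c n)))"
      using abs_c by (simp add: absolutely_summable_def)
    then show "bounded_op X (op_series X c T)"
      unfolding op_series_eq[OF abs_c]
      using bounded_op_series_op bounded_op_cong[of "restrict _ (carrier X)"] by (metis restrict_apply')
    show "spectrum X (op_series X c T) \<subseteq> ball 0 1 \<union> {1}"
    proof (rule subsetI, rule ccontr)
      fix z assume spec: "z \<in> spectrum X (op_series X c T)" and "z \<notin> ball 0 1 \<union> {1}"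
      then have z: "1 \<le> cmod z" "z \<noteq> 1" by auto
      obtain \<kappa> where "0 < \<kappa>" "\<And>w. w \<in> ball 0 1 \<Longrightarrow> \<kappa> * (1 + cmod (1 - h w)) \<le> cmod (z - h w)"
        using far_outside_disc[OF c1 sector_imp_not_identity[OF \<gamma> sect] z] by blast
      from resolvent(1)[OF this(1) zero_less_one this(2)] spec show False by simp
    qed
    fix \<omega> assume "\<gamma> < \<omega> \<and> \<omega> < pi"
    then have \<omega>: "\<gamma> < \<omega>" "\<omega> < pi" by auto
    define \<kappa> where "\<kappa> = sqrt ((1 - cos (\<omega> - \<gamma>)) / 2)"
    have "cos (\<omega> - \<gamma>) < cos 0" using \<omega> \<gamma> by (intro cos_monotone_0_pi) auto
    then have \<kappa>: "0 < \<kappa>" by (simp add: \<kappa>_def)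
    define C where "C = max 1 (power_constant * (1 / \<kappa> + 64 / \<kappa>\<^sup>2))"
    show "\<exists>C\<ge>1. \<forall>z. z \<notin> (\<lambda>w. 1 - w) ` closure (sector \<omega>) \<longrightarrow>
        z \<notin> spectrum X (op_series X c T) \<and> op_norm X (resolvent X (op_series X c T) z) \<le> C / cmod (z - 1)"
    proof (intro exI[of _ C] conjI allI impI)
      show "1 \<le> C" by (simp add: C_def)
      fix z assume "z \<notin> (\<lambda>w. 1 - w) ` closure (sector \<omega>)"
      then have w: "1 - z \<notin> closure (sector \<omega>)" by (auto simp: image_iff dest: bspec[of _ _ "1 - z"])
      define a where "a = cmod (1 - z)"
      have "0 \<in> closure (sector \<omega>)" using \<omega> \<gamma> by (simp add: closure_sector_iff_cos)
      with w have "1 - z \<noteq> 0" by metis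
      then have a: "0 < a" by (simp add: a_def)
      have far: "\<kappa> * (a + cmod (1 - h u)) \<le> cmod (z - h u)" if "u \<in> ball 0 1" for u
        using sectors_separated[OF \<gamma>(1) \<omega> sect[OF that] w] by (simp add: \<kappa>_def a_def add.commute)
      show "z \<notin> spectrum X (op_series X c T)" by (rule resolvent(1)[OF \<kappa> a far])
      have "power_constant * (1 / (\<kappa> * a) + 64 / (\<kappa>\<^sup>2 * a)) = power_constant * (1 / \<kappa> + 64 / \<kappa>\<^sup>2) / a"
        using a \<kappa> by (simp add: field_simps)
      also have "\<dots> \<le> C / a" using a by (intro divide_right_mono) (auto simp: C_def)
      finally show "op_norm X (resolvent X (op_series X c T) z) \<le> C / cmod (z - 1)"
        using resolvent(2)[OF \<kappa> a far] by (simp add: a_def norm_minus_commute)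
    qed
  qed (use \<gamma> in auto)
qed

end

text \<open>The Banach space \<open>\<complex>\<close>, carried by the right summand of the type.\<close>

definition complex_plane :: "('u + complex) normed_module" where
  "complex_plane = \<lparr>carrier = range Inr, mult = (\<lambda>x y. Inr (projr x * projr y)), one = Inr 1, zero = Inr 0,
     add = (\<lambda>x y. Inr (projr x + projr y)), smult = (\<lambda>a x. Inr (a * projr x)),
     vnorm = (\<lambda>x. cmod (projr x))\<rparr>"

lemma complex_plane_simps [simp]:
  "carrier complex_plane = range Inr"
  "\<zero>\<^bsub>complex_plane\<^esub> = Inr 0"
  "x \<oplus>\<^bsub>complex_plane\<^esub> y = Inr (projr x + projr y)"
  "a \<odot>\<^bsub>complex_plane\<^esub> x = Inr (a * projr x)"
  "vnorm complex_plane x = cmod (projr x)"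
  by (simp_all add: complex_plane_def)

lemma complex_plane_normed: "complex_normed_space (complex_plane :: ('u + complex) normed_module)"
proof -
  have "cring complex_ring"
    by (rule cringI, rule abelian_groupI, simp_all add: complex_ring_def algebra_simps)
       (auto intro!: comm_monoidI exI[of _ "- _"] simp: complex_ring_def)
  moreover have "abelian_group (complex_plane :: ('u + complex) normed_module)"
    by (rule abelian_groupI) (auto simp: algebra_simps intro: exI[of _ "- _"])
  ultimately have "module complex_ring (complex_plane :: ('u + complex) normed_module)"
    by (intro moduleI) (auto simp: complex_ring_def algebra_simps)
  then show ?thesis
    by (rule complex_normed_space.intro)
       (unfold_locales, auto simp: norm_mult norm_triangle_ineq)
qed

lemma complex_plane_minus:
  "Inr x \<ominus>\<^bsub>complex_plane\<^esub> Inr y = (Inr (x - y) :: 'u + complex)"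
proof -
  interpret complex_normed_space "complex_plane :: ('u + complex) normed_module"
    by (rule complex_plane_normed)
  show ?thesis by (subst minus_conv) auto
qed

lemma complex_plane_banach: "complex_banach_space (complex_plane :: ('u + complex) normed_module)"
proof -
  interpret complex_normed_space "complex_plane :: ('u + complex) normed_module"
    by (rule complex_plane_normed)
  have d: "vdist complex_plane (Inr x :: 'u + complex) (Inr y) = dist x y" for x y
    by (simp add: vdist_def complex_plane_minus dist_norm)
  have "metric.mcomplete"
    unfolding metric.mcomplete_def
  proof (intro allI impI)
    fix \<sigma> :: "nat \<Rightarrow> 'u + complex" assume \<sigma>: "metric.MCauchy \<sigma>"
    then have r: "\<sigma> n = Inr (projr (\<sigma> n))" for n
      unfolding metric.MCauchy_def by (auto simp: image_subset_iff) (metis sum.collapse(2) sum.disc(2) rangeI image_iff)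
    have "Cauchy (\<lambda>n. projr (\<sigma> n))"
      using \<sigma> unfolding metric.MCauchy_def Cauchy_def by (subst (asm) r, subst (asm) (2) r) (simp add: d)
    then obtain l where l: "(\<lambda>n. projr (\<sigma> n)) \<longlonglongrightarrow> l"
      using Cauchy_convergent_iff convergent_def by blast
    have "limitin metric.mtopology \<sigma> (Inr l) sequentially"
      unfolding metric.limitin_metric
    proof (intro conjI allI impI)
      fix e :: real assume "0 < e"
      with l have "\<forall>\<^sub>F n in sequentially. dist (projr (\<sigma> n)) l < e" by (rule tendstoD)
      then show "\<forall>\<^sub>F n in sequentially. \<sigma> n \<in> carrier complex_plane \<and> vdist complex_plane (\<sigma> n) (Inr l) < e"
        by eventually_elim (subst (1 2) r, simp add: d)
    qed simp
    then show "\<exists>x. limitin metric.mtopology \<sigma> x sequentially" by blast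
  qed
  then show ?thesis by (intro complex_banach_space.intro complex_normed_space_axioms complex_banach_space_axioms.intro)
qed

text \<open>Multiplication by \<open>w\<close> on \<open>\<complex>\<close> is a contraction \<open>T\<close> and \<open>h(T)\<close> is multiplication by \<open>y = h w\<close>, so that
  \<open>y\<close> is an eigenvalue. If the argument of \<open>1 - y\<close> exceeded \<open>\<gamma>\<close>, then \<open>y\<close> would lie in the
  resolvent set by the Ritt condition for an angle between the two.\<close>

lemma ritt_multiplication_imp_sector:
  fixes X :: "('u + complex) normed_module"
  assumes c: "summable (\<lambda>n. \<bar>c n\<bar>)" and h: "(\<lambda>n. of_real (c n) * w ^ n) sums y" and w: "cmod w < 1"
    and X: "X = complex_plane"
    and ritt: "power_bounded X (\<lambda>x. Inr (w * projr x)) \<Longrightarrow> ritt_operator X (op_series X c (\<lambda>x. Inr (w * projr x))) \<gamma>"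
    and \<gamma>: "0 < \<gamma>" "\<gamma> < pi / 2"
  shows "1 - y \<in> closure (sector \<gamma>)"
proof (rule ccontr)
  define T :: "'u + complex \<Rightarrow> 'u + complex" where "T = (\<lambda>x. Inr (w * projr x))"
  interpret complex_banach_space X unfolding X by (rule complex_plane_banach)
  have pow: "(T ^^ n) (Inr x) = Inr (w ^ n * x)" for n x
    by (induction n) (simp_all add: T_def mult.assoc)
  have bT: "bounded_op X T"
    unfolding bounded_op_def X by (auto simp: T_def algebra_simps norm_mult intro!: exI[of _ "cmod w"])
  have "op_norm X (T ^^ n) \<le> 1" for n
  proof (rule op_norm_le)
    fix x assume "x \<in> carrier X"
    then obtain u where u: "x = Inr u" by (auto simp: X)
    have "cmod (w ^ n) * cmod u \<le> 1 * cmod u" using w by (intro mult_right_mono) (auto simp: norm_power power_le_one)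
    then show "vnorm X ((T ^^ n) x) \<le> 1 * vnorm X x" by (simp add: u pow X norm_mult)
  qed simp
  then have pb: "power_bounded X T" using bT by (auto simp: power_bounded_def bdd_above_def)
  interpret power_bounded_operator X T by unfold_locales (rule pb)
  define S where "S = op_series X c T"
  have ritt: "ritt_operator X S \<gamma>" using ritt pb by (simp add: S_def T_def)
  define F where "F = Abs_fps (\<lambda>n. complex_of_real (c n))"
  have F: "absolutely_summable F" using c by (simp add: absolutely_summable_def F_def)
  have part: "partial_op F n (Inr x) = Inr ((\<Sum>k<n. of_real (c k) * w ^ k) * x)" for n x
  proof (induction n)
    case 0
    show ?case unfolding partial_op_0 by (simp add: X)
  next
    case (Suc n)
    have "Inr x \<in> carrier X" by (simp add: X)
    from partial_op_Suc[OF this, of F n] show ?case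
      unfolding Suc pow by (simp add: X F_def algebra_simps)
  qed
  have S: "S (Inr x) = Inr (y * x)" for x
  proof -
    have "converges (\<lambda>n. partial_op F n (Inr x)) (Inr (y * x))"
      unfolding converges_def part
    proof (intro conjI allI)
      have "(\<lambda>n. cmod ((\<Sum>k<n. of_real (c k) * w ^ k) * x - y * x)) \<longlonglongrightarrow> cmod (y * x - y * x)"
        using h unfolding sums_def by (intro tendsto_intros)
      then show "(\<lambda>n. vnorm X (Inr ((\<Sum>k<n. of_real (c k) * w ^ k) * x) \<ominus>\<^bsub>X\<^esub> Inr (y * x))) \<longlonglongrightarrow> 0"
        by (simp add: X complex_plane_minus)
    qed (auto simp: X)
    then have "series_op F (Inr x) = Inr (y * x)" by (rule series_op_eqI)
    moreover have "Inr x \<in> carrier X" by (simp add: X)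
    ultimately show ?thesis by (simp add: S_def op_series_eq[OF c] F_def)
  qed
  have "y \<odot>\<^bsub>X\<^esub> Inr x \<ominus>\<^bsub>X\<^esub> S (Inr x) = Inr 0" for x by (simp add: S X complex_plane_minus)
  then have "\<not> inj_on (\<lambda>x. y \<odot>\<^bsub>X\<^esub> x \<ominus>\<^bsub>X\<^esub> S x) (carrier X)"
    unfolding inj_on_def X by (metis Inr_inject complex_plane_simps(1) rangeI zero_neq_one)
  then have spec: "y \<in> spectrum X S" by (auto simp: spectrum_def bij_betw_def)
  assume out: "1 - y \<notin> closure (sector \<gamma>)"
  define \<omega> where "\<omega> = (\<gamma> + \<bar>Arg (1 - y)\<bar>) / 2"
  have A: "1 - y \<noteq> 0" "\<gamma> < \<bar>Arg (1 - y)\<bar>" using out \<gamma> closure_sector_iff_Arg[of \<gamma> "1 - y"] by auto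
  then have \<omega>: "\<gamma> < \<omega>" "\<omega> < pi" "\<omega> < \<bar>Arg (1 - y)\<bar>"
    using abs_Arg_le_pi[of "1 - y"] \<gamma> by (auto simp: \<omega>_def)
  then have "1 - y \<notin> closure (sector \<omega>)" using A \<gamma> closure_sector_iff_Arg[of \<omega> "1 - y"] by auto
  then have "y \<notin> (\<lambda>w. 1 - w) ` closure (sector \<omega>)" by force
  then have "y \<notin> spectrum X S" using ritt \<omega> unfolding ritt_operator_def by blast
  with spec show False by simp
qed

theorem theorem1p3:
  fixes h :: "complex \<Rightarrow> complex" and c :: "nat \<Rightarrow> real" and \<gamma> :: real
  assumes "regular_hausdorff h c"
    and "\<not> h constant_on ball 0 1"
    and "0 < \<gamma>" and "\<gamma> < pi / 2"
  shows "(\<forall>z\<in>ball 0 1. 1 - h z \<in> closure (sector \<gamma>)) \<longleftrightarrow>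
    (\<forall>X :: ('u + complex) normed_module. complex_banach_space X \<longrightarrow>
       (\<forall>T. power_bounded X T \<longrightarrow> ritt_operator X (op_series X c T) \<gamma>))"
proof -
  obtain \<nu> where "hausdorff_representation h c \<nu>"
    using regular_hausdorff_imp_representation[OF assms(1)] .
  then interpret hausdorff_representation h c \<nu> .
  show ?thesis
  proof (intro iffI allI impI ballI)
    fix X :: "('u + complex) normed_module" and T
    assume "\<forall>z\<in>ball 0 1. 1 - h z \<in> closure (sector \<gamma>)" "complex_banach_space X" "power_bounded X T"
    then show "ritt_operator X (op_series X c T) \<gamma>"
      using ritt_operator_op_series assms(2-4) by blast
  next
    fix z :: complex
    assume ritt: "\<forall>X :: ('u + complex) normed_module. complex_banach_space X \<longrightarrow>
       (\<forall>T. power_bounded X T \<longrightarrow> ritt_operator X (op_series X c T) \<gamma>)" and z: "z \<in> ball 0 1"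
    have abs_c: "summable (\<lambda>n. \<bar>c n\<bar>)"
      using sums_summable[OF coeff_sums] coeff_nonneg by simp
    show "1 - h z \<in> closure (sector \<gamma>)"
    proof (rule ritt_multiplication_imp_sector[OF abs_c h_sums[OF z] _ refl _ assms(3,4)])
      show "cmod z < 1" using z by simp
      show "power_bounded (complex_plane :: ('u + complex) normed_module) (\<lambda>x. Inr (z * projr x)) \<Longrightarrow>
        ritt_operator (complex_plane :: ('u + complex) normed_module) (op_series complex_plane c (\<lambda>x. Inr (z * projr x))) \<gamma>"
        by (rule ritt[rule_format, OF complex_plane_banach])
    qed
  qed
qed

end
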